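(* Let $G$ be a finite group with $\psi'(G) > \psi'(D_8) = \frac{19}{43}$. Then $G$ is an $M$-group. More precisely, up to isomorphism, $G$ belongs to one of the following pairwise disjoint classes of groups: (1) cyclic groups; (2) $(\mathcal{C}_{2^{k-1}}\times \mathcal{C}_2)\times \mathcal{C}_m$, where $k\geq 2$ and $m$ is odd; (3) $M(2^k)\times \mathcal{C}_m$, where $k\geq 4$ and $m$ is odd; (4) $Q_8\times \mathcal{C}_m$, where $m$ is odd; (5) $(\mathcal{C}_3\rtimes_\iota \mathcal{C}_{2^k})\times \mathcal{C}_m$, where $k\geq 1$ and $\gcd(m,6)=1$; (6) $(\mathcal{C}_5\rtimes_\iota \mathcal{C}_2)\times \mathcal{C}_m$, where $\gcd(m,10)=1$; (7) $(\mathcal{C}_5\rtimes_\iota \mathcal{C}_4)\times \mathcal{C}_m$, where $\gcd(m,10)=1$.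
   Context: For a finite group $G$, $\psi(G)=\sum_{x\in G} o(x)$ is the sum of the orders of its elements, and $\psi'(G)=\psi(G)/\psi(\mathcal{C}_{|G|})$, where $\mathcal{C}_n$ denotes the cyclic group of order $n$. $D_{2n}$ is the dihedral group of order $2n$; $Q_8$ is the quaternion group of order $8$. A group is an $M$-group if its subgroup lattice is modular, i.e. for all subgroups $H,K,L$ with $H\le L$ one has $\langle H, K\cap L\rangle=\langle H,K\rangle\cap L$. For $k\ge 4$, $M(2^k)=\langle x,y\mid x^{2^{k-1}}=y^2=1,\ yxy^{-1}=x^{2^{k-2}+1}\rangle$. If $H$ is abelian and $K$ is cyclic of even order, $H\rtimes_\iota K$ denotes the semidirect product in which a generator of $K$ acts on $H$ by the inversion automorphism $h\mapsto h^{-1}$. *)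

theory Defs
  imports "HOL-Algebra.Algebra"
begin

definition psi :: "('a, 'b) monoid_scheme \<Rightarrow> nat" where
  "psi G = (\<Sum>x\<in>carrier G. group.ord G x)"

abbreviation cyc :: "nat \<Rightarrow> int monoid" where
  "cyc n \<equiv> integer_mod_group n"

definition psi' :: "('a, 'b) monoid_scheme \<Rightarrow> real" where
  "psi' G = real (psi G) / real (psi (cyc (order G)))"

definition M_group :: "('a, 'b) monoid_scheme \<Rightarrow> bool" where
  "M_group G \<longleftrightarrow>
     (\<forall>H K L. subgroup H G \<longrightarrow> subgroup K G \<longrightarrow> subgroup L G \<longrightarrow> H \<subseteq> L \<longrightarrow>
        generate G (H \<union> (K \<inter> L)) = generate G (H \<union> K) \<inter> L)"

text \<open>M(2^k) = <x,y | x^(2^(k-1)) = y^2 = 1, y x y^-1 = x^(2^(k-2)+1)>;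
  the pair (a,b) stands for x^a y^b.\<close>
definition Mgrp :: "nat \<Rightarrow> (nat \<times> nat) monoid" where
  "Mgrp k = \<lparr>carrier = {..<2^(k-1)} \<times> {..<2},
     monoid.mult = (\<lambda>(a,b) (c,d). ((a + c * (2^(k-2) + 1)^b) mod 2^(k-1), (b + d) mod 2)),
     one = (0, 0)\<rparr>"

text \<open>Quaternion group Q_8 = <x,y | x^4 = 1, y^2 = x^2, y x y^-1 = x^-1>;
  the pair (a,b) stands for x^a y^b.\<close>
definition Q8 :: "(nat \<times> nat) monoid" where
  "Q8 = \<lparr>carrier = {..<4} \<times> {..<2},
     monoid.mult = (\<lambda>(a,b) (c,d). ((a + c * 3^b + 2 * (b * d)) mod 4, (b + d) mod 2)),
     one = (0, 0)\<rparr>"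

text \<open>C_n \<rtimes>_iota C_m (m even): a generator of C_m acts on C_n by inversion;
  the pair (a,b) stands for (h^a, g^b), with g h g^-1 = h^-1.\<close>
definition inv_sdp :: "nat \<Rightarrow> nat \<Rightarrow> (nat \<times> nat) monoid" where
  "inv_sdp n m = \<lparr>carrier = {..<n} \<times> {..<m},
     monoid.mult = (\<lambda>(a,b) (c,d). ((a + c * (n - 1)^b) mod n, (b + d) mod m)),
     one = (0, 0)\<rparr>"

definition in_class :: "nat \<Rightarrow> ('a, 'b) monoid_scheme \<Rightarrow> bool" where
  "in_class i G =
    (if i = 1 then cyclic_group G
     else if i = 2 then (\<exists>k m. k \<ge> 2 \<and> odd m \<and> G \<cong> (cyc (2^(k-1)) \<times>\<times> cyc 2) \<times>\<times> cyc m)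
     else if i = 3 then (\<exists>k m. k \<ge> 4 \<and> odd m \<and> G \<cong> Mgrp k \<times>\<times> cyc m)
     else if i = 4 then (\<exists>m. odd m \<and> G \<cong> Q8 \<times>\<times> cyc m)
     else if i = 5 then (\<exists>k m. k \<ge> 1 \<and> gcd m 6 = 1 \<and> G \<cong> inv_sdp 3 (2^k) \<times>\<times> cyc m)
     else if i = 6 then (\<exists>m. gcd m 10 = 1 \<and> G \<cong> inv_sdp 5 2 \<times>\<times> cyc m)
     else if i = 7 then (\<exists>m. gcd m 10 = 1 \<and> G \<cong> inv_sdp 5 4 \<times>\<times> cyc m)
     else False)"

end

theory Submission
  imports Defs "HOL-Number_Theory.Number_Theory"
begin

hide_const (open) Divisibility.prime

text \<open>Write \<open>c(n)\<close> for \<open>\<psi>\<close> of the cyclic group of order \<open>n\<close>. An element \<open>x\<close> of maximal order satisfies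
  \<open>\<psi>(G) \<le> |G| \<cdot> o(x)\<close>, and \<open>c(n) / n\<^sup>2\<close> is bounded below in terms of the largest prime \<open>p\<close> dividing \<open>n\<close>, so
  the hypothesis makes the index of \<open>\<langle>x\<rangle>\<close> small. Hence \<open>G\<close> has a normal cyclic Sylow \<open>p\<close>-subgroup \<open>P\<close> if
  \<open>p\<close> is odd; this is immediate when the index is less than \<open>p\<close>, and otherwise \<open>p\<close> is 3 or 5 and the
  index is 3, 4 or 5. If \<open>P\<close> is central, the kernel of the transfer to \<open>P\<close> is a direct factor and
  induction applies. If not, let \<open>C\<close> be the centralizer of \<open>P\<close>; then
  \<open>\<psi>(G) \<le> |P| \<psi>(G/P) + (c(|P|) - |P|) \<psi>(C/P)\<close> forces \<open>|P|\<close> to be 3 or 5, \<open>G/P\<close> to be cyclic and its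
  generator to invert \<open>P\<close>. When \<open>G\<close> is a 2-group, it has a cyclic subgroup of index at most 2.\<close>

subsection \<open>Sums of orders in cyclic groups\<close>

section \<open>Orders of elements and the function \<open>\<psi>\<close>\<close>

text \<open>The threshold is \<psi>(D_8) / \<psi>(C_8), where \<open>19 = 1 + 5 * 2 + 2 * 4\<close>
  and \<open>43 = 1 + 2 + 2 * 4 + 4 * 8\<close>; all estimates work with the integer inequality
  \<open>19 * cpsi (order G) < 43 * psi G\<close>. D_8 attains equality, so the case of order 8 has
  no slack, and several other estimates are nearly sharp. Averaging bounds the index of a maximal
  cyclic subgroup, but too weakly for small primes. Index 5 for the prime 5 falls to a finer
  estimate, whereas index 3 and 4 for the prime 3 need the action on the cosets, which is carried
  out by hand with transversals. In the noncentral case, the quotient and the image of the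
  centralizer are controlled through the fact that \<psi> is largest on the cyclic group of a given
  order. This is proved beforehand, by induction along a cyclic normal Sylow subgroup. Modularity is
  not extracted from the inequality: it is verified on each model group and carried over to the
  product with a cyclic group of coprime order.\<close>

text \<open>The residue \<open>i\<close> has order \<open>n div gcd n i\<close> modulo \<open>n\<close>.\<close>

definition cpsi :: "nat \<Rightarrow> nat" where
  "cpsi n = (\<Sum>i<n. n div gcd n i)"

lemma cpsi_1 [simp]: "cpsi (Suc 0) = 1"
  by (simp add: cpsi_def)

lemma cpsi_le: "cpsi n \<le> n\<^sup>2"
proof -
  have "cpsi n \<le> (\<Sum>i<n. n)"
    unfolding cpsi_def by (intro sum_mono) simp
  then show ?thesis by (simp add: power2_eq_square)
qed

lemma bij_betw_mod_pair:
  fixes a b :: nat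
  assumes "coprime a b" "a > 0" "b > 0"
  shows "bij_betw (\<lambda>i. (i mod a, i mod b)) {..<a * b} ({..<a} \<times> {..<b})"
proof (rule bij_betw_imageI)
  show inj: "inj_on (\<lambda>i. (i mod a, i mod b)) {..<a * b}"
  proof (rule inj_onI)
    fix i j assume ij: "i \<in> {..<a * b}" "j \<in> {..<a * b}" "(i mod a, i mod b) = (j mod a, j mod b)"
    then have "[i = j] (mod a)" "[i = j] (mod b)" by (auto simp: cong_def)
    then have "[i = j] (mod a * b)" using assms(1) coprime_cong_mult_nat by blast
    then show "i = j" using ij by (simp add: cong_def)
  qed
  show "(\<lambda>i. (i mod a, i mod b)) ` {..<a * b} = {..<a} \<times> {..<b}"
    by (rule card_subset_eq) (use assms inj in \<open>auto simp: card_image\<close>)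
qed

text \<open>By the Chinese remainder theorem a residue modulo \<open>a * b\<close> is a pair of
  residues, and \<open>gcd (a * b) i\<close> is the product of the two gcds, so the sum
  factors.\<close>

lemma cpsi_mult:
  assumes "coprime a b" "a > 0" "b > 0"
  shows "cpsi (a * b) = cpsi a * cpsi b"
proof -
  have "cpsi a * cpsi b = (\<Sum>(i,j)\<in>{..<a} \<times> {..<b}. (a div gcd a i) * (b div gcd b j))"
    by (simp add: cpsi_def sum_product sum.cartesian_product)
  also have "\<dots> = (\<Sum>i<a*b. (a div gcd a (i mod a)) * (b div gcd b (i mod b)))"
    by (subst sum.reindex_bij_betw [OF bij_betw_mod_pair [OF assms], symmetric]) simp
  also have "\<dots> = (\<Sum>i<a*b. (a * b) div gcd (a * b) i)"
  proof (rule sum.cong)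
    fix i
    have "gcd (a * b) i = gcd a i * gcd b i"
    proof (rule dvd_antisym)
      show "gcd a i * gcd b i dvd gcd (a * b) i"
        using assms(1) by (intro gcd_greatest mult_dvd_mono divides_mult) (auto intro: coprime_divisors [of _ a _ b])
      show "gcd (a * b) i dvd gcd a i * gcd b i"
      proof -
        obtain x y where xy: "gcd (a * b) i = x * y" "x dvd a" "y dvd b"
          using division_decomp [OF gcd_dvd1] by metis
        have "x dvd i" "y dvd i"
          using gcd_dvd2 [of "a * b" i] unfolding xy by (auto dest: dvd_mult_left dvd_mult_right)
        then show ?thesis unfolding xy by (intro mult_dvd_mono gcd_greatest xy)
      qed
    qed
    then show "(a div gcd a (i mod a)) * (b div gcd b (i mod b)) = a * b div gcd (a * b) i"
      by (simp add: div_mult_div_if_dvd gcd.commute flip: gcd_red_nat)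
  qed simp
  finally show ?thesis by (simp add: cpsi_def)
qed

text \<open>The multiples of \<open>p\<close> contribute \<open>cpsi (p ^ a)\<close>; every other
  residue is a unit and has the full order \<open>p ^ Suc a\<close>.\<close>

lemma cpsi_prime_power_Suc:
  assumes "prime p"
  shows "cpsi (p ^ Suc a) = cpsi (p ^ a) + (p ^ Suc a - p ^ a) * p ^ Suc a"
proof -
  let ?M = "(\<lambda>j. p * j) ` {..<p ^ a}"
  have p: "p > 0" using assms prime_gt_0_nat by blast
  have sub: "?M \<subseteq> {..<p ^ Suc a}" using p by auto
  have inj: "inj_on (\<lambda>j. p * j) {..<p ^ a}" using p by (auto simp: inj_on_def)
  have M: "i \<in> ?M \<longleftrightarrow> p dvd i" if "i < p ^ Suc a" for i
    using that p by (auto simp: image_def elim!: dvdE)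
  have "cpsi (p ^ Suc a) = (\<Sum>i\<in>?M. p ^ Suc a div gcd (p ^ Suc a) i)
      + (\<Sum>i\<in>{..<p ^ Suc a} - ?M. p ^ Suc a div gcd (p ^ Suc a) i)"
    unfolding cpsi_def by (subst sum.subset_diff [OF sub]) auto
  also have "(\<Sum>i\<in>?M. p ^ Suc a div gcd (p ^ Suc a) i) = cpsi (p ^ a)"
    using p by (simp add: sum.reindex [OF inj] cpsi_def gcd_mult_distrib_nat [symmetric])
  also have "(\<Sum>i\<in>{..<p ^ Suc a} - ?M. p ^ Suc a div gcd (p ^ Suc a) i)
      = (\<Sum>i\<in>{..<p ^ Suc a} - ?M. p ^ Suc a)"
  proof (rule sum.cong)
    fix i assume i: "i \<in> {..<p ^ Suc a} - ?M"
    then have "\<not> p dvd i" using M by blast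
    then have "coprime (p ^ Suc a) i" using assms by (simp add: prime_imp_coprime)
    then show "p ^ Suc a div gcd (p ^ Suc a) i = p ^ Suc a" by simp
  qed simp
  also have "\<dots> = (p ^ Suc a - p ^ a) * p ^ Suc a"
    using sub by (simp add: card_Diff_subset card_image [OF inj])
  finally show ?thesis .
qed

text \<open>Geometric summation of the recursion, with the denominator \<open>p + 1\<close> cleared
  so that everything stays in the naturals.\<close>

lemma cpsi_prime_power:
  assumes "prime p"
  shows "(p + 1) * cpsi (p ^ a) = p * (p ^ a)\<^sup>2 + 1"
proof (induction a)
  case (Suc a)
  have "p \<ge> 1" using assms by (rule prime_ge_1_nat)
  then have "(p + 1) * ((p ^ Suc a - p ^ a) * p ^ Suc a) + p * (p ^ a)\<^sup>2 = p * (p ^ Suc a)\<^sup>2"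
  proof -
    obtain r where r: "p = Suc r" using \<open>p \<ge> 1\<close> by (cases p) auto
    show ?thesis unfolding r by (simp add: power2_eq_square algebra_simps)
  qed
  then show ?case
    using Suc unfolding cpsi_prime_power_Suc [OF assms, of a] distrib_left [of "p + 1"] by linarith
qed simp

lemma cpsi_pos: "n > 0 \<Longrightarrow> cpsi n > 0"
  unfolding cpsi_def by (rule sum_pos2 [of _ 0]) auto

lemma decompose_prime_power:
  fixes n q :: nat
  assumes "prime q" "n > 0"
  obtains e m where "n = q ^ e * m" "\<not> q dvd m" "m > 0" "coprime (q ^ e) m"
proof -
  obtain m where m: "n = q ^ multiplicity q n * m" "\<not> q dvd m"
    using assms multiplicity_decompose' [of n q] by (metis not_prime_unit not_gr_zero mult.commute)
  moreover have "m > 0" using m(2) by (metis dvd_0_right gr0I)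
  ultimately show ?thesis using that assms(1) by (metis coprime_power_left_iff prime_imp_coprime)
qed

text \<open>Only the \<open>q\<close>-part of the argument changes. The quotient of
  \<open>cpsi (q ^ Suc e)\<close> by \<open>cpsi (q ^ e)\<close> is least at \<open>e = 0\<close>,
  where it equals \<open>cpsi q = q^2 - q + 1\<close>.\<close>

lemma cpsi_prime_mult:
  assumes "prime q" "k > 0"
  shows "(q\<^sup>2 - q + 1) * cpsi k \<le> cpsi (q * k)"
proof -
  obtain e m where k: "k = q ^ e * m" and m: "\<not> q dvd m"
    using decompose_prime_power [OF assms] by blast
  have m0: "m > 0" using m by (metis dvd_0_right gr0I)
  have cop: "coprime (q ^ i) m" for i
    using m assms by (simp add: prime_imp_coprime)
  have q: "q > 0" "q \<ge> 1" using assms prime_gt_0_nat by (auto simp: Suc_leI)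
  have "(q\<^sup>2 - q + 1) * cpsi (q ^ e) \<le> cpsi (q ^ Suc e)"
  proof -
    have "(q + 1) * ((q\<^sup>2 - q + 1) * cpsi (q ^ e)) = (q\<^sup>2 - q + 1) * (q * (q ^ e)\<^sup>2 + 1)"
      unfolding cpsi_prime_power [OF assms(1), of e, symmetric] by (simp only: mult_ac)
    also have "\<dots> \<le> q * (q ^ Suc e)\<^sup>2 + 1"
    proof -
      obtain r where r: "q = Suc r" using q by (cases q) auto
      have E: "q\<^sup>2 - q + 1 = r * q + 1" unfolding r by (simp add: power2_eq_square)
      have "1 \<le> (q ^ e)\<^sup>2" using q by simp
      then have "r * q \<le> (q ^ e)\<^sup>2 * (r * q)" by simp
      moreover have "q * (q ^ Suc e)\<^sup>2 = (q ^ e)\<^sup>2 * (q * (r * q)) + (q ^ e)\<^sup>2 * (r * q) + (q ^ e)\<^sup>2 * q"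
        unfolding r by (simp add: power2_eq_square algebra_simps)
      ultimately show ?thesis unfolding E by (simp add: algebra_simps)
    qed
    also have "\<dots> = (q + 1) * cpsi (q ^ Suc e)"
      using cpsi_prime_power [OF assms(1), of "Suc e"] by simp
    finally show ?thesis by (metis Suc_eq_plus1 Suc_mult_le_cancel1)
  qed
  moreover have "cpsi k = cpsi (q ^ e) * cpsi m"
    unfolding k using cop m0 q by (intro cpsi_mult) auto
  moreover have "cpsi (q * k) = cpsi (q ^ Suc e) * cpsi m"
    unfolding k using cpsi_mult [OF cop, of "Suc e"] m0 q by (simp add: mult.assoc)
  ultimately show ?thesis by (metis mult.assoc mult_le_mono1)
qed

lemma cpsi_mono_mult:
  assumes "r > 0" "k > 0"
  shows "cpsi k \<le> cpsi (r * k)"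
  using assms
proof (induction r arbitrary: k rule: less_induct)
  case (less r)
  show ?case
  proof (cases "r = 1")
    case False
    then obtain q where q: "prime q" "q dvd r" by (meson prime_factor_nat)
    then obtain s where s: "r = q * s" by auto
    have s1: "s > 0" "s < r" using less.prems s prime_gt_1_nat [OF q(1)] by auto
    have "cpsi k \<le> cpsi (s * k)" using less s1 by blast
    also have "\<dots> \<le> (q\<^sup>2 - q + 1) * cpsi (s * k)" by simp
    also have "\<dots> \<le> cpsi (q * (s * k))" using cpsi_prime_mult q s1 less.prems by simp
    finally show ?thesis by (simp add: s mult.assoc)
  qed simp
qed

lemma cpsi_mult_ge3:
  assumes "r \<ge> 2" "k > 0"
  shows "3 * cpsi k \<le> cpsi (r * k)"
proof -
  obtain q where q: "prime q" "q dvd r" using assms prime_factor_nat [of r] by fastforce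
  then obtain s where s: "r = q * s" by auto
  have s1: "s > 0" using assms s by (cases s) auto
  have q2: "q \<ge> 2" using q prime_ge_2_nat by blast
  then have "3 \<le> q\<^sup>2 - q + 1"
  proof -
    have "q * 2 \<le> q * q" using q2 by (rule mult_le_mono2)
    then show ?thesis unfolding power2_eq_square using q2 by linarith
  qed
  then have "3 * cpsi k \<le> (q\<^sup>2 - q + 1) * cpsi (s * k)"
    using cpsi_mono_mult [OF s1 assms(2)] mult_le_mono by blast
  also have "\<dots> \<le> cpsi (q * (s * k))" using cpsi_prime_mult q s1 assms by simp
  finally show ?thesis by (simp add: s mult.assoc)
qed

text \<open>An odd prime factor of \<open>r\<close> contributes at least \<open>cpsi 3 = 7\<close>.
  Without one, \<open>r\<close> is 2 times a number that is at least 2, and two factors 3 give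
  9.\<close>

lemma cpsi_mult_ge7:
  assumes "r \<ge> 3" "k > 0"
  shows "7 * cpsi k \<le> cpsi (r * k)"
proof (cases "\<exists>q. prime q \<and> q dvd r \<and> q \<ge> 3")
  case True
  then obtain q where q: "prime q" "q dvd r" "q \<ge> 3" by blast
  then obtain s where s: "r = q * s" by auto
  have s1: "s > 0" using assms s by (cases s) auto
  have "7 \<le> q\<^sup>2 - q + 1"
  proof -
    have "q * 3 \<le> q * q" using q(3) by (rule mult_le_mono2)
    then show ?thesis unfolding power2_eq_square using q(3) by linarith
  qed
  then have "7 * cpsi k \<le> (q\<^sup>2 - q + 1) * cpsi (s * k)"
    using cpsi_mono_mult [OF s1 assms(2)] by (rule mult_le_mono)
  also have "\<dots> \<le> cpsi (q * (s * k))" using cpsi_prime_mult [OF q(1), of "s * k"] s1 assms(2) by simp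
  finally show ?thesis by (simp add: s mult.assoc)
next
  case False
  have "r \<noteq> 1" using assms(1) by simp
  then obtain q where q: "prime q" "q dvd r" using prime_factor_nat by blast
  moreover have "q \<ge> 2" using q(1) by (rule prime_ge_2_nat)
  moreover have "\<not> q \<ge> 3" using False q by blast
  ultimately have "q = 2" by linarith
  then obtain s where s: "r = 2 * s" using q(2) by (auto elim: dvdE)
  have s2: "s \<ge> 2" using assms(1) s by linarith
  have "9 * cpsi k \<le> 3 * cpsi (s * k)" using cpsi_mult_ge3 [OF s2 assms(2)] by simp
  also have "\<dots> \<le> cpsi (2 * (s * k))" by (rule cpsi_mult_ge3) (use s2 assms in auto)
  finally show ?thesis by (simp add: s mult.assoc)
qed

lemma cpsi_ge_step:
  fixes A B :: nat
  assumes S: "\<And>n. n > 0 \<Longrightarrow> (\<And>r. prime r \<Longrightarrow> r dvd n \<Longrightarrow> r \<in> S) \<Longrightarrow> A * n\<^sup>2 \<le> B * cpsi n"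
    and q: "prime q" and n: "n > 0" "\<And>r. prime r \<Longrightarrow> r dvd n \<Longrightarrow> r \<in> insert q S"
  shows "(q * A) * n\<^sup>2 \<le> ((q + 1) * B) * cpsi n"
proof -
  obtain e m where m: "n = q ^ e * m" "\<not> q dvd m" "m > 0" "coprime (q ^ e) m"
    using decompose_prime_power q n(1) by blast
  have "A * m\<^sup>2 \<le> B * cpsi m"
  proof (rule S)
    fix r assume r: "prime r" "r dvd m"
    then have "r \<in> insert q S" using n(2) m(1) by auto
    then show "r \<in> S" using r m(2) by auto
  qed (rule m(3))
  moreover have "q * (q ^ e)\<^sup>2 \<le> (q + 1) * cpsi (q ^ e)"
    using cpsi_prime_power [OF q, of e] by simp
  ultimately have "(A * m\<^sup>2) * (q * (q ^ e)\<^sup>2) \<le> (B * cpsi m) * ((q + 1) * cpsi (q ^ e))"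
    by (rule mult_le_mono)
  moreover have "cpsi n = cpsi (q ^ e) * cpsi m"
    unfolding m(1) using m q by (intro cpsi_mult) (auto simp: prime_gt_0_nat)
  ultimately show ?thesis unfolding m(1) by (simp add: power_mult_distrib algebra_simps)
qed

text \<open>The counterpart from above: \<open>cpsi (q ^ Suc e)\<close> is at most
  \<open>(q^2 - q + 1) / q^2\<close> times the square of \<open>q ^ Suc e\<close>, with equality at
  \<open>e = 0\<close>.\<close>

lemma cpsi_le_step:
  fixes A B :: nat
  assumes "prime q" "\<not> q dvd m" "m > 0" "A * cpsi m \<le> B * m\<^sup>2"
  shows "(q\<^sup>2 * A) * cpsi (q ^ Suc e * m) \<le> ((q\<^sup>2 - q + 1) * B) * (q ^ Suc e * m)\<^sup>2"
proof -
  have q1: "q > 0" using assms by (simp add: prime_gt_0_nat)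
  obtain r where r: "q = Suc r" using q1 by (cases q) auto
  have E: "q\<^sup>2 - q + 1 = r * q + 1" unfolding r by (simp add: power2_eq_square)
  have "q\<^sup>2 * cpsi (q ^ Suc e) \<le> (q\<^sup>2 - q + 1) * (q ^ Suc e)\<^sup>2"
  proof -
    have "(q + 1) * (q\<^sup>2 * cpsi (q ^ Suc e)) = q\<^sup>2 * (q * (q ^ Suc e)\<^sup>2 + 1)"
      unfolding cpsi_prime_power [OF assms(1), of "Suc e", symmetric] by (simp only: mult_ac)
    also have "\<dots> = q\<^sup>2 * q * (q ^ Suc e)\<^sup>2 + q\<^sup>2" by (simp add: algebra_simps)
    also have "\<dots> \<le> q\<^sup>2 * q * (q ^ Suc e)\<^sup>2 + (q ^ Suc e)\<^sup>2"
    proof -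
      have "q \<le> q ^ Suc e" using q1 by simp
      then show ?thesis by (meson add_left_mono power_mono le0)
    qed
    also have "\<dots> = (q + 1) * ((q\<^sup>2 - q + 1) * (q ^ Suc e)\<^sup>2)"
      unfolding E unfolding r by (simp add: power2_eq_square algebra_simps)
    finally show ?thesis by (metis Suc_eq_plus1 Suc_mult_le_cancel1)
  qed
  then have "(q\<^sup>2 * cpsi (q ^ Suc e)) * (A * cpsi m)
      \<le> ((q\<^sup>2 - q + 1) * (q ^ Suc e)\<^sup>2) * (B * m\<^sup>2)"
    using assms(4) mult_le_mono by blast
  moreover have "cpsi (q ^ Suc e * m) = cpsi (q ^ Suc e) * cpsi m"
    using assms q1 by (intro cpsi_mult) (auto simp: prime_imp_coprime simp del: power_Suc)
  ultimately show ?thesis by (simp only: power_mult_distrib) (simp only: mult_ac)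
qed

lemma cpsi_le_prime:
  assumes "prime q" "q dvd n" "n > 0"
  shows "q\<^sup>2 * cpsi n \<le> (q\<^sup>2 - q + 1) * n\<^sup>2"
proof -
  obtain e m where m: "n = q ^ e * m" "\<not> q dvd m" "m > 0" "coprime (q ^ e) m"
    using decompose_prime_power assms(1,3) by blast
  then obtain e' where "e = Suc e'" using assms(2) by (cases e) auto
  then show ?thesis using cpsi_le_step [OF assms(1) m(2,3), of 1 1 e'] m(1) cpsi_le [of m] by simp
qed

lemma cpsi_le_6:
  assumes "6 dvd n" "n > 0"
  shows "12 * cpsi n \<le> 7 * n\<^sup>2"
proof -
  obtain e m where m: "n = 2 ^ e * m" "\<not> 2 dvd m" "m > 0" "coprime (2 ^ e) m"
    using decompose_prime_power [OF two_is_prime_nat assms(2)] by blast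
  have "2 dvd n" "3 dvd n" using assms(1) by (auto elim!: dvdE)
  then obtain e' where e: "e = Suc e'" using m by (cases e) auto
  have "coprime 3 (2 ^ e :: nat)" by simp
  then have "3 dvd m" using \<open>3 dvd n\<close> m(1) by (metis coprime_dvd_mult_right_iff)
  then have "9 * cpsi m \<le> 7 * m\<^sup>2" using cpsi_le_prime [of 3 m] m(3) by simp
  then have "36 * cpsi n \<le> 21 * n\<^sup>2"
    using cpsi_le_step [OF two_is_prime_nat m(2,3), of 9 7 e'] m(1) e by simp
  then show ?thesis by simp
qed

lemma cpsi_2_power_ge:
  "3 * cpsi (2 ^ a) = 2 * (2 ^ a)\<^sup>2 + 1"
  using cpsi_prime_power [OF two_is_prime_nat, of a] by simp

text \<open>The quotient \<open>43 / 11\<close> is \<open>cpsi 8 / cpsi 4\<close>. Doubling raises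
  the exponent of 2, and the growth factor of the 2-part increases with that exponent.\<close>

lemma cpsi_double:
  assumes "4 dvd k" "k > 0"
  shows "43 * cpsi k \<le> 11 * cpsi (2 * k)"
proof -
  obtain e m where m: "k = 2 ^ e * m" "\<not> 2 dvd m" "m > 0" "coprime (2 ^ e) m"
    using decompose_prime_power [OF two_is_prime_nat assms(2)] by blast
  have "coprime 2 m" using m(2) by (simp add: coprime_left_2_iff_odd)
  then have cop: "coprime (2 ^ i) m" for i by simp
  have "e \<ge> 2"
  proof (rule ccontr)
    assume "\<not> e \<ge> 2"
    then have "e = 0 \<or> e = 1" by auto
    then show False using assms(1) m by (auto elim!: dvdE)
  qed
  then obtain f where f: "e = f + 2" by (metis le_add_diff_inverse2)
  have "(16::nat) \<le> (2 ^ e)\<^sup>2" unfolding f by (simp add: power2_eq_square)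
  then have "43 * cpsi (2 ^ e) \<le> 11 * cpsi (2 ^ Suc e)"
    using cpsi_2_power_ge [of e] cpsi_2_power_ge [of "Suc e"] by (simp add: power2_eq_square)
  then have "43 * (cpsi (2 ^ e) * cpsi m) \<le> 11 * (cpsi (2 ^ Suc e) * cpsi m)"
    by (metis mult.assoc mult_le_mono1)
  then show ?thesis
    using cpsi_mult [OF cop, of e] cpsi_mult [OF cop, of "Suc e"] m(1,3) by (simp add: mult.assoc)
qed

text \<open>Each step from \<open>N\<close> to \<open>Suc N\<close> is charged the factor
  \<open>(N + 1) / (N + 2)\<close>, whether or not \<open>Suc N\<close> is prime. The product
  telescopes, which is why the bound depends on \<open>N\<close> only through
  \<open>N + 1\<close>.\<close>

lemma cpsi_ge_smooth:
  fixes A B :: nat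
  assumes base: "\<And>n. n > 0 \<Longrightarrow> (\<And>r. prime r \<Longrightarrow> r dvd n \<Longrightarrow> r \<le> N0) \<Longrightarrow> A * n\<^sup>2 \<le> ((N0 + 1) * B) * cpsi n"
    and "N0 \<le> N" "n > 0" "\<And>r. prime r \<Longrightarrow> r dvd n \<Longrightarrow> r \<le> N"
  shows "A * n\<^sup>2 \<le> ((N + 1) * B) * cpsi n"
  using assms(2-4)
proof (induction N arbitrary: n rule: dec_induct)
  case base
  then show ?case using assms(1) by blast
next
  case (step N)
  show ?case
  proof (cases "prime (Suc N)")
    case True
    have "(Suc N * A) * n\<^sup>2 \<le> ((Suc N + 1) * ((N + 1) * B)) * cpsi n"
    proof (rule cpsi_ge_step [where S = "{..N}"])
      show "\<And>n. n > 0 \<Longrightarrow> (\<And>r. prime r \<Longrightarrow> r dvd n \<Longrightarrow> r \<in> {..N}) \<Longrightarrow> A * n\<^sup>2 \<le> ((N + 1) * B) * cpsi n"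
        by (rule step.IH) auto
      show "\<And>r. prime r \<Longrightarrow> r dvd n \<Longrightarrow> r \<in> insert (Suc N) {..N}"
        using step.prems(2) by (metis atMost_iff insertI1 insertI2 le_SucE)
    qed (use True step.prems in auto)
    then have "Suc N * (A * n\<^sup>2) \<le> Suc N * (((Suc N + 1) * B) * cpsi n)"
      by (simp add: algebra_simps)
    then show ?thesis by (simp only: mult_le_cancel1)
  next
    case False
    then have "r \<le> N" if "prime r" "r dvd n" for r
      using step.prems(2) [OF that] that by (metis le_SucE)
    then have "A * n\<^sup>2 \<le> ((N + 1) * B) * cpsi n" using step.IH step.prems(1) by presburger
    also have "\<dots> \<le> ((Suc N + 1) * B) * cpsi n" by simp
    finally show ?thesis .
  qed
qed

lemma no_prime_divisor_eq_1:
  fixes n :: nat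
  assumes "n > 0" "\<And>r. prime r \<Longrightarrow> r dvd n \<Longrightarrow> r \<in> {}"
  shows "n = 1"
  using assms by (metis empty_iff prime_factor_nat)

text \<open>The telescoping bound started at 1, where only \<open>n = 1\<close> is possible. It
  suffices for the maximality of cyclic groups; the classification needs the later start at
  7.\<close>

lemma cpsi_ge_half_bound:
  assumes "n > 0" "\<And>r. prime r \<Longrightarrow> r dvd n \<Longrightarrow> r \<le> N" "N > 0"
  shows "2 * n\<^sup>2 \<le> (N + 1) * cpsi n"
proof -
  have "2 * n\<^sup>2 \<le> ((N + 1) * 1) * cpsi n"
  proof (rule cpsi_ge_smooth [where ?N0.0 = 1])
    fix n :: nat assume n: "n > 0" "\<And>r. prime r \<Longrightarrow> r dvd n \<Longrightarrow> r \<le> 1"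
    have "n = 1"
    proof (rule ccontr)
      assume "n \<noteq> 1"
      then obtain r where "prime r" "r dvd n" using prime_factor_nat by blast
      then show False using n(2) [of r] prime_ge_2_nat [of r] by simp
    qed
    then show "2 * n\<^sup>2 \<le> ((1 + 1) * 1) * cpsi n" by simp
  qed (use assms in auto)
  then show ?thesis by simp
qed

lemma prime_3: "prime (3::nat)" and prime_5: "prime (5::nat)" and prime_7: "prime (7::nat)"
  by (simp_all add: prime_nat_numeral_eq)

text \<open>The constants in the following bounds come from
  \<open>cpsi n \<ge> n\<^sup>2 \<cdot> (\<Prod>r. r / (r + 1))\<close>, where \<open>r\<close> ranges over the primes that may divide \<open>n\<close>.\<close>

lemma cpsi_ge_0:
  assumes "n > 0" "\<And>r. prime r \<Longrightarrow> r dvd n \<Longrightarrow> r \<in> {}"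
  shows "1 * n\<^sup>2 \<le> 1 * cpsi n"
  using no_prime_divisor_eq_1 [OF assms] by simp

lemma cpsi_ge_2:
  assumes "n > 0" "\<And>r. prime r \<Longrightarrow> r dvd n \<Longrightarrow> r \<in> {2}"
  shows "2 * n\<^sup>2 \<le> 3 * cpsi n"
proof -
  have "(2 * 1) * n\<^sup>2 \<le> ((2 + 1) * 1) * cpsi n"
    by (rule cpsi_ge_step [where S = "{}", OF _ two_is_prime_nat assms]) (rule cpsi_ge_0)
  then show ?thesis by simp
qed

lemma cpsi_ge_3:
  assumes "n > 0" "\<And>r. prime r \<Longrightarrow> r dvd n \<Longrightarrow> r \<in> {3}"
  shows "3 * n\<^sup>2 \<le> 4 * cpsi n"
proof -
  have "(3 * 1) * n\<^sup>2 \<le> ((3 + 1) * 1) * cpsi n"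
    by (rule cpsi_ge_step [where S = "{}", OF _ prime_3 assms]) (rule cpsi_ge_0)
  then show ?thesis by simp
qed

lemma cpsi_ge_23:
  assumes "n > 0" "\<And>r. prime r \<Longrightarrow> r dvd n \<Longrightarrow> r \<in> {3,2}"
  shows "6 * n\<^sup>2 \<le> 12 * cpsi n"
proof -
  have "(3 * 2) * n\<^sup>2 \<le> ((3 + 1) * 3) * cpsi n"
    by (rule cpsi_ge_step [where S = "{2}", OF _ prime_3 assms]) (rule cpsi_ge_2)
  then show ?thesis by simp
qed

lemma cpsi_ge_25:
  assumes "n > 0" "\<And>r. prime r \<Longrightarrow> r dvd n \<Longrightarrow> r \<in> {5,2}"
  shows "10 * n\<^sup>2 \<le> 18 * cpsi n"
proof -
  have "(5 * 2) * n\<^sup>2 \<le> ((5 + 1) * 3) * cpsi n"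
    by (rule cpsi_ge_step [where S = "{2}", OF _ prime_5 assms]) (rule cpsi_ge_2)
  then show ?thesis by simp
qed

lemma cpsi_ge_35:
  assumes "n > 0" "\<And>r. prime r \<Longrightarrow> r dvd n \<Longrightarrow> r \<in> {5,3}"
  shows "15 * n\<^sup>2 \<le> 24 * cpsi n"
proof -
  have "(5 * 3) * n\<^sup>2 \<le> ((5 + 1) * 4) * cpsi n"
    by (rule cpsi_ge_step [where S = "{3}", OF _ prime_5 assms]) (rule cpsi_ge_3)
  then show ?thesis by simp
qed

lemma cpsi_ge_235:
  assumes "n > 0" "\<And>r. prime r \<Longrightarrow> r dvd n \<Longrightarrow> r \<in> {5,3,2}"
  shows "30 * n\<^sup>2 \<le> 72 * cpsi n"
proof -
  have "(5 * 6) * n\<^sup>2 \<le> ((5 + 1) * 12) * cpsi n"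
    by (rule cpsi_ge_step [where S = "{3,2}", OF _ prime_5 assms]) (rule cpsi_ge_23)
  then show ?thesis by simp
qed

lemma cpsi_ge_2357:
  assumes "n > 0" "\<And>r. prime r \<Longrightarrow> r dvd n \<Longrightarrow> r \<in> {7,5,3,2}"
  shows "210 * n\<^sup>2 \<le> 576 * cpsi n"
proof -
  have "(7 * 30) * n\<^sup>2 \<le> ((7 + 1) * 72) * cpsi n"
    by (rule cpsi_ge_step [where S = "{5,3,2}", OF _ prime_7 assms]) (rule cpsi_ge_235)
  then show ?thesis by simp
qed

lemma prime_le_7:
  assumes "prime (r::nat)" "r \<le> 7"
  shows "r \<in> {7,5,3,2}"
proof -
  have "r = 0 \<or> r = 1 \<or> r = 2 \<or> r = 3 \<or> r = 4 \<or> r = 5 \<or> r = 6 \<or> r = 7" using assms(2) by linarith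
  moreover have "\<not> prime (4::nat)" "\<not> prime (6::nat)" by (simp_all add: prime_nat_numeral_eq)
  ultimately show ?thesis using assms(1) by auto
qed

text \<open>The telescoping product starts after the exact factors of 2, 3, 5 and 7, whose product
  \<open>210 / 576\<close> equals \<open>35 / (12 * 8)\<close>.\<close>

lemma cpsi_ge_7_bound:
  assumes "n > 0" "\<And>r. prime r \<Longrightarrow> r dvd n \<Longrightarrow> r \<le> N" "N \<ge> 7"
  shows "35 * n\<^sup>2 \<le> 12 * (N + 1) * cpsi n"
proof -
  have "35 * n\<^sup>2 \<le> ((N + 1) * 12) * cpsi n"
  proof (rule cpsi_ge_smooth [where ?N0.0 = 7])
    fix n :: nat assume "n > 0" "\<And>r. prime r \<Longrightarrow> r dvd n \<Longrightarrow> r \<le> 7"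
    then have "210 * n\<^sup>2 \<le> 576 * cpsi n" by (intro cpsi_ge_2357 prime_le_7)
    then show "35 * n\<^sup>2 \<le> ((7 + 1) * 12) * cpsi n" by simp
  qed (use assms in auto)
  then show ?thesis by (simp add: mult.commute)
qed

subsection \<open>Cyclic subgroups of small index\<close>

text \<open>In \<open>c ^ N - 1 = (c - 1) * (\<Sum>i<N. c ^ i)\<close> the sum is \<open>N\<close>
  modulo \<open>p\<close>, hence prime to \<open>p\<close>. It serves to show that a power
  automorphism of a cyclic \<open>p\<close>-group is trivial if it is trivial modulo
  \<open>p\<close> and has order prime to \<open>p\<close>.\<close>

lemma pow_congruent_1_lift:
  fixes c :: int and p :: nat
  assumes "prime p" "int p dvd c - 1" "\<not> p dvd N" "int (p ^ a) dvd c ^ N - 1"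
  shows "int (p ^ a) dvd c - 1"
proof -
  have "[(\<Sum>i<N. c ^ i) = (\<Sum>i<N. 1 ^ i)] (mod int p)"
    using assms(2) by (intro cong_sum cong_pow) (simp add: cong_iff_dvd_diff)
  then have "[(\<Sum>i<N. c ^ i) = int N] (mod int p)" by simp
  then have "\<not> int p dvd (\<Sum>i<N. c ^ i)"
    using assms(3) cong_dvd_iff int_dvd_int_iff by blast
  moreover have "prime (int p)" using assms(1) by simp
  ultimately have "coprime (int (p ^ a)) (\<Sum>i<N. c ^ i)"
    by (simp add: prime_imp_coprime)
  moreover have "c ^ N - 1 = (c - 1) * (\<Sum>i<N. c ^ i)"
    by (rule power_diff_1_eq)
  ultimately show ?thesis
    using assms(4) coprime_dvd_mult_left_iff by metis
qed

section \<open>Powers, element orders and cyclic subgroups of a finite group\<close>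

locale fin_group = group +
  assumes fin [simp, intro]: "finite (carrier G)"
begin

lemma ord_pos [simp]: "x \<in> carrier G \<Longrightarrow> 0 < ord x"
  using ord_ge_1 [OF fin] by fastforce

lemma order_pos [simp]: "0 < order G"
  using order_gt_0_iff_finite fin by blast

lemma generate_singleton:
  assumes "x \<in> carrier G"
  shows "generate G {x} = (\<lambda>i. x [^] i) ` {..<ord x}"
proof -
  have "generate G {x} = {x [^] k | k. k \<in> {0..ord x - 1}}"
    using generate_pow_nat [OF assms] ord_elems [OF fin assms] ord_pos [OF assms] by simp
  moreover have "{0..ord x - 1} = {..<ord x}" using ord_pos [OF assms] by auto
  ultimately show ?thesis by auto
qed

lemma generate_singleton_nat:
  assumes "x \<in> carrier G"
  shows "generate G {x} = range (\<lambda>i::nat. x [^] i)"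
  using generate_pow_nat [OF assms] ord_pos [OF assms] by auto

lemma inj_on_pow: "x \<in> carrier G \<Longrightarrow> inj_on (\<lambda>i. x [^] i) {..<ord x}"
  using ord_inj [of x] by (rule inj_on_subset) auto

lemma card_generate [simp]: "x \<in> carrier G \<Longrightarrow> card (generate G {x}) = ord x"
  using generate_pow_card by simp

lemma generate_subgroup [simp, intro]: "x \<in> carrier G \<Longrightarrow> subgroup (generate G {x}) G"
  using generate_is_subgroup by simp

lemma pow_in_generate [simp, intro]: "x \<in> carrier G \<Longrightarrow> x [^] (i::nat) \<in> generate G {x}"
  using generate_singleton_nat by blast

lemma self_in_generate [simp, intro]: "x \<in> carrier G \<Longrightarrow> x \<in> generate G {x}"
  by (simp add: generate.incl)

lemma pow_eq_iff_nat:
  assumes "x \<in> carrier G"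
  shows "x [^] (i::nat) = x [^] (j::nat) \<longleftrightarrow> int (ord x) dvd (int i - int j)"
  using int_pow_eq [OF assms, of "int j" "int i"] by (simp add: int_pow_int eq_commute)

lemma pow_mod_ord: "x \<in> carrier G \<Longrightarrow> x [^] (i mod ord x) = x [^] (i::nat)"
  by (simp add: pow_eq_iff_nat) (metis dvd_minus_mod dvd_diff_commute of_nat_mod)

lemma subgroup_card_dvd: "subgroup H G \<Longrightarrow> card H dvd order G"
  using lagrange by (metis dvd_triv_right)

lemma subgroup_finite: "subgroup H G \<Longrightarrow> finite H"
  using fin finite_subset subgroup.subset by blast

lemma generate_eq_generate:
  assumes "y \<in> generate G {x}" "x \<in> carrier G" "ord y = ord x"
  shows "generate G {y} = generate G {x}"
proof (rule card_subset_eq)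
  have "y \<in> carrier G" using assms generate_in_carrier by blast
  then show "generate G {y} \<subseteq> generate G {x}" "card (generate G {y}) = card (generate G {x})"
    using assms generate_subgroup_incl [of "{y}" "generate G {x}"] by simp_all
  show "finite (generate G {x})" using assms subgroup_finite by blast
qed

lemma sum_ord_generate:
  assumes "x \<in> carrier G"
  shows "(\<Sum>y\<in>generate G {x}. ord y) = cpsi (ord x)"
proof -
  have "(\<Sum>y\<in>generate G {x}. ord y) = (\<Sum>i\<in>{..<ord x}. ord (x [^] i))"
    unfolding generate_singleton [OF assms] by (rule sum.reindex [OF inj_on_pow [OF assms], simplified comp_def])
  also have "\<dots> = cpsi (ord x)"
    unfolding cpsi_def by (rule sum.cong) (use assms in \<open>auto simp: ord_pow_gen\<close>)
  finally show ?thesis .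
qed

lemma order_dvd_subgroup: 
  assumes "subgroup H G" "x \<in> H" shows "ord x dvd card H"
proof -
  have x: "x \<in> carrier G" using assms(2) subgroup.mem_carrier [OF assms(1)] by blast
  interpret H: fin_group "G\<lparr>carrier := H\<rparr>"
    using assms subgroup_imp_group subgroup_finite by (simp add: fin_group_def fin_group_axioms_def)
  have "x [^] card H = \<one>"
    using H.pow_order_eq_1 [of x] assms by (simp add: order_def flip: nat_pow_consistent)
  then show ?thesis using x by (simp add: pow_eq_id)
qed

lemma ord_subgroup:
  assumes "subgroup H G" "x \<in> H"
  shows "group.ord (G\<lparr>carrier := H\<rparr>) x = ord x"
proof -
  interpret H: group "G\<lparr>carrier := H\<rparr>"
    using assms subgroup_imp_group by simp
  have x: "x \<in> carrier G" using assms(2) subgroup.mem_carrier [OF assms(1)] by blast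
  have "\<forall>n. x [^] n = \<one> \<longleftrightarrow> H.ord x dvd n"
    using H.pow_eq_id [of x] assms by (simp flip: nat_pow_consistent)
  then show ?thesis using ord_unique [OF x] by metis
qed

lemma psi_subgroup:
  "subgroup H G \<Longrightarrow> psi (G\<lparr>carrier := H\<rparr>) = (\<Sum>x\<in>H. ord x)"
  unfolding psi_def by (intro sum.cong) (auto simp: ord_subgroup)

lemma subgroup_fin_group: "subgroup H G \<Longrightarrow> fin_group (G\<lparr>carrier := H\<rparr>)"
  using subgroup_imp_group subgroup_finite by (simp add: fin_group_def fin_group_axioms_def)

lemma order_subgroup: "order (G\<lparr>carrier := H\<rparr>) = card H"
  by (simp add: order_def)

lemma psi_le_card_mult:
  assumes "S \<subseteq> carrier G" "\<And>x. x \<in> S \<Longrightarrow> ord x \<le> M"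
  shows "(\<Sum>x\<in>S. ord x) \<le> card S * M"
  using sum_mono [of S ord "\<lambda>_. M"] assms by simp

lemma psi_split:
  assumes "S \<subseteq> carrier G"
  shows "psi G = (\<Sum>x\<in>S. ord x) + (\<Sum>x\<in>carrier G - S. ord x)"
  unfolding psi_def using sum.subset_diff [OF assms fin, of ord] by (simp add: add.commute)

lemma ex_max_ord:
  obtains x where "x \<in> carrier G" "\<And>y. y \<in> carrier G \<Longrightarrow> ord y \<le> ord x"
proof -
  have "finite (ord ` carrier G)" "ord ` carrier G \<noteq> {}" by auto
  then have "Max (ord ` carrier G) \<in> ord ` carrier G" by (rule Max_in)
  then obtain x where x: "x \<in> carrier G" "Max (ord ` carrier G) = ord x" by blast
  have "ord y \<le> ord x" if "y \<in> carrier G" for y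
    using Max_ge [OF \<open>finite (ord ` carrier G)\<close>, of "ord y"] that x(2) by simp
  then show ?thesis using that x(1) by blast
qed

lemma subgroup_pow_closed: "subgroup S G \<Longrightarrow> s \<in> S \<Longrightarrow> s [^] (k::nat) \<in> S"
  by (induction k) (simp_all add: subgroup.m_closed subgroup.one_closed)

text \<open>\<open>j\<close> is invertible modulo \<open>ord z\<close>, so \<open>z\<close> is
  itself a power of \<open>z [^] j\<close>.\<close>

lemma ord_coprime_pow_eq:
  assumes "z \<in> carrier G" "subgroup S G" "z [^] (j::nat) \<in> S" "coprime j (ord z)"
  shows "z \<in> S"
proof -
  obtain k where k: "[j * k = 1] (mod ord z)"
    using cong_solve_coprime_nat [OF assms(4)] by auto
  have "(z [^] j) [^] k = z [^] (j * k)" using assms(1) by (simp add: nat_pow_pow)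
  also have "\<dots> = z [^] (1::nat)"
  proof -
    have "[int (j * k) = int 1] (mod int (ord z))" using k cong_int_iff by blast
    then show ?thesis unfolding pow_eq_iff_nat [OF assms(1)] by (simp only: cong_iff_dvd_diff)
  qed
  finally have "z = (z [^] j) [^] k" using assms(1) by simp
  then show ?thesis using subgroup_pow_closed [OF assms(2,3), of k] by simp
qed

text \<open>If \<open>z\<close> were outside, then so would be its powers with exponents from 1 to
  \<open>p - 1\<close>, and \<open>N\<close> would contain \<open>p\<close> disjoint cosets of the
  cyclic subgroup. The ambient subgroup \<open>N\<close> is a parameter because the argument is also
  applied inside a centralizer.\<close>

lemma mem_cyclic_of_small_index:
  assumes p: "prime p" and N: "subgroup N G" "x \<in> N" "card N < p * ord x"
    and z: "z \<in> N" "z [^] (p ^ a) = \<one>"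
  shows "z \<in> generate G {x}"
proof (rule ccontr)
  assume nz: "z \<notin> generate G {x}"
  let ?S = "generate G {x}"
  have x: "x \<in> carrier G" and zc: "z \<in> carrier G" using N(2) z(1) subgroup.mem_carrier [OF N(1)] by blast+
  have S: "subgroup ?S G" using x by blast
  have SN: "?S \<subseteq> N" using N x by (simp add: generate_subgroup_incl)
  have zS: "z [^] j \<notin> ?S" if "0 < j" "j < p" for j
  proof
    assume "z [^] j \<in> ?S"
    moreover have "coprime j (ord z)"
    proof -
      have "\<not> p dvd j" using that nat_dvd_not_less by blast
      then have "coprime p j" using p prime_imp_coprime by blast
      then have "coprime j (p ^ a)" by (simp add: coprime_commute)
      moreover have "ord z dvd p ^ a" using z zc by (simp add: pow_eq_id)
      ultimately show ?thesis by (rule coprime_divisors [OF dvd_refl, rotated])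
    qed
    ultimately have "z \<in> ?S" by (rule ord_coprime_pow_eq [OF zc S])
    then show False using nz by contradiction
  qed
  have inj: "inj_on (\<lambda>(j,s). z [^] j \<otimes> s) ({..<p} \<times> ?S)"
  proof -
    have *: "i = j" if ij: "i \<le> j" "j < p" "s \<in> ?S" "t \<in> ?S" "z [^] i \<otimes> s = z [^] j \<otimes> t" for i j :: nat and s t
    proof (rule ccontr)
      assume "i \<noteq> j"
      have sc: "s \<in> carrier G" "t \<in> carrier G" using ij(3,4) subgroup.mem_carrier [OF S] by blast+
      have "z [^] j = z [^] i \<otimes> z [^] (j - i)" using zc ij(1) by (simp add: nat_pow_mult)
      then have "z [^] i \<otimes> s = z [^] i \<otimes> (z [^] (j - i) \<otimes> t)"
        unfolding ij(5) using sc zc by (simp add: m_assoc)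
      then have "s = z [^] (j - i) \<otimes> t" using sc zc by (metis l_cancel m_closed nat_pow_closed)
      then have "z [^] (j - i) = s \<otimes> inv t" using sc zc by (simp add: m_assoc)
      then have "z [^] (j - i) \<in> ?S"
        using subgroup.m_closed [OF S ij(3) subgroup.m_inv_closed [OF S ij(4)]] by simp
      then show False using zS [of "j - i"] ij \<open>i \<noteq> j\<close> by simp
    qed
    show ?thesis
    proof (rule inj_onI)
      fix v w assume vw: "v \<in> {..<p} \<times> ?S" "w \<in> {..<p} \<times> ?S"
        "(case v of (j, s) \<Rightarrow> z [^] j \<otimes> s) = (case w of (j, s) \<Rightarrow> z [^] j \<otimes> s)"
      obtain i j :: nat and s t where ij: "v = (i, s)" "w = (j, t)" by (cases v, cases w)
      have A: "i \<in> {..<p}" "s \<in> ?S" "j \<in> {..<p}" "t \<in> ?S" "z [^] i \<otimes> s = z [^] j \<otimes> t"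
        using vw unfolding ij by simp_all
      have "i = j"
      proof (cases "i \<le> j")
        case True
        show ?thesis by (rule * [OF True _ A(2,4,5)]) (use A(3) in simp)
      next
        case False
        have "j = i" by (rule * [OF _ _ A(4,2) A(5) [symmetric]]) (use A(1) False in simp_all)
        then show ?thesis by simp
      qed
      moreover have "s \<in> carrier G" "t \<in> carrier G" using A(2,4) subgroup.mem_carrier [OF S] by blast+
      ultimately show "v = w" using A(5) zc unfolding ij by simp
    qed
  qed
  have sub: "(\<lambda>(j,s). z [^] j \<otimes> s) ` ({..<p} \<times> ?S) \<subseteq> N"
  proof clarify
    fix j :: nat and s assume "s \<in> ?S"
    then have "s \<in> N" using SN by blast
    then show "z [^] j \<otimes> s \<in> N"
      using subgroup.m_closed [OF N(1)] subgroup_pow_closed [OF N(1) z(1)] by blast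
  qed
  have "card ({..<p} \<times> ?S) \<le> card N"
    by (rule card_inj_on_le [OF inj sub subgroup_finite [OF N(1)]])
  then show False using N x by (simp add: card_cartesian_product)
qed

text \<open>A cyclic group has only one subgroup of order \<open>q\<close>. This turns the knowledge
  that a conjugate stays in the cyclic subgroup into the knowledge that it stays in its Sylow
  part.\<close>

lemma mem_generate_of_pow_eq_1:
  assumes x: "x \<in> carrier G" and z: "z \<in> generate G {x}" "z [^] (q::nat) = \<one>" and q: "q dvd ord x"
  shows "z \<in> generate G {x [^] (ord x div q)}"
proof -
  obtain i :: nat where i: "z = x [^] i" using z generate_singleton_nat [OF x] by blast
  have "x [^] (i * q) = \<one>" using z x unfolding i by (simp add: nat_pow_pow)
  then have "ord x dvd i * q" using x by (simp add: pow_eq_id)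
  moreover obtain k where k: "ord x = k * q" using q by (metis dvd_def mult.commute)
  moreover have "q > 0" using k ord_pos [OF x] by (metis mult_0_right neq0_conv)
  ultimately have "k dvd i" by simp
  then obtain l where l: "i = k * l" by auto
  have "z = (x [^] k) [^] l" unfolding i l using x by (simp add: nat_pow_pow)
  moreover have "ord x div q = k" using k \<open>q > 0\<close> by simp
  ultimately show ?thesis using x by simp
qed

lemma conj_pow:
  assumes "g \<in> carrier G" "u \<in> carrier G"
  shows "(g \<otimes> u \<otimes> inv g) [^] (n::nat) = g \<otimes> u [^] n \<otimes> inv g"
proof (induction n)
  case (Suc n)
  have "inv g \<otimes> (g \<otimes> (u \<otimes> inv g)) = u \<otimes> inv g"
    using assms m_assoc [of "inv g" g "u \<otimes> inv g"] by simp
  then show ?case using assms Suc by (simp add: m_assoc)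
qed (use assms in simp)

lemma ord_conj:
  assumes "g \<in> carrier G" "u \<in> carrier G"
  shows "ord (g \<otimes> u \<otimes> inv g) = ord u"
proof -
  have "(g \<otimes> u \<otimes> inv g) [^] n = \<one> \<longleftrightarrow> u [^] n = \<one>" for n :: nat
  proof -
    have "g \<otimes> u [^] n \<otimes> inv g = \<one> \<longleftrightarrow> u [^] n = \<one>"
    proof
      assume "g \<otimes> u [^] n \<otimes> inv g = \<one>"
      then have "g \<otimes> u [^] n = g" using assms by (metis inv_closed inv_equality inv_inv m_closed nat_pow_closed)
      then show "u [^] n = \<one>" using assms by simp
    qed (use assms in simp)
    then show ?thesis using assms by (simp add: conj_pow)
  qed
  then show ?thesis using assms by (simp add: ord_unique pow_eq_id)
qed

text \<open>The index is below \<open>p\<close>, hence prime to \<open>p\<close>, so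
  \<open>ord x\<close> carries the full \<open>p\<close>-part of the order. Conjugates of elements
  of that part have \<open>p\<close>-power order and cannot leave the cyclic subgroup of
  \<open>x\<close>.\<close>

lemma normal_cyclic_of_small_index:
  assumes p: "prime p" and n: "order G = p ^ a * t" "\<not> p dvd t"
    and x: "x \<in> carrier G" "order G < p * ord x"
  obtains u where "u \<in> carrier G" "ord u = p ^ a" "generate G {u} \<lhd> G" "u \<in> generate G {x}"
proof -
  have "ord x dvd order G" using x by (simp add: ord_dvd_group_order)
  then obtain d where d: "order G = ord x * d" by auto
  then have "d < p" "d > 0" using x order_pos by (auto simp: mult.commute intro: gr0I)
  then have "\<not> p dvd d" using nat_dvd_not_less by blast
  then have "coprime (p ^ a) d" using p by (simp add: prime_imp_coprime)
  moreover have "p ^ a dvd ord x * d" using n d by simp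
  ultimately have pa: "p ^ a dvd ord x" by (simp add: coprime_dvd_mult_left_iff)
  define u where "u = x [^] (ord x div p ^ a)"
  have p0: "p ^ a > 0" using p by (simp add: prime_gt_0_nat)
  have u: "u \<in> carrier G" using x by (simp add: u_def)
  have "ord x div p ^ a \<noteq> 0" using pa ord_pos [OF x(1)] by (auto elim: dvdE)
  then have ou: "ord u = p ^ a"
    unfolding u_def using x pa p0 ord_pos [OF x(1)]
    by (subst ord_pow) (auto elim!: dvdE)
  have "generate G {u} \<lhd> G"
  proof (rule normal_invI)
    fix g h assume g: "g \<in> carrier G" and h: "h \<in> generate G {u}"
    then have hc: "h \<in> carrier G" using u generate_in_carrier by blast
    have "ord h dvd p ^ a" using order_dvd_subgroup [of "generate G {u}" h] u h ou by simp
    then have "(g \<otimes> h \<otimes> inv g) [^] (p ^ a) = \<one>"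
      using g hc by (metis inv_closed m_closed ord_conj pow_eq_id)
    moreover from this have "g \<otimes> h \<otimes> inv g \<in> generate G {x}"
      by (rule mem_cyclic_of_small_index [OF p subgroup_self, rotated -1]) (use x g hc in \<open>auto simp: order_def\<close>)
    ultimately show "g \<otimes> h \<otimes> inv g \<in> generate G {u}"
      unfolding u_def using mem_generate_of_pow_eq_1 x pa by blast
  qed (use u in simp)
  then show ?thesis using that [OF u ou] x by (simp add: u_def)
qed

end

lemma fin_group_cyc: "n > 0 \<Longrightarrow> fin_group (cyc n)"
  by (simp add: fin_group_def fin_group_axioms_def carrier_integer_mod_group)

lemma order_cyc [simp]: "order (cyc n) = n"
  by (cases "n = 0") (simp_all add: order_def carrier_integer_mod_group)

lemma psi_cyc:
  assumes "n > 0"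
  shows "psi (cyc n) = cpsi n"
proof -
  interpret C: fin_group "cyc n" using assms by (rule fin_group_cyc)
  define g where "g = (if n = 1 then 0 else 1 :: int)"
  have g: "g \<in> carrier (cyc n)" using assms by (simp add: g_def carrier_integer_mod_group)
  have "C.ord g = n"
  proof (cases "n = 1")
    case False
    have "\<forall>k::nat. g [^]\<^bsub>cyc n\<^esub> k = \<one>\<^bsub>cyc n\<^esub> \<longleftrightarrow> n dvd k"
      using False by (simp add: g_def flip: of_nat_mod dvd_eq_mod_eq_0)
    then show ?thesis using C.ord_unique [OF g] by blast
  qed (use g C.ord_id in \<open>simp add: g_def\<close>)
  moreover have "generate (cyc n) {g} = carrier (cyc n)"
  proof (rule card_subset_eq)
    show "generate (cyc n) {g} \<subseteq> carrier (cyc n)" using g by (simp add: C.generate_incl)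
    show "card (generate (cyc n) {g}) = card (carrier (cyc n))"
      using C.card_generate [OF g] \<open>C.ord g = n\<close> order_cyc [of n] by (simp add: order_def)
  qed simp
  ultimately show ?thesis using C.sum_ord_generate [OF g] by (simp add: psi_def)
qed

subsection \<open>Cyclic normal Sylow subgroups\<close>

context fin_group
begin

lemma normal_card_rcosets:
  assumes "N \<lhd> G" shows "order (G Mod N) * card N = order G"
proof -
  have "order (G Mod N) = card (rcosets N)" by (simp add: order_def FactGroup_def)
  then show ?thesis using lagrange_finite [OF fin normal_imp_subgroup [OF assms]] by simp
qed

lemma fin_group_Mod:
  assumes "N \<lhd> G" shows "fin_group (G Mod N)"
proof -
  have "order (G Mod N) \<noteq> 0"
    using normal_card_rcosets [OF assms] order_pos by (intro notI) simp
  then have "finite (carrier (G Mod N))" unfolding order_def by (rule card_ge_0_finite [OF neq0_conv [THEN iffD1]])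
  then show ?thesis
    by (simp add: fin_group_def fin_group_axioms_def normal.factorgroup_is_group [OF assms])
qed

lemma rcoset_pow_eq_one_iff:
  assumes "N \<lhd> G" "g \<in> carrier G"
  shows "(N #> g) [^]\<^bsub>G Mod N\<^esub> (k::nat) = \<one>\<^bsub>G Mod N\<^esub> \<longleftrightarrow> g [^] k \<in> N"
proof -
  have N: "subgroup N G" using assms(1) by (rule normal_imp_subgroup)
  have "(N #> g) [^]\<^bsub>G Mod N\<^esub> k = N #> g [^] k"
    by (rule normal.FactGroup_pow [OF assms])
  moreover have "N #> g [^] k = N \<longleftrightarrow> g [^] k \<in> N"
    using coset_join1 [of N "g [^] k"] coset_join2 [of "g [^] k" N] N assms(2) by blast
  ultimately show ?thesis by simp
qed

lemma ord_rcoset_dvd_iff: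
  assumes "N \<lhd> G" "g \<in> carrier G"
  shows "group.ord (G Mod N) (N #> g) dvd k \<longleftrightarrow> g [^] (k::nat) \<in> N"
proof -
  interpret H: fin_group "G Mod N" using assms(1) by (rule fin_group_Mod)
  have "N #> g \<in> carrier (G Mod N)"
    using assms(2) by (simp add: carrier_FactGroup)
  then show ?thesis using H.pow_eq_id rcoset_pow_eq_one_iff [OF assms] by metis
qed

lemma sum_carrier_rcosets:
  assumes "subgroup N G"
  shows "(\<Sum>g\<in>carrier G. f g) = (\<Sum>c\<in>rcosets N. \<Sum>g\<in>c. f g)"
proof -
  have "(\<Sum>g\<in>\<Union>(rcosets N). f g) = (sum \<circ> sum) f (rcosets N)"
  proof (rule sum.Union_disjoint)
    show "\<forall>A\<in>rcosets N. finite A"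
      using assms cosets_finite fin subgroup.subset by blast
    show "\<forall>A\<in>rcosets N. \<forall>B\<in>rcosets N. A \<noteq> B \<longrightarrow> A \<inter> B = {}"
      using rcos_disjoint [OF assms] by (auto simp: pairwise_def disjnt_def)
  qed
  then show ?thesis by (simp add: rcosets_part_G [OF assms])
qed

lemma centralizer_subgroup:
  assumes "u \<in> carrier G"
  shows "subgroup {g \<in> carrier G. g \<otimes> u = u \<otimes> g} G"
proof (rule subgroupI)
  show "{g \<in> carrier G. g \<otimes> u = u \<otimes> g} \<noteq> {}" using assms by (auto intro!: exI [of _ \<one>])
next
  fix a assume "a \<in> {g \<in> carrier G. g \<otimes> u = u \<otimes> g}"
  then have a: "a \<in> carrier G" "a \<otimes> u = u \<otimes> a" by auto
  have "inv a \<otimes> u = inv a \<otimes> (u \<otimes> a) \<otimes> inv a" using a assms by (simp add: m_assoc)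
  also have "\<dots> = u \<otimes> inv a" using a assms by (simp flip: a(2)) (simp flip: m_assoc)
  finally show "inv a \<in> {g \<in> carrier G. g \<otimes> u = u \<otimes> g}" using a by simp
next
  fix a b assume "a \<in> {g \<in> carrier G. g \<otimes> u = u \<otimes> g}" "b \<in> {g \<in> carrier G. g \<otimes> u = u \<otimes> g}"
  then have ab: "a \<in> carrier G" "a \<otimes> u = u \<otimes> a" "b \<in> carrier G" "b \<otimes> u = u \<otimes> b" by auto
  have "a \<otimes> b \<otimes> u = a \<otimes> (u \<otimes> b)" using ab assms by (simp add: m_assoc)
  also have "\<dots> = (a \<otimes> u) \<otimes> b" using ab(1,3) assms by (simp add: m_assoc)
  also have "\<dots> = (u \<otimes> a) \<otimes> b" by (simp only: ab(2))
  also have "\<dots> = u \<otimes> (a \<otimes> b)" using ab(1,3) assms by (simp add: m_assoc)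
  finally show "a \<otimes> b \<in> {g \<in> carrier G. g \<otimes> u = u \<otimes> g}" using ab by simp
qed auto

lemma conj_iter:
  assumes "g \<in> carrier G" "u \<in> carrier G" "g \<otimes> u \<otimes> inv g = u [^] (c::nat)"
  shows "g [^] (n::nat) \<otimes> u \<otimes> inv (g [^] n) = u [^] (c ^ n)"
proof (induction n)
  case (Suc n)
  have "g [^] Suc n \<otimes> u \<otimes> inv (g [^] Suc n) = g [^] n \<otimes> (g \<otimes> u \<otimes> inv g) \<otimes> inv (g [^] n)"
    using assms(1,2) by (simp add: m_assoc inv_mult_group)
  also have "\<dots> = (g [^] n \<otimes> u \<otimes> inv (g [^] n)) [^] c"
    unfolding assms(3) using assms(1,2) by (simp add: conj_pow)
  also have "\<dots> = u [^] (c ^ Suc n)"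
    unfolding Suc using assms(2) by (simp add: nat_pow_pow mult.commute)
  finally show ?case .
qed (use assms in simp)

lemma commute_iff_conj:
  assumes "g \<in> carrier G" "u \<in> carrier G"
  shows "g \<otimes> u \<otimes> inv g = u \<longleftrightarrow> g \<otimes> u = u \<otimes> g"
  using assms by (metis inv_closed inv_solve_right m_closed inv_solve_right')

lemma conj_eq_pow:
  assumes "generate G {u} \<lhd> G" "g \<in> carrier G" "u \<in> carrier G"
  obtains c :: nat where "g \<otimes> u \<otimes> inv g = u [^] c"
proof -
  have "g \<otimes> u \<otimes> inv g \<in> generate G {u}"
    using normal_invE(2) [OF assms(1,2)] assms(3) by blast
  then show ?thesis using that generate_singleton_nat [OF assms(3)] by blast
qed

text \<open>A nontrivial automorphism of \<open>p'\<close>-order of a cyclic \<open>p\<close>-group has no nontrivial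
  fixed points, so in a coset of the cyclic normal Sylow subgroup that does not centralize it
  all elements have the order of the coset.\<close>

lemma ord_noncentralizing:
  assumes p: "prime p" and u: "u \<in> carrier G" "ord u = p ^ a" "generate G {u} \<lhd> G"
    and g: "g \<in> carrier G" "g \<otimes> u \<noteq> u \<otimes> g"
    and N: "g [^] N \<in> generate G {u}" "\<not> p dvd N"
  shows "g [^] N = \<one>"
proof (rule ccontr)
  assume ne: "g [^] N \<noteq> \<one>"
  obtain j :: nat where j: "g [^] N = u [^] j"
    using N(1) generate_singleton_nat [OF u(1)] by blast
  obtain c :: nat where c: "g \<otimes> u \<otimes> inv g = u [^] c"
    using conj_eq_pow u g by blast
  \<comment> \<open>\<open>g\<close> commutes with its own power \<open>g [^] N = u [^] j\<close>.
    As that power is nontrivial, the congruence forces \<open>c\<close> to be 1 modulo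
    \<open>p\<close>.\<close>
  have "u [^] (c * j) = g \<otimes> g [^] N \<otimes> inv g"
    using conj_pow [OF g(1) u(1), of j] u(1) unfolding c j by (simp add: nat_pow_pow)
  also have "\<dots> = u [^] j"
    using g(1) nat_pow_comm [of g 1 N] unfolding j [symmetric] by (simp add: m_assoc)
  finally have "int (p ^ a) dvd (int c - 1) * int j"
    unfolding pow_eq_iff_nat [OF u(1)] u(2) by (simp add: algebra_simps)
  moreover have "\<not> int (p ^ a) dvd int j"
    using ne u unfolding j by (metis int_dvd_int_iff pow_eq_id)
  ultimately have pc: "int p dvd int c - 1"
  proof -
    assume A: "int (p ^ a) dvd (int c - 1) * int j" "\<not> int (p ^ a) dvd int j"
    have "coprime (int (p ^ a)) (int c - 1)" if "\<not> int p dvd int c - 1"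
      using that p by (simp add: prime_imp_coprime)
    then show ?thesis using A coprime_dvd_mult_right_iff by blast
  qed
  \<comment> \<open>\<open>g [^] N\<close> is a power of \<open>u\<close> and acts trivially, so
    \<open>c ^ N\<close> is 1 modulo \<open>p ^ a\<close>; this lifts to \<open>c\<close> because
    \<open>N\<close> is prime to \<open>p\<close>.\<close>
  have "u [^] (c ^ N) = g [^] N \<otimes> u \<otimes> inv (g [^] N)"
    using conj_iter [OF g(1) u(1) c] by simp
  also have "\<dots> = u"
    unfolding j using u(1) nat_pow_comm [of u j 1] by (simp add: m_assoc)
  finally have "u [^] (c ^ N) = u [^] (1::nat)" using u(1) by simp
  then have "int (p ^ a) dvd int c ^ N - 1"
    unfolding pow_eq_iff_nat [OF u(1)] u(2) by simp
  then have "int (p ^ a) dvd int c - 1"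
    by (rule pow_congruent_1_lift [OF p pc N(2)])
  then have "u [^] c = u [^] (1::nat)"
    unfolding pow_eq_iff_nat [OF u(1)] u(2) by simp
  then have "g \<otimes> u = u \<otimes> g" using c commute_iff_conj [OF g(1) u(1)] u(1) by simp
  with g(2) show False by contradiction
qed

text \<open>A splitting for a single coset: the exponent \<open>q * s\<close> is a multiple of
  \<open>q\<close>, so the resulting power has order dividing \<open>N\<close>, and it is 1 modulo
  \<open>N\<close>, so the power stays in the coset of \<open>g\<close>.\<close>

lemma coprime_part:
  assumes N: "P \<lhd> G" "card P = q" and g: "g \<in> carrier G" "g [^] N \<in> P" "coprime q N"
  obtains h where "h \<in> P #> g" "h [^] N = \<one>" "h \<in> generate G {g}"
proof -
  have P: "subgroup P G" using N(1) by (rule normal_imp_subgroup)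
  obtain s where s: "[q * s = 1] (mod N)"
    using cong_solve_coprime_nat [OF g(3)] by auto
  define h where "h = g [^] (q * s)"
  have "(g [^] N) [^] q = \<one>"
    using order_dvd_subgroup [OF P g(2)] g(1) N(2) by (simp flip: pow_eq_id)
  then have "g [^] (q * N) = \<one>" using g(1) by (simp add: nat_pow_pow mult.commute)
  then have "(g [^] (q * N)) [^] s = \<one>" by simp
  then have hN: "h [^] N = \<one>" using g(1) by (simp add: h_def nat_pow_pow mult_ac)
  have "h \<in> P #> g"
  proof (cases "q * s = 0")
    \<comment> \<open>Here \<open>N = 1\<close>. The case is separate because the other one
      subtracts 1 from \<open>q * s\<close>.\<close>
    case True
    then have "[1 = 0] (mod N)" using s cong_sym by metis
    then have "N = 1" by (simp add: cong_0_iff)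
    then have "g \<in> P" using g by simp
    then have "P #> g = P" using coset_join2 P g by blast
    moreover have "h = \<one>" using True by (auto simp: h_def)
    ultimately show ?thesis using subgroup.one_closed [OF P] by simp
  next
    case False
    have "N dvd q * s - 1" using s False by (simp add: cong_altdef_nat)
    then obtain k where "q * s - 1 = N * k" by (rule dvdE)
    then have k: "q * s = N * k + 1" using False by linarith
    have "h = (g [^] N) [^] k \<otimes> g" unfolding h_def k using g(1) by (simp add: nat_pow_pow flip: nat_pow_mult)
    then show ?thesis using subgroup_pow_closed [OF P g(2)] rcosI [OF _ subgroup.subset [OF P] g(1)] by simp
  qed
  then show ?thesis using that hN g(1) by (simp add: h_def)
qed

lemma sum_ord_centralizing_coset:
  assumes u: "u \<in> carrier G" and g: "g \<in> carrier G" "g \<otimes> u = u \<otimes> g" "g [^] N = \<one>" and N: "N > 0"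
  shows "(\<Sum>h\<in>generate G {u} #> g. ord h) \<le> N * cpsi (ord u)"
proof -
  have im: "generate G {u} #> g = (\<lambda>h. h \<otimes> g) ` generate G {u}" by (auto simp: r_coset_def)
  have sub: "generate G {u} \<subseteq> carrier G" using u by (simp add: generate_incl)
  have "(\<Sum>h\<in>generate G {u} #> g. ord h) = (\<Sum>h\<in>generate G {u}. ord (h \<otimes> g))"
    unfolding im by (rule sum.reindex [OF inj_on_subset [OF inj_on_multc [OF g(1)] sub], simplified comp_def])
  also have "\<dots> \<le> (\<Sum>h\<in>generate G {u}. N * ord h)"
  proof (rule sum_mono)
    fix h assume h: "h \<in> generate G {u}"
    then have hc: "h \<in> carrier G" using sub by blast
    obtain i :: nat where i: "h = u [^] i" using h generate_singleton_nat [OF u] by blast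
    have "h \<otimes> g = g \<otimes> h" unfolding i using group_commutes_pow [of u g i] u g by simp
    then have "(h \<otimes> g) [^] (N * ord h) = h [^] (N * ord h) \<otimes> g [^] (N * ord h)"
      using hc g(1) by (intro pow_mult_distrib)
    also have "g [^] (N * ord h) = \<one>" using g by (simp flip: nat_pow_pow)
    also have "h [^] (N * ord h) = \<one>" using hc by (simp add: pow_eq_id)
    finally have "ord (h \<otimes> g) dvd N * ord h" using hc g(1) by (simp add: pow_eq_id)
    then show "ord (h \<otimes> g) \<le> N * ord h"
      using \<open>ord (h \<otimes> g) dvd N * ord h\<close> hc N by (intro dvd_imp_le) auto
  qed
  also have "\<dots> = N * cpsi (ord u)" using sum_ord_generate [OF u] by (simp flip: sum_distrib_left)
  finally show ?thesis .
qed

text \<open>With equality, in fact: the elements of a centralizing coset \<open>c\<close> have orders \<open>ord c\<close>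
  times the orders of the elements of the Sylow subgroup.\<close>

lemma psi_le_cyclic_normal_sylow:
  fixes u p a t
  assumes p: "prime p" and n: "order G = p ^ a * t" "\<not> p dvd t"
    and u: "u \<in> carrier G" "ord u = p ^ a" "generate G {u} \<lhd> G"
  defines "H \<equiv> G Mod generate G {u}"
  defines "K \<equiv> {c \<in> carrier H. \<forall>g\<in>c. g \<otimes> u = u \<otimes> g}"
  shows "order H = t" "fin_group H" "subgroup K H"
    "K = carrier H \<longleftrightarrow> (\<forall>g\<in>carrier G. g \<otimes> u = u \<otimes> g)"
    "psi G + p ^ a * (\<Sum>c\<in>K. group.ord H c) \<le> p ^ a * psi H + cpsi (p ^ a) * (\<Sum>c\<in>K. group.ord H c)"
proof -
  define P where "P = generate G {u}"
  have P: "P \<lhd> G" using u by (simp add: P_def)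
  have PG: "subgroup P G" using P by (rule normal_imp_subgroup)
  have cP: "card P = p ^ a" using u by (simp add: P_def)
  have p0: "p ^ a > 0" using p by (simp add: prime_gt_0_nat)
  have HP: "H = G Mod P" by (simp add: H_def P_def)
  show HF: "fin_group H" unfolding HP by (rule fin_group_Mod [OF P])
  interpret H: fin_group H by (rule HF)
  interpret P: normal P G by (rule P)
  have cH: "carrier H = rcosets P" by (simp add: HP FactGroup_def)
  show oH: "order H = t"
    using normal_card_rcosets [OF P] n cP prime_gt_0_nat [OF p] by (simp add: HP mult.commute)
  define C where "C = {g \<in> carrier G. g \<otimes> u = u \<otimes> g}"
  have C: "subgroup C G" unfolding C_def by (rule centralizer_subgroup [OF u(1)])
  have "u \<in> C" using u by (simp add: C_def)
  then have PC: "P \<subseteq> C" unfolding P_def using C by (simp add: generate_subgroup_incl)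
  have coset_C: "g \<in> C" if hg: "h \<in> P #> g" "h \<in> C" "g \<in> carrier G" for g h
  proof -
    obtain v where v: "v \<in> P" "h = v \<otimes> g" using hg(1) by (auto simp: r_coset_def)
    have "v \<in> carrier G" using v(1) subgroup.mem_carrier [OF PG] by blast
    then have "g = inv v \<otimes> h" using hg(3) by (simp add: v(2) m_assoc [symmetric])
    moreover have "inv v \<in> C" using v(1) PC by (intro subgroup.m_inv_closed [OF C]) auto
    ultimately show ?thesis using hg(2) subgroup.m_closed [OF C] by simp
  qed
  have C_coset: "h \<in> C" if "h \<in> P #> g" "g \<in> C" for g h
    using that PC subgroup.m_closed [OF C] by (auto simp: r_coset_def)
  \<comment> \<open>\<open>K\<close> is the image of the centralizer \<open>C\<close> of
    \<open>u\<close>. Since \<open>P\<close> is abelian, \<open>C\<close> is a union of cosets of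
    \<open>P\<close>, so one representative decides membership.\<close>
  have KC: "P #> g \<in> K \<longleftrightarrow> g \<in> C" if g: "g \<in> carrier G" for g
  proof
    assume "P #> g \<in> K"
    then show "g \<in> C" using rcos_self [OF g PG] g unfolding K_def C_def by blast
  next
    assume "g \<in> C"
    then show "P #> g \<in> K"
      using C_coset g rcosetsI [OF subgroup.subset [OF PG] g] unfolding K_def C_def cH by blast
  qed
  have KH: "K \<subseteq> carrier H" by (auto simp: K_def)
  show "subgroup K H"
  proof (rule H.subgroupI)
    have "\<one>\<^bsub>H\<^esub> \<in> K" using KC [OF one_closed] subgroup.one_closed [OF C] coset_mult_one subgroup.subset [OF PG] by (simp add: HP)
    then show "K \<noteq> {}" by blast
  next
    fix c assume c: "c \<in> K"
    then obtain g where g: "g \<in> carrier G" "c = P #> g" using KH by (auto simp: HP carrier_FactGroup)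
    have "inv\<^bsub>H\<^esub> c = P #> inv g"
      using g c KH by (simp add: HP P.inv_FactGroup P.rcos_inv subset_iff)
    then show "inv\<^bsub>H\<^esub> c \<in> K" using KC g c subgroup.m_inv_closed [OF C] by simp
  next
    fix c d assume cd: "c \<in> K" "d \<in> K"
    then have "c \<in> carrier H" "d \<in> carrier H" using KH by blast+
    then obtain g h where g: "g \<in> carrier G" "c = P #> g" "h \<in> carrier G" "d = P #> h"
      unfolding HP carrier_FactGroup by blast
    have "c \<otimes>\<^bsub>H\<^esub> d = P #> (g \<otimes> h)" using g by (simp add: HP P.rcos_sum)
    then show "c \<otimes>\<^bsub>H\<^esub> d \<in> K" using KC g cd subgroup.m_closed [OF C] by simp
  qed (rule KH)
  show "K = carrier H \<longleftrightarrow> (\<forall>g\<in>carrier G. g \<otimes> u = u \<otimes> g)"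
  proof
    assume "K = carrier H"
    then show "\<forall>g\<in>carrier G. g \<otimes> u = u \<otimes> g"
      using KC rcosetsI [OF subgroup.subset [OF PG]] unfolding cH C_def by blast
  next
    assume "\<forall>g\<in>carrier G. g \<otimes> u = u \<otimes> g"
    then show "K = carrier H" using rcosets_part_G [OF PG] unfolding K_def cH by blast
  qed
  have ordt: "H.ord c dvd t" if "c \<in> carrier H" for c
    using H.ord_dvd_group_order [OF that] oH by simp
  have notp: "\<not> p dvd H.ord c" if "c \<in> carrier H" for c
    using ordt [OF that] n(2) dvd_trans by blast
  \<comment> \<open>By \<open>coprime_part\<close> the coset has a representative whose order
    divides the order of the coset, and that representative commutes with \<open>P\<close>.\<close>
  have A: "(\<Sum>g\<in>c. ord g) \<le> H.ord c * cpsi (p ^ a)" if c: "c \<in> K" for c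
  proof -
    have cc: "c \<in> carrier H" using c KH by blast
    then obtain g where g: "g \<in> carrier G" "c = P #> g" by (auto simp: HP carrier_FactGroup)
    have gN: "g [^] H.ord c \<in> P"
      using ord_rcoset_dvd_iff [OF P g(1)] g(2) HP by (metis dvd_refl)
    have "coprime (p ^ a) (H.ord c)" using notp [OF cc] p by (simp add: prime_imp_coprime)
    then obtain h where h: "h \<in> P #> g" "h [^] H.ord c = \<one>"
      using coprime_part [OF P cP g(1) gN] by blast
    have hc: "h \<in> carrier G" using h(1) g(1) r_coset_subset_G subgroup.subset [OF PG] by blast
    have "c = P #> h" using repr_independence [OF h(1) g(1) PG] g(2) by simp
    moreover have "h \<otimes> u = u \<otimes> h" using c h(1) g(2) by (auto simp: K_def)
    ultimately show ?thesis
      using sum_ord_centralizing_coset [OF u(1) hc _ h(2)] u(2) cc by (simp add: P_def)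
  qed
  have B: "(\<Sum>g\<in>c. ord g) \<le> p ^ a * H.ord c" if c: "c \<in> carrier H" "c \<notin> K" for c
  proof -
    obtain g where g: "g \<in> carrier G" "c = P #> g" using c by (auto simp: HP carrier_FactGroup)
    have "ord h \<le> H.ord c" if h: "h \<in> c" for h
    proof -
      have hc: "h \<in> carrier G" using h g r_coset_subset_G subgroup.subset [OF PG] by blast
      have ch: "c = P #> h" using repr_independence [OF _ g(1) PG] g(2) h by blast
      then have "h \<otimes> u \<noteq> u \<otimes> h" using KC [OF hc] c(2) hc by (auto simp: C_def)
      moreover have "h [^] H.ord c \<in> P"
        using ord_rcoset_dvd_iff [OF P hc] ch HP by (metis dvd_refl)
      ultimately have "h [^] H.ord c = \<one>"
        using ord_noncentralizing [OF p u hc _ _ notp [OF c(1)]] by (simp add: P_def)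
      then have "ord h dvd H.ord c" using hc by (simp add: pow_eq_id)
      then show ?thesis using c(1) by (simp add: dvd_imp_le)
    qed
    then have "(\<Sum>g\<in>c. ord g) \<le> card c * H.ord c" using sum_mono [of c ord "\<lambda>_. H.ord c"] by simp
    also have "card c = p ^ a" using card_rcosets_equal [OF _ subgroup.subset [OF PG], of c] c(1) cP cH by simp
    finally show ?thesis .
  qed
  have finK: "finite K" using KH finite_subset H.fin by blast
  have "psi G = (\<Sum>c\<in>carrier H. \<Sum>g\<in>c. ord g)"
    unfolding psi_def cH by (rule sum_carrier_rcosets [OF PG])
  also have "\<dots> = (\<Sum>c\<in>carrier H - K. \<Sum>g\<in>c. ord g) + (\<Sum>c\<in>K. \<Sum>g\<in>c. ord g)"
    by (rule sum.subset_diff [OF KH H.fin])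
  also have "\<dots> \<le> (\<Sum>c\<in>carrier H - K. p ^ a * H.ord c) + (\<Sum>c\<in>K. H.ord c * cpsi (p ^ a))"
    by (intro add_mono sum_mono) (use A B in auto)
  \<comment> \<open>Adding the terms for \<open>K\<close> completes the first sum to all of
    \<open>H\<close> and avoids the subtraction \<open>cpsi (p ^ a) - p ^ a\<close>.\<close>
  also have "\<dots> + p ^ a * (\<Sum>c\<in>K. H.ord c) = p ^ a * psi H + cpsi (p ^ a) * (\<Sum>c\<in>K. H.ord c)"
    unfolding psi_def sum.subset_diff [OF KH H.fin] by (simp add: sum_distrib_left sum_distrib_right algebra_simps)
  finally show "psi G + p ^ a * (\<Sum>c\<in>K. H.ord c) \<le> p ^ a * psi H + cpsi (p ^ a) * (\<Sum>c\<in>K. H.ord c)"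
    by simp
qed

end

section \<open>Isomorphism invariance, and the maximality of \<psi> on cyclic groups\<close>

lemma ord_iso:
  assumes "group G" "group H" "f \<in> iso G H" "x \<in> carrier G"
  shows "group.ord H (f x) = group.ord G x"
proof -
  interpret group_hom G H f
    using assms by (simp add: group_hom_def group_hom_axioms_def iso_imp_homomorphism)
  have inj: "inj_on f (carrier G)" using assms(3) by (simp add: iso_def bij_betw_def)
  have "f x [^]\<^bsub>H\<^esub> n = \<one>\<^bsub>H\<^esub> \<longleftrightarrow> x [^]\<^bsub>G\<^esub> n = \<one>\<^bsub>G\<^esub>" for n :: nat
    using inj assms(4) by (metis G.nat_pow_closed G.one_closed hom_nat_pow hom_one inj_on_eq_iff)
  then show ?thesis
    using H.ord_unique [of "f x"] assms(4) G.pow_eq_id by simp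
qed

lemma psi_iso:
  assumes "group G" "group H" "G \<cong> H"
  shows "psi G = psi H"
proof -
  obtain f where f: "f \<in> iso G H" using assms(3) by (auto simp: is_iso_def)
  then have "bij_betw f (carrier G) (carrier H)" by (simp add: iso_def)
  then have "psi H = (\<Sum>x\<in>carrier G. group.ord H (f x))"
    unfolding psi_def by (rule sum.reindex_bij_betw [symmetric])
  then show ?thesis unfolding psi_def using ord_iso [OF assms(1,2) f] by simp
qed

lemma (in fin_group) ex_iso_nat:
  obtains H :: "nat monoid" where "fin_group H" "G \<cong> H"
proof -
  obtain f :: "'a \<Rightarrow> nat" where f: "inj_on f (carrier G)"
    using finite_imp_inj_to_nat_seg [OF fin] by blast
  have "f \<in> iso G (image_group f G)" by (rule inj_imp_image_group_iso [OF f])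
  moreover have "group (image_group f G)" by (rule inj_imp_image_group_is_group [OF f])
  ultimately show ?thesis
    using that [of "image_group f G"]
    by (auto simp: fin_group_def fin_group_axioms_def is_iso_def image_group_carrier)
qed

lemma (in fin_group) psi_le_order_mult:
  assumes "\<And>y. y \<in> carrier G \<Longrightarrow> ord y \<le> M" shows "psi G \<le> order G * M"
  using psi_le_card_mult [OF subset_refl assms] by (simp add: psi_def order_def)

lemma largest_prime_divisor:
  fixes n :: nat
  assumes "n > 1"
  obtains p where "prime p" "p dvd n" "\<And>r. prime r \<Longrightarrow> r dvd n \<Longrightarrow> r \<le> p"
proof -
  have "finite {r. prime r \<and> r dvd n}"
    by (rule finite_subset [of _ "{..n}"]) (use assms in \<open>auto dest: dvd_imp_le\<close>)
  moreover obtain r where "prime r" "r dvd n" using assms prime_factor_nat [of n] by auto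
  ultimately show ?thesis
    using that [of "Max {r. prime r \<and> r dvd n}"] Max_in [of "{r. prime r \<and> r dvd n}"]
      Max_ge [of "{r. prime r \<and> r dvd n}"] by blast
qed

text \<open>Transporting quotients back to the type \<^typ>\<open>nat\<close> allows an induction in which
  the group is replaced by a quotient.\<close>

lemma psi_le_cpsi_nat:
  fixes G :: "nat monoid"
  assumes "fin_group G"
  shows "psi G \<le> cpsi (order G)"
  using assms
proof (induction "order G" arbitrary: G rule: less_induct)
  case less
  interpret fin_group G by (rule less.prems)
  show ?case
  proof (rule ccontr)
    assume neg: "\<not> psi G \<le> cpsi (order G)"
    have "order G > 1"
    proof (rule ccontr)
      assume "\<not> order G > 1"
      then have o1: "order G = 1" using order_pos by linarith
      have "ord y \<le> 1" if "y \<in> carrier G" for y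
        using ord_le_group_order [OF fin that] o1 by simp
      then have "psi G \<le> order G * 1" by (rule psi_le_order_mult)
      then show False using neg o1 by simp
    qed
    then obtain p where p: "prime p" "p dvd order G" "\<And>r. prime r \<Longrightarrow> r dvd order G \<Longrightarrow> r \<le> p"
      using largest_prime_divisor by blast
    obtain a t where t: "order G = p ^ a * t" "\<not> p dvd t" "t > 0" "coprime (p ^ a) t"
      using decompose_prime_power [OF p(1) order_pos] by blast
    have p2: "p \<ge> 2" using p(1) by (rule prime_ge_2_nat)
    have "a \<noteq> 0" using p(2) t by (metis mult_1 power_0)
    then have "p ^ a > 1" using p2 by (intro one_less_power) simp_all
    then have "t < order G" using t by simp
    obtain x where x: "x \<in> carrier G" "\<And>y. y \<in> carrier G \<Longrightarrow> ord y \<le> ord x" using ex_max_ord by metis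
    \<comment> \<open>A counterexample would have average order above \<open>2 / (p + 1)\<close> of
      the group order, and \<open>2 / (p + 1)\<close> is at least \<open>1 / p\<close>; so the
      cyclic subgroup of \<open>x\<close> has index below \<open>p\<close>.\<close>
    have "2 * (order G)\<^sup>2 \<le> (p + 1) * cpsi (order G)"
      using cpsi_ge_half_bound p order_pos p2 by simp
    also have "\<dots> < (p + 1) * psi G" using neg by (intro mult_strict_left_mono) simp_all
    also have "\<dots> \<le> (p + 1) * (order G * ord x)" using psi_le_order_mult [OF x(2)] by (intro mult_le_mono2)
    finally have "order G * (2 * order G) < order G * ((p + 1) * ord x)"
      by (simp add: power2_eq_square algebra_simps)
    then have "2 * order G < (p + 1) * ord x" by (simp only: mult_less_cancel1)
    moreover have "(p + 1) * ord x \<le> 2 * (p * ord x)" using p2 by simp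
    ultimately have "order G < p * ord x" by linarith
    then obtain u where u: "u \<in> carrier G" "ord u = p ^ a" "generate G {u} \<lhd> G"
      using normal_cyclic_of_small_index [OF p(1) t(1,2) x(1)] by blast
    define H where "H = G Mod generate G {u}"
    define K where "K = {c \<in> carrier H. \<forall>g\<in>c. g \<otimes>\<^bsub>G\<^esub> u = u \<otimes>\<^bsub>G\<^esub> g}"
    define S where "S = (\<Sum>c\<in>K. group.ord H c)"
    note B = psi_le_cyclic_normal_sylow [OF p(1) t(1,2) u, folded H_def, folded K_def, folded S_def]
    interpret H: fin_group H by (rule B(2))
    obtain H' :: "nat monoid" where H': "fin_group H'" "H \<cong> H'" by (rule H.ex_iso_nat)
    have "order H' = t" using H'(2) B(1) iso_same_card by (fastforce simp: order_def)
    then have "psi H' \<le> cpsi t" using less.hyps [of H'] \<open>t < order G\<close> H'(1) by simp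
    then have Ht: "psi H \<le> cpsi t" using psi_iso [of H H'] H' by (simp add: fin_group_def H.is_group)
    have "S \<le> psi H" unfolding S_def psi_def by (rule sum_mono2) (auto simp: K_def)
    have "p ^ a \<le> cpsi (p ^ a)"
    proof -
      have "(\<Sum>i<p ^ a. 1) \<le> cpsi (p ^ a)"
        unfolding cpsi_def by (rule sum_mono) (use p2 in \<open>auto simp: Suc_le_eq div_greater_zero_iff intro!: dvd_imp_le\<close>)
      then show ?thesis by simp
    qed
    then obtain d where d: "cpsi (p ^ a) = p ^ a + d" by (metis le_add_diff_inverse)
    have "psi G \<le> p ^ a * psi H + d * S" using B(5) unfolding d by (simp add: algebra_simps)
    also have "\<dots> \<le> p ^ a * psi H + d * psi H" using \<open>S \<le> psi H\<close> by simp
    also have "\<dots> = cpsi (p ^ a) * psi H" by (simp add: d algebra_simps)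
    also have "\<dots> \<le> cpsi (p ^ a) * cpsi t" using Ht by simp
    also have "\<dots> = cpsi (order G)" using cpsi_mult [OF t(4)] t(1,3) p2 by simp
    finally show False using neg by simp
  qed
qed

lemma (in fin_group) psi_le_cpsi: "psi G \<le> cpsi (order G)"
proof -
  obtain H :: "nat monoid" where H: "fin_group H" "G \<cong> H" by (rule ex_iso_nat)
  have "psi G = psi H" using psi_iso [of G H] H by (simp add: fin_group_def)
  moreover have "order G = order H" using H(2) iso_same_card by (fastforce simp: order_def)
  ultimately show ?thesis using psi_le_cpsi_nat [OF H(1)] by simp
qed

subsection \<open>The Sylow subgroup of the largest prime\<close>

context fin_group
begin

text \<open>As many elements in distinct cosets as the index allows exhaust the cosets. This
  replaces the permutation representation on the cosets in all arguments about index 2, 3 and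
  4.\<close>

lemma transversal_covers:
  assumes S: "subgroup S G" and R: "R \<subseteq> carrier G" "order G \<le> card R * card S"
    and d: "\<And>r s. r \<in> R \<Longrightarrow> s \<in> R \<Longrightarrow> r \<otimes> inv s \<in> S \<Longrightarrow> r = s"
    and g: "g \<in> carrier G"
  obtains r where "r \<in> R" "g \<otimes> inv r \<in> S"
proof -
  interpret S: subgroup S G by (rule S)
  have fR: "finite (rcosets S)" by (simp add: RCOSETS_def)
  have inj: "inj_on (\<lambda>r. S #> r) R"
  proof (rule inj_onI)
    fix r s assume rs: "r \<in> R" "s \<in> R" "S #> r = S #> s"
    then have "r \<in> carrier G" "s \<in> carrier G" using R(1) by blast+
    then have "r \<otimes> inv s \<in> S"
      using rcos_self [OF _ S, of r] S.rcos_module [OF is_group, of s r] rs(3) by simp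
    then show "r = s" using d rs by blast
  qed
  have c: "card S > 0" using S.finite_imp_card_positive fin by blast
  have "card (rcosets S) * card S = order G" using lagrange_finite [OF fin S] .
  then have "card (rcosets S) \<le> card R" using R(2) c by (metis mult_le_cancel2)
  then have "(\<lambda>r. S #> r) ` R = rcosets S"
    using R(1) S.subset by (intro card_subset_eq [OF fR])
      (auto simp: card_image [OF inj] intro!: rcosetsI antisym card_inj_on_le [OF inj _ fR])
  moreover have "S #> g \<in> rcosets S" using rcosetsI [OF S.subset g] .
  ultimately obtain r where r: "r \<in> R" "S #> g = S #> r" by (metis imageE)
  then have "r \<in> carrier G" using R(1) by blast
  then have "g \<otimes> inv r \<in> S"
    using rcos_self [OF g S] S.rcos_module [OF is_group, of r g] g r(2) by simp
  then show ?thesis using that r(1) by blast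
qed

lemma index_2_square:
  assumes M: "subgroup M G" "order G = 2 * card M" and g: "g \<in> carrier G"
  shows "g [^] (2::nat) \<in> M"
proof (cases "g \<in> M")
  case True
  then show ?thesis by (rule subgroup_pow_closed [OF M(1)])
next
  case False
  have ne: "g \<noteq> \<one>" using False subgroup.one_closed [OF M(1)] by auto
  have iM: "inv z \<in> M \<Longrightarrow> z \<in> carrier G \<Longrightarrow> z \<in> M" for z
    using subgroup.m_inv_closed [OF M(1), of "inv z"] by simp
  obtain r where r: "r \<in> {\<one>, g}" "g \<otimes> g \<otimes> inv r \<in> M"
  proof (rule transversal_covers [OF M(1), of "{\<one>, g}" "g \<otimes> g"])
    have "inv g \<notin> M" using iM g False by blast
    then show "\<And>r s. r \<in> {\<one>, g} \<Longrightarrow> s \<in> {\<one>, g} \<Longrightarrow> r \<otimes> inv s \<in> M \<Longrightarrow> r = s"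
      using False g by auto
    show "order G \<le> card {\<one>, g} * card M" using ne M(2) by simp
  qed (use g in simp_all)
  then show ?thesis using False g by (auto simp: numeral_2_eq_2 m_assoc)
qed

lemma index_2_odd:
  assumes "subgroup M G" "order G = 2 * card M" "g \<in> carrier G" "odd (ord g)"
  shows "g \<in> M"
  by (rule ord_coprime_pow_eq [OF assms(3,1) index_2_square [OF assms(1-3)]])
     (use assms(4) in \<open>simp add: coprime_left_2_iff_odd\<close>)

lemma commuting_coprime_inj:
  assumes A: "subgroup A G" and B: "subgroup B G" and "coprime (card A) (card B)"
  shows "A \<inter> B = {\<one>}" "inj_on (\<lambda>(a,b). a \<otimes> b) (A \<times> B)"
proof -
  show AB: "A \<inter> B = {\<one>}"
  proof -
    have "z = \<one>" if z: "z \<in> A" "z \<in> B" for z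
    proof -
      have "ord z dvd card A" "ord z dvd card B" using order_dvd_subgroup A B z by blast+
      then have "ord z = 1" using assms(3) by (meson coprime_def nat_dvd_1_iff_1)
      moreover have "z \<in> carrier G" using subgroup.mem_carrier [OF A z(1)] .
      ultimately show ?thesis using ord_eq_1 by blast
    qed
    then show ?thesis using subgroup.one_closed A B by blast
  qed
  show "inj_on (\<lambda>(a,b). a \<otimes> b) (A \<times> B)"
  proof (rule inj_onI)
    fix v w assume vw: "v \<in> A \<times> B" "w \<in> A \<times> B"
      "(case v of (a,b) \<Rightarrow> a \<otimes> b) = (case w of (a,b) \<Rightarrow> a \<otimes> b)"
    obtain a b c d where e: "v = (a,b)" "w = (c,d)" by (cases v, cases w)
    have m: "a \<in> A" "b \<in> B" "c \<in> A" "d \<in> B" "a \<otimes> b = c \<otimes> d" using vw unfolding e by simp_all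
    have cc: "a \<in> carrier G" "b \<in> carrier G" "c \<in> carrier G" "d \<in> carrier G"
      using m subgroup.mem_carrier [OF A] subgroup.mem_carrier [OF B] by blast+
    have "inv c \<otimes> a = inv c \<otimes> (a \<otimes> b) \<otimes> inv b" using cc by (simp add: m_assoc)
    also have "\<dots> = d \<otimes> inv b" unfolding m(5) using cc by (simp add: m_assoc [symmetric])
    finally have eq: "inv c \<otimes> a = d \<otimes> inv b" .
    have "inv c \<otimes> a \<in> A" "d \<otimes> inv b \<in> B"
      using subgroup.m_closed [OF A subgroup.m_inv_closed [OF A m(3)] m(1)]
        subgroup.m_closed [OF B m(4) subgroup.m_inv_closed [OF B m(2)]] by auto
    then have "inv c \<otimes> a \<in> A \<inter> B" "d \<otimes> inv b \<in> A \<inter> B" unfolding eq by auto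
    then have "inv c \<otimes> a = \<one>" "d \<otimes> inv b = \<one>" using AB by auto
    then have "a = c" "d = b" using cc by (metis inv_closed inv_equality inv_inv, metis inv_closed inv_equality inv_inv)
    then show "v = w" unfolding e by simp
  qed
qed

lemma product_subgroup:
  assumes A: "subgroup A G" and B: "subgroup B G" and cop: "coprime (card A) (card B)"
    and com: "\<And>a b. a \<in> A \<Longrightarrow> b \<in> B \<Longrightarrow> a \<otimes> b = b \<otimes> a"
  shows "subgroup (A <#> B) G" "card (A <#> B) = card A * card B"
proof -
  have im: "A <#> B = (\<lambda>(a,b). a \<otimes> b) ` (A \<times> B)" by (auto simp: set_mult_def)
  show "card (A <#> B) = card A * card B"
    unfolding im using card_image [OF commuting_coprime_inj(2) [OF A B cop]]
    by (simp add: card_cartesian_product)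
  show "subgroup (A <#> B) G"
  proof (rule subgroupI)
    show "A <#> B \<subseteq> carrier G" using setmult_subset_G subgroup.subset A B by blast
    show "A <#> B \<noteq> {}" unfolding im using subgroup.one_closed [OF A] subgroup.one_closed [OF B] by blast
  next
    fix z assume "z \<in> A <#> B"
    then obtain a b where z: "a \<in> A" "b \<in> B" "z = a \<otimes> b" unfolding set_mult_def by blast
    have "a \<in> carrier G" "b \<in> carrier G" using z subgroup.mem_carrier [OF A] subgroup.mem_carrier [OF B] by blast+
    then have "inv z = inv a \<otimes> inv b"
      using com [OF z(1,2)] by (simp add: z(3) inv_mult_group)
    then show "inv z \<in> A <#> B"
      using subgroup.m_inv_closed [OF A z(1)] subgroup.m_inv_closed [OF B z(2)] unfolding set_mult_def by blast
  next
    fix z w assume "z \<in> A <#> B" "w \<in> A <#> B"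
    then obtain a b c d where z: "a \<in> A" "b \<in> B" "z = a \<otimes> b" "c \<in> A" "d \<in> B" "w = c \<otimes> d"
      unfolding set_mult_def by blast
    have cc: "a \<in> carrier G" "b \<in> carrier G" "c \<in> carrier G" "d \<in> carrier G"
      using z subgroup.mem_carrier [OF A] subgroup.mem_carrier [OF B] by blast+
    have "z \<otimes> w = a \<otimes> (b \<otimes> c) \<otimes> d" using cc by (simp add: z m_assoc)
    also have "\<dots> = (a \<otimes> c) \<otimes> (b \<otimes> d)"
      unfolding com [OF z(4,2), symmetric] using cc by (simp add: m_assoc)
    finally show "z \<otimes> w \<in> A <#> B"
      using subgroup.m_closed [OF A z(1,4)] subgroup.m_closed [OF B z(2,5)] unfolding set_mult_def by blast
  qed
qed

lemma commutes_generate: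
  assumes "g \<in> carrier G" "u \<in> carrier G" "g \<otimes> u = u \<otimes> g" "v \<in> generate G {u}"
  shows "g \<otimes> v = v \<otimes> g"
proof -
  obtain i :: nat where "v = u [^] i" using assms(4) generate_singleton_nat [OF assms(2)] by blast
  then show ?thesis using group_commutes_pow [of u g i] assms(1-3) by simp
qed

lemma normal_generateI':
  assumes "u \<in> carrier G" "\<And>g. g \<in> carrier G \<Longrightarrow> g \<otimes> u \<otimes> inv g \<in> generate G {u}"
  shows "generate G {u} \<lhd> G"
proof (rule normal_invI)
  fix g h assume g: "g \<in> carrier G" and "h \<in> generate G {u}"
  then obtain i :: nat where "h = u [^] i" using generate_singleton_nat [OF assms(1)] by blast
  then have "g \<otimes> h \<otimes> inv g = (g \<otimes> u \<otimes> inv g) [^] i" using conj_pow g assms(1) by simp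
  then show "g \<otimes> h \<otimes> inv g \<in> generate G {u}"
    using subgroup_pow_closed [OF generate_subgroup [OF assms(1)] assms(2) [OF g]] by simp
qed (use assms in simp)

text \<open>In the next lemma a non-normal \<open>\<langle>u\<rangle>\<close> has exactly four conjugates, as for \<open>A\<^sub>4\<close>. The elements of
  maximal order then lie in the four conjugates of \<open>\<langle>x\<rangle>\<close>, so they are too few.\<close>

lemma normal_sylow_3_index_4:
  assumes n: "order G = 3 ^ a * t" "\<not> 3 dvd t" "a > 0" "\<not> 5 dvd order G"
    and x: "x \<in> carrier G" "\<And>y. y \<in> carrier G \<Longrightarrow> ord y \<le> ord x" "order G = 4 * ord x"
    and psi: "31 * (order G)\<^sup>2 < 144 * psi G"
  obtains u where "u \<in> carrier G" "ord u = 3 ^ a" "generate G {u} \<lhd> G"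
proof -
  define m where "m = ord x"
  have m: "order G = 4 * m" using x by (simp add: m_def)
  have cop34: "coprime 3 (4::nat)" using prime_imp_coprime [OF prime_3, of 4] by simp
  then have "coprime (3 ^ a) (4::nat)" by simp
  then have am: "3 ^ a dvd m" using n(1) m by (metis coprime_dvd_mult_right_iff dvd_triv_left)
  obtain k where k: "m = 3 ^ a * k" using am by auto
  have k0: "k > 0" using k ord_pos [OF x(1)] m_def by (metis gr0I mult_0_right less_irrefl)
  define u where "u = x [^] (m div 3 ^ a)"
  have u: "u \<in> carrier G" using x by (simp add: u_def)
  have mk: "m div 3 ^ a = k" using k by simp
  have ou: "ord u = 3 ^ a"
    unfolding u_def mk using ord_pow [OF x(1), of k] k k0 by (simp add: m_def)
  define S where "S = generate G {x}"
  have S: "subgroup S G" "card S = m" "x \<in> S" using x by (auto simp: S_def m_def)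
  have Scomm: "b \<otimes> c = c \<otimes> b" if "b \<in> S" "c \<in> S" for b c
  proof -
    have "b \<in> carrier G" using that subgroup.mem_carrier [OF S(1)] by blast
    moreover have "x \<otimes> b = b \<otimes> x" using commutes_generate [OF x(1) x(1)] that by (simp add: S_def)
    ultimately show ?thesis using commutes_generate [of b x c] x(1) that by (simp add: S_def)
  qed
  have in_u: "z \<in> generate G {u}" if "z \<in> S" "z [^] ((3::nat) ^ a) = \<one>" for z
    using mem_generate_of_pow_eq_1 [OF x(1)] that am unfolding u_def S_def m_def by blast
  have "generate G {u} \<lhd> G"
  proof (rule ccontr)
    assume nn: "\<not> generate G {u} \<lhd> G"
    define C where "C = {g \<in> carrier G. g \<otimes> u = u \<otimes> g}"
    have C: "subgroup C G" unfolding C_def by (rule centralizer_subgroup [OF u])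
    have uS: "u \<in> S" by (simp add: S_def u_def x)
    then have SC: "S \<subseteq> C" unfolding C_def using Scomm subgroup.mem_carrier [OF S(1)] by blast
    have "m dvd card C"
    proof -
      have "m dvd card C" using order_dvd_subgroup [OF C, of x] SC S(3) by (auto simp: m_def)
      then show ?thesis .
    qed
    \<comment> \<open>\<open>j\<close> is the index of the cyclic subgroup \<open>S\<close> in
      \<open>C\<close>. If it is 4, then \<open>u\<close> is central. If it is 2, every conjugate of
      \<open>u\<close> has odd order, so it lies in \<open>C\<close> and then in \<open>S\<close>.
      Both make the subgroup of \<open>u\<close> normal, which leaves \<open>C = S\<close>.\<close>
    then obtain j where j: "card C = m * j" by auto
    have "m > 0" using x by (simp add: m_def)
    have "card C dvd 4 * m" using subgroup_card_dvd [OF C] m by simp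
    then have "j dvd 4" using \<open>m > 0\<close> j by (simp add: mult.commute)
    moreover have "j \<le> 4" using dvd_imp_le [OF \<open>j dvd 4\<close>] by simp
    ultimately have "j = 1 \<or> j = 2 \<or> j = 4"
    proof -
      have "j = 0 \<or> j = 1 \<or> j = 2 \<or> j = 3 \<or> j = 4" using \<open>j \<le> 4\<close> by linarith
      then show ?thesis using \<open>j dvd 4\<close> by auto
    qed
    moreover have "j \<noteq> 4"
    proof
      assume "j = 4"
      then have "C = carrier G" using j m card_subset_eq [OF fin subgroup.subset [OF C]] by (simp add: order_def mult.commute)
      then have "g \<otimes> u \<otimes> inv g = u" if "g \<in> carrier G" for g
        using commute_iff_conj [OF that u] that C_def by blast
      then have "generate G {u} \<lhd> G" using normal_generateI' u by simp
      with nn show False by contradiction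
    qed
    moreover have "j \<noteq> 2"
    proof
      assume j2: "j = 2"
      have "g \<otimes> u \<otimes> inv g \<in> generate G {u}" if g: "g \<in> carrier G" for g
      proof -
        define w where "w = g \<otimes> u \<otimes> inv g"
        have w: "w \<in> carrier G" "ord w = 3 ^ a" using g u ord_conj ou by (auto simp: w_def)
        then have w1: "w [^] ((3::nat) ^ a) = \<one>" by (simp add: pow_eq_id)
        have "w \<in> C" by (rule index_2_odd [OF C]) (use j j2 m w in auto)
        then have "w \<in> S"
          unfolding S_def using mem_cyclic_of_small_index [OF prime_3 C _ _ _ w1] SC S(3) j j2 \<open>m > 0\<close>
          by (auto simp: m_def)
        then show ?thesis using in_u w1 by (simp add: w_def)
      qed
      then show False using nn normal_generateI' u by blast
    qed
    ultimately have "card C = m" using j by simp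
    then have CS: "C = S" using card_subset_eq [OF subgroup_finite [OF C] SC] S(2) by simp
    \<comment> \<open>The subgroup of index 3 in \<open>S\<close>. Its elements have order at most
      \<open>q = m / 3\<close>, so the elements of order \<open>m\<close> in \<open>S\<close> lie in
      \<open>B\<close>, which has \<open>2 * q\<close> elements.\<close>
    define T where "T = generate G {x [^] (3::nat)}"
    have "(3::nat) dvd 3 ^ a" using n(3) by simp
    then have "3 dvd m" using am by (rule dvd_trans)
    then obtain q where q: "m = 3 * q" by auto
    have "ord (x [^] (3::nat)) = q" using ord_pow [OF x(1), of 3] \<open>3 dvd m\<close> q by (simp add: m_def)
    then have T: "subgroup T G" "card T = q" "T \<subseteq> S"
      using x generate_subgroup_incl [of "{x [^] (3::nat)}" S] S(1) by (auto simp: T_def S_def)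
    have q0: "q > 0" using q \<open>m > 0\<close> by simp
    have Tord: "ord z \<le> q" if "z \<in> T" for z
      using order_dvd_subgroup [OF T(1) that] T(2) q0 by (simp add: dvd_imp_le)
    define B where "B = S - T"
    have fS: "finite S" using subgroup_finite S by blast
    have cB: "card B = 2 * q"
      unfolding B_def using T S q fS by (simp add: card_Diff_subset finite_subset)
    define A where "A = {y \<in> carrier G. ord y = m}"
    \<comment> \<open>The conjugates of \<open>B\<close> by the elements of one coset. Since
      \<open>S\<close> is abelian, any element of the coset gives the same conjugates, so each of
      the four cosets accounts for at most \<open>2 * q\<close> elements.\<close>
    define F where "F = (\<lambda>c. {inv h \<otimes> b \<otimes> h | h b. h \<in> c \<and> b \<in> B})"
    have AF: "A \<subseteq> (\<Union>c\<in>rcosets S. F c)"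
    proof
      fix y assume "y \<in> A"
      then have y: "y \<in> carrier G" "ord y = m" by (auto simp: A_def)
      define v where "v = y [^] k"
      have v: "v \<in> carrier G" using y by (simp add: v_def)
      have ov: "ord v = 3 ^ a" unfolding v_def using ord_pow [OF y(1), of k] k k0 y(2) by simp
      have v1: "v [^] ((3::nat) ^ a) = \<one>" using v ov by (simp add: pow_eq_id)
      have imp: "v \<in> S" if "v [^] i \<in> S" "i = 1 \<or> i = 2 \<or> i = 4" for i :: nat
      proof (rule ord_coprime_pow_eq [OF v S(1) that(1)])
        have "coprime (i::nat) 3" using that(2) cop34 by (auto simp: coprime_commute)
        then show "coprime i (ord v)" by (simp add: ov)
      qed
      \<comment> \<open>A 3-element permuting four cosets fixes one of them. Explicitly: if
        \<open>v\<close> is not in \<open>S\<close>, then \<open>v [^] 3\<close> is, so the cosets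
        of 1, \<open>v\<close> and \<open>v [^] 2\<close> form an orbit, and the remaining coset,
        that of \<open>g\<close>, must be fixed by \<open>v\<close>.\<close>
      have "\<exists>g\<in>carrier G. g \<otimes> v \<otimes> inv g \<in> S"
      proof (cases "v \<in> S")
        case True
        then show ?thesis using v by (intro bexI [of _ \<one>]) simp_all
      next
        case False
        have ivS: "inv z \<in> S \<Longrightarrow> z \<in> carrier G \<Longrightarrow> z \<in> S" for z
          using subgroup.m_inv_closed [OF S(1), of "inv z"] by simp
        have vd: "v [^] i \<otimes> inv (v [^] j) = v [^] (i - j)" if "j \<le> i" for i j :: nat
        proof -
          have "v [^] i = v [^] (i - j) \<otimes> v [^] j" using that v by (simp add: nat_pow_mult)
          then show ?thesis using v by (simp add: m_assoc)
        qed
        have vd': "v [^] (i - j) \<in> S" if "v [^] i \<otimes> inv (v [^] j) \<in> S \<or> v [^] j \<otimes> inv (v [^] i) \<in> S" "j \<le> i" for i j :: nat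
        proof -
          have "inv (v [^] j \<otimes> inv (v [^] i)) = v [^] i \<otimes> inv (v [^] j)" using v by (simp add: inv_mult_group)
          then have "v [^] i \<otimes> inv (v [^] j) \<in> S" using that(1) subgroup.m_inv_closed [OF S(1)] by metis
          then show ?thesis using vd [OF that(2)] by simp
        qed
        have n12: "v [^] (1::nat) \<notin> S" "v [^] (2::nat) \<notin> S" "v [^] (4::nat) \<notin> S"
          using imp False by blast+
        have v3: "v [^] (3::nat) \<in> S"
        proof (rule ccontr)
          assume n3: "v [^] (3::nat) \<notin> S"
          have nS: "v [^] i \<notin> S" if "0 < i" "i \<le> 4" for i :: nat
          proof -
            have "i = 1 \<or> i = 2 \<or> i = 3 \<or> i = 4" using that by linarith
            then show ?thesis using n12 n3 by auto
          qed
          let ?R = "(\<lambda>i. v [^] i) ` {..<4::nat}"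
          have d: "i = j" if "i < 4" "j < 4" "v [^] i \<otimes> inv (v [^] j) \<in> S" for i j :: nat
          proof (rule ccontr)
            assume "i \<noteq> j"
            then consider "j < i" | "i < j" by linarith
            then show False
              by cases (use vd' [of i j] vd' [of j i] nS [of "i - j"] nS [of "j - i"] that in auto)
          qed
          have "inj_on (\<lambda>i. v [^] i) {..<4::nat}"
          proof (rule inj_onI)
            fix i j :: nat assume "i \<in> {..<4}" "j \<in> {..<4}" "v [^] i = v [^] j"
            then show "i = j" using d [of i j] v subgroup.one_closed [OF S(1)] by simp
          qed
          then have cR: "card ?R = 4" by (simp add: card_image)
          obtain r where r: "r \<in> ?R" "v [^] (4::nat) \<otimes> inv r \<in> S"
            by (rule transversal_covers [OF S(1), of ?R "v [^] (4::nat)"])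
               (use v cR m S(2) d in auto)
          then obtain i :: nat where i: "i < 4" "v [^] (4::nat) \<otimes> inv (v [^] i) \<in> S" by auto
          then show False using vd [of i 4] nS [of "4 - i"] by simp
        qed
        have vmod: "v [^] i \<in> S \<Longrightarrow> 3 dvd i" for i :: nat
        proof (rule ccontr)
          assume "v [^] i \<in> S" "\<not> 3 dvd i"
          then have "coprime 3 i" using prime_3 prime_imp_coprime by blast
          then have "coprime i (ord v)" by (simp add: ov coprime_commute)
          then show False using ord_coprime_pow_eq [OF v S(1) \<open>v [^] i \<in> S\<close>] False by blast
        qed
        have "card (S \<union> (S #> v) \<union> (S #> v [^] (2::nat))) \<le> 3 * m"
        proof -
          have "card (S #> z) = m" if "z \<in> carrier G" for z
            using card_rcosets_equal [OF rcosetsI [OF subgroup.subset [OF S(1)] that] subgroup.subset [OF S(1)]] S(2) by simp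
          then show ?thesis
            using card_Un_le [of "S \<union> (S #> v)" "S #> v [^] (2::nat)"] card_Un_le [of S "S #> v"] v S(2) by simp
        qed
        then have "card (S \<union> (S #> v) \<union> (S #> v [^] (2::nat))) < card (carrier G)"
          using m \<open>m > 0\<close> by (simp add: order_def)
        then have "\<not> carrier G \<subseteq> S \<union> (S #> v) \<union> (S #> v [^] (2::nat))"
          using card_mono fS by (metis (no_types, lifting) finite_Un fin not_less v nat_pow_closed rcosetsI rcosets_finite S(1) subgroup.subset)
        then obtain g where g: "g \<in> carrier G" "g \<notin> S" "g \<notin> S #> v" "g \<notin> S #> v [^] (2::nat)" by blast
        have gi: "g \<otimes> inv (v [^] i) \<notin> S" if "i < 3" for i :: nat
        proof -
          have "i = 0 \<or> i = 1 \<or> i = 2" using that by linarith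
          moreover have "z \<in> carrier G \<Longrightarrow> g \<notin> S #> z \<Longrightarrow> g \<otimes> inv z \<notin> S" for z
            using subgroup.rcos_module [OF S(1) is_group] g(1) by blast
          ultimately show ?thesis using g v by auto
        qed
        have gS: "g \<otimes> v [^] i \<notin> S" for i :: nat
        proof
          assume A: "g \<otimes> v [^] i \<in> S"
          \<comment> \<open>The exponent below 3 that completes \<open>i\<close> to a multiple of 3,
            since \<open>i + 2 * i\<close> is one.\<close>
          define r where "r = (2 * i) mod 3"
          have "(i + r) mod 3 = (i + 2 * i) mod 3" unfolding r_def by (rule mod_add_right_eq)
          then have "3 dvd i + r" by (simp add: dvd_eq_mod_eq_0)
          then obtain l where l: "i + r = 3 * l" by auto
          have "g \<otimes> v [^] i = g \<otimes> inv (v [^] r) \<otimes> (v [^] (3::nat)) [^] l"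
          proof -
            have "(v [^] (3::nat)) [^] l = v [^] (r + i)" using v l by (simp add: nat_pow_pow add.commute)
            also have "\<dots> = v [^] r \<otimes> v [^] i" using v by (simp add: nat_pow_mult)
            finally show ?thesis using v g(1) by (simp add: m_assoc) (simp flip: m_assoc)
          qed
          moreover have s: "(v [^] (3::nat)) [^] l \<in> S" by (rule subgroup_pow_closed [OF S(1) v3])
          ultimately have "g \<otimes> inv (v [^] r) \<otimes> (v [^] (3::nat)) [^] l \<otimes> inv ((v [^] (3::nat)) [^] l) \<in> S"
            using subgroup.m_closed [OF S(1) A subgroup.m_inv_closed [OF S(1) s]] by simp
          then have "g \<otimes> inv (v [^] r) \<in> S" using g v by (simp add: m_assoc)
          then show False using gi [of r] by (simp add: r_def)
        qed
        let ?R = "insert g ((\<lambda>i. v [^] i) ` {..<3::nat})"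
        have d: "i = j" if "i < 3" "j < 3" "v [^] i \<otimes> inv (v [^] j) \<in> S" for i j :: nat
        proof (rule ccontr)
          assume "i \<noteq> j"
          then consider "j < i" | "i < j" by linarith
          then show False
            by cases (use vd' [of i j] vd' [of j i] vmod [of "i - j"] vmod [of "j - i"] that in \<open>auto dest: dvd_imp_le\<close>)
        qed
        have inj: "inj_on (\<lambda>i. v [^] i) {..<3::nat}"
        proof (rule inj_onI)
          fix i j :: nat assume "i \<in> {..<3}" "j \<in> {..<3}" "v [^] i = v [^] j"
          then show "i = j" using d [of i j] v subgroup.one_closed [OF S(1)] by simp
        qed
        have gv: "g \<noteq> v [^] i" if "i < 3" for i :: nat
          using gi [OF that] v subgroup.one_closed [OF S(1)] by auto
        have gi': "v [^] i \<otimes> inv g \<notin> S" if "i < 3" for i :: nat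
        proof
          assume "v [^] i \<otimes> inv g \<in> S"
          then have "inv (v [^] i \<otimes> inv g) \<in> S" by (rule subgroup.m_inv_closed [OF S(1)])
          then show False using gi [OF that] g v by (simp add: inv_mult_group)
        qed
        have "g \<notin> (\<lambda>i. v [^] i) ` {..<3::nat}" using gv by auto
        then have cR: "card ?R = 4" using card_image [OF inj] by simp
        obtain r where r: "r \<in> ?R" "g \<otimes> v \<otimes> inv r \<in> S"
        proof (rule transversal_covers [OF S(1), of ?R "g \<otimes> v"])
          show "order G \<le> card ?R * card S" unfolding cR using m S(2) by simp
          show "r = s" if "r \<in> ?R" "s \<in> ?R" "r \<otimes> inv s \<in> S" for r s
            using that d gi gi' by auto
        qed (use g v in auto)
        show ?thesis
        proof (cases "r = g")
          case True
          then show ?thesis using r g by blast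
        next
          case False
          then obtain i :: nat where i: "i < 3" "r = v [^] i" using r(1) by auto
          define l where "l = 3 - i"
          have "v [^] (3::nat) = v [^] i \<otimes> v [^] l" using i v by (simp add: nat_pow_mult l_def)
          then have "g \<otimes> v \<otimes> inv (v [^] i) \<otimes> v [^] (3::nat) = g \<otimes> (v \<otimes> v [^] l)"
            using g(1) v by (simp add: m_assoc) (simp flip: m_assoc)
          also have "\<dots> = g \<otimes> v [^] Suc l" using v by (simp only: nat_pow_Suc2)
          finally have "g \<otimes> v [^] Suc l \<in> S"
            using subgroup.m_closed [OF S(1) r(2) v3] i by simp
          then show ?thesis using gS by blast
        qed
      qed
      then obtain g where g: "g \<in> carrier G" "g \<otimes> v \<otimes> inv g \<in> S" by blast
      \<comment> \<open>\<open>z\<close> generates the same subgroup as \<open>u\<close>. The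
        conjugate \<open>b\<close> of \<open>y\<close> commutes with its power \<open>z\<close>,
        hence with \<open>u\<close>, and so lies in \<open>C = S\<close>.\<close>
      define z where "z = g \<otimes> v \<otimes> inv g"
      have zc: "z \<in> carrier G" and oz: "ord z = 3 ^ a" using g v ord_conj ov by (auto simp: z_def)
      have "z [^] ((3::nat) ^ a) = \<one>" using zc oz by (simp add: pow_eq_id)
      then have "z \<in> generate G {u}" using in_u g(2) by (simp add: z_def)
      then have "generate G {z} = generate G {u}" using generate_eq_generate u oz ou by simp
      then have uz: "u \<in> generate G {z}" using u by simp
      define b where "b = g \<otimes> y \<otimes> inv g"
      have bc: "b \<in> carrier G" "ord b = m" using g y ord_conj by (auto simp: b_def)
      have "b [^] k = z" unfolding b_def z_def v_def using conj_pow g y by simp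
      then have "b \<otimes> z = z \<otimes> b" using nat_pow_comm [of b 1 k] bc by simp
      then have "b \<otimes> u = u \<otimes> b" using commutes_generate [OF bc(1) zc _ uz] by simp
      then have "b \<in> S" using bc CS by (auto simp: C_def)
      moreover have "b \<notin> T" using Tord [of b] bc q q0 by auto
      ultimately have bB: "b \<in> B" by (simp add: B_def)
      have "y = inv g \<otimes> b \<otimes> g" unfolding b_def using g y by (simp add: m_assoc) (simp flip: m_assoc)
      then have "y \<in> F (S #> g)"
        unfolding F_def using bB rcos_self [OF g(1) S(1)] by blast
      then show "y \<in> (\<Union>c\<in>rcosets S. F c)" using rcosetsI [OF subgroup.subset [OF S(1)] g(1)] by blast
    qed
    have cF: "finite (F c) \<and> card (F c) \<le> 2 * q" if cc: "c \<in> rcosets S" for c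
    proof -
      obtain g where g: "g \<in> carrier G" "c = S #> g" using cc by (auto simp: RCOSETS_def)
      have "F c \<subseteq> (\<lambda>b. inv g \<otimes> b \<otimes> g) ` B"
      proof
        fix y assume "y \<in> F c"
        then obtain h b where h: "h \<in> S #> g" "b \<in> B" "y = inv h \<otimes> b \<otimes> h" by (auto simp: F_def g)
        then obtain s where s: "s \<in> S" "h = s \<otimes> g" by (auto simp: r_coset_def)
        have sb: "s \<in> carrier G" "b \<in> carrier G" "b \<in> S"
          using s h subgroup.mem_carrier [OF S(1)] by (auto simp: B_def)
        have "y = inv g \<otimes> (inv s \<otimes> (b \<otimes> s)) \<otimes> g" using sb g by (simp add: h s inv_mult_group m_assoc)
        also have "inv s \<otimes> (b \<otimes> s) = b" unfolding Scomm [OF sb(3) s(1)] using sb by (simp flip: m_assoc)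
        finally show "y \<in> (\<lambda>b. inv g \<otimes> b \<otimes> g) ` B" using h(2) by blast
      qed
      moreover have "finite B" using fS by (simp add: B_def)
      ultimately show ?thesis
        using card_mono [of "(\<lambda>b. inv g \<otimes> b \<otimes> g) ` B" "F c"] card_image_le [of B "\<lambda>b. inv g \<otimes> b \<otimes> g"] cB
        by (auto intro: finite_subset)
    qed
    have cR: "card (rcosets S) = 4" using lagrange_finite [OF fin S(1)] m S(2) \<open>m > 0\<close> by simp
    then have fR: "finite (rcosets S)" by (simp add: card_ge_0_finite)
    have "card A \<le> card (\<Union>c\<in>rcosets S. F c)"
      by (rule card_mono [OF _ AF]) (use fR cF in auto)
    also have "\<dots> \<le> (\<Sum>c\<in>rcosets S. card (F c))" by (rule card_UN_le [OF fR])
    also have "\<dots> \<le> (\<Sum>c\<in>rcosets S. 2 * q)" by (rule sum_mono) (use cF in auto)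
    also have "\<dots> = 8 * q" using cR by simp
    finally have cA: "card A \<le> 8 * q" .
    have AT: "A \<inter> T = {}" using Tord q q0 by (force simp: A_def)
    have sub: "A \<union> T \<subseteq> carrier G" using subgroup.subset [OF T(1)] by (auto simp: A_def)
    have fA: "finite A" "finite T" using fin subgroup_finite T(1) by (auto simp: A_def)
    \<comment> \<open>An order other than \<open>m\<close> has index above 4, and 5 does not divide
      the group order, so the index is at least 6.\<close>
    have rest: "ord y \<le> 2 * q" if "y \<in> carrier G - (A \<union> T)" for y
    proof -
      have y: "y \<in> carrier G" "ord y \<noteq> m" using that by (auto simp: A_def)
      then have "ord y < m" using x(2) m_def by (metis le_neq_implies_less)
      obtain d where d: "order G = ord y * d" using ord_dvd_group_order [OF y(1)] by auto
      have "d > 4" using d m \<open>ord y < m\<close> by (intro ccontr [of "d > 4"]) (auto simp: not_less dest: mult_le_mono2 [of d 4 "ord y"])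
      moreover have "d \<noteq> 5" using d n(4) by auto
      ultimately have "d \<ge> 6" by simp
      then have "ord y * 6 \<le> order G" unfolding d by simp
      then show ?thesis using m q by simp
    qed
    have "psi G = (\<Sum>y\<in>A \<union> T. ord y) + (\<Sum>y\<in>carrier G - (A \<union> T). ord y)" by (rule psi_split [OF sub])
    also have "(\<Sum>y\<in>A \<union> T. ord y) = (\<Sum>y\<in>A. ord y) + (\<Sum>y\<in>T. ord y)"
      using fA AT by (rule sum.union_disjoint)
    also have "(\<Sum>y\<in>A. ord y) \<le> card A * (3 * q)"
      using sum_mono [of A ord "\<lambda>_. 3 * q"] q by (simp add: A_def)
    also have "(\<Sum>y\<in>T. ord y) \<le> q * q"
      using sum_mono [of T ord "\<lambda>_. q"] Tord T(2) by simp
    also have "(\<Sum>y\<in>carrier G - (A \<union> T). ord y) \<le> card (carrier G - (A \<union> T)) * (2 * q)"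
      using sum_mono [of "carrier G - (A \<union> T)" ord "\<lambda>_. 2 * q"] rest by simp
    also have "card (carrier G - (A \<union> T)) = 11 * q - card A"
      using sub fA AT T(2) m q by (simp add: card_Diff_subset card_Un_disjoint order_def)
    finally have "psi G \<le> card A * (3 * q) + q * q + (11 * q - card A) * (2 * q)" by simp
    \<comment> \<open>The extreme case is \<open>card A = 8 * q\<close>: it gives
      \<open>24 + 1 + 6 = 31\<close> times \<open>q^2\<close>, and the group order is
      \<open>12 * q\<close>. Removing an element from \<open>A\<close> only lowers its bound from
      \<open>3 * q\<close> to \<open>2 * q\<close>.\<close>
    moreover obtain r where r: "8 * q = card A + r" using cA by (metis le_add_diff_inverse)
    moreover have "11 * q - card A = 3 * q + r" using r by simp
    ultimately have "psi G \<le> card A * (3 * q) + q * q + (3 * q + r) * (2 * q)" by simp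
    also have "\<dots> \<le> (card A + r) * (3 * q) + 7 * (q * q)" by (simp add: algebra_simps)
    also have "\<dots> = 31 * q\<^sup>2" unfolding r [symmetric] by (simp add: power2_eq_square)
    finally have "psi G \<le> 31 * q\<^sup>2" .
    moreover have "31 * (order G)\<^sup>2 = 144 * (31 * q\<^sup>2)" using m q by (simp add: power2_eq_square)
    ultimately show False using psi by linarith
  qed
  then show ?thesis using that u ou by blast
qed

text \<open>The image of \<open>z\<close> in the quotient has order dividing both \<open>q\<close>
  and \<open>t\<close>.\<close>

lemma mem_normal_sylow:
  assumes "P \<lhd> G" "card P = q" "order G = q * t" "coprime q t"
    and z: "z \<in> carrier G" "z [^] q = \<one>"
  shows "z \<in> P"
proof -
  interpret H: fin_group "G Mod P" by (rule fin_group_Mod [OF assms(1)])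
  have P: "subgroup P G" using assms(1) by (rule normal_imp_subgroup)
  have "q > 0" using assms(3) order_pos by (cases q) simp_all
  moreover have "order (G Mod P) * q = t * q"
    using normal_card_rcosets [OF assms(1)] unfolding assms(2,3) by (simp only: mult.commute)
  ultimately have oH: "order (G Mod P) = t" by simp
  have zc: "P #> z \<in> carrier (G Mod P)" using z by (simp add: carrier_FactGroup)
  have "H.ord (P #> z) dvd q"
    using ord_rcoset_dvd_iff [OF assms(1) z(1)] z(2) subgroup.one_closed [OF P] by simp
  moreover have "H.ord (P #> z) dvd t" using H.ord_dvd_group_order [OF zc] oH by simp
  ultimately have "H.ord (P #> z) = 1" using assms(4) by (meson coprime_def nat_dvd_1_iff_1)
  then have "z [^] (1::nat) \<in> P" using ord_rcoset_dvd_iff [OF assms(1) z(1), of 1] by simp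
  then show ?thesis using z(1) by simp
qed

text \<open>\<open>x\<close> fixes the coset \<open>S\<close> and hence permutes the other two, so
  its square fixes all three. In terms of representatives: \<open>g \<otimes> x \<otimes> x\<close>
  lies in the coset of 1, \<open>g\<close> or \<open>g \<otimes> x\<close>, and the first and the
  last are impossible.\<close>

lemma square_conj_of_index_3:
  assumes S: "subgroup S G" "order G = 3 * card S" and x: "x \<in> S" and g: "g \<in> carrier G"
  shows "g \<otimes> x [^] (2::nat) \<otimes> inv g \<in> S"
proof -
  have xc: "x \<in> carrier G" using subgroup.mem_carrier [OF S(1) x] .
  have x2: "x [^] (2::nat) = x \<otimes> x" using xc by (simp add: numeral_2_eq_2)
  have inS: "inv z \<in> S \<Longrightarrow> z \<in> carrier G \<Longrightarrow> z \<in> S" for z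
    using subgroup.m_inv_closed [OF S(1), of "inv z"] by simp
  consider "g \<in> S" | "g \<otimes> x \<otimes> inv g \<in> S" | "g \<notin> S" "g \<otimes> x \<otimes> inv g \<notin> S" by blast
  then show ?thesis
  proof cases
    case 1
    then show ?thesis
      using subgroup.m_closed [OF S(1)] subgroup.m_inv_closed [OF S(1)] subgroup_pow_closed [OF S(1) x] by simp
  next
    case 2
    then have "(g \<otimes> x \<otimes> inv g) [^] (2::nat) \<in> S" by (rule subgroup_pow_closed [OF S(1)])
    then show ?thesis using conj_pow [OF g xc] by simp
  next
    case 3
    have gx: "g \<otimes> x \<notin> S"
    proof
      assume "g \<otimes> x \<in> S"
      then have "g \<otimes> x \<otimes> inv x \<in> S" using subgroup.m_closed [OF S(1) _ subgroup.m_inv_closed [OF S(1) x]] by blast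
      then show False using 3 g xc by (simp add: m_assoc)
    qed
    have ne: "\<one> \<noteq> g" "\<one> \<noteq> g \<otimes> x" "g \<noteq> g \<otimes> x"
      using 3 gx subgroup.one_closed [OF S(1)] g xc by (auto simp: m_assoc)
    let ?R = "{\<one>, g, g \<otimes> x}"
    have cR: "card ?R = 3" using ne by simp
    have nn: "inv g \<notin> S" "inv (g \<otimes> x) \<notin> S" "g \<otimes> inv (g \<otimes> x) \<notin> S"
    proof -
      show "inv g \<notin> S" "inv (g \<otimes> x) \<notin> S" using inS 3 gx g xc by auto
      show "g \<otimes> inv (g \<otimes> x) \<notin> S"
      proof
        assume "g \<otimes> inv (g \<otimes> x) \<in> S"
        then have "inv (g \<otimes> inv (g \<otimes> x)) \<in> S" by (rule subgroup.m_inv_closed [OF S(1)])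
        then show False using 3 g xc by (simp add: inv_mult_group m_assoc)
      qed
    qed
    obtain r where r: "r \<in> ?R" "g \<otimes> x \<otimes> x \<otimes> inv r \<in> S"
    proof (rule transversal_covers [OF S(1), of ?R "g \<otimes> x \<otimes> x"])
      show "order G \<le> card ?R * card S" unfolding cR S(2) by simp
      show "r = s" if "r \<in> ?R" "s \<in> ?R" "r \<otimes> inv s \<in> S" for r s
        using that nn 3 gx g xc by auto
    qed (use g xc in auto)
    have "r \<noteq> \<one>"
    proof
      assume "r = \<one>"
      then have "g \<otimes> x \<otimes> x \<in> S" using r g xc by simp
      then have "g \<otimes> x \<otimes> x \<otimes> inv x \<in> S" using subgroup.m_closed [OF S(1) _ subgroup.m_inv_closed [OF S(1) x]] by blast
      then show False using gx g xc by (simp add: m_assoc)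
    qed
    moreover have "r \<noteq> g \<otimes> x"
    proof
      assume "r = g \<otimes> x"
      then show False using r 3 g xc by (simp add: m_assoc inv_mult_group) (simp flip: m_assoc)
    qed
    ultimately show ?thesis using r g xc by (simp add: x2 m_assoc)
  qed
qed

text \<open>The square of \<open>x\<close> acts trivially on the three cosets of \<open>\<langle>x\<rangle>\<close>, so its
  2-part generates a normal subgroup. That is centralized by a Sylow 3-subgroup \<open>P\<close>, because the
  automorphism group of a cyclic 2-group is a 2-group; hence \<open>P\<close> is characteristic in a subgroup
  of index 2.\<close>

lemma normal_sylow_3_index_3:
  assumes n: "order G = 3 ^ Suc b * 2 ^ e"
    and x: "x \<in> carrier G" "order G = 3 * ord x"
  obtains P where "P \<lhd> G" "card P = 3 ^ Suc b"
proof -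
  have m: "ord x = 3 ^ b * 2 ^ e" using n x(2) by simp
  obtain P where P: "subgroup P G" "card P = 3 ^ Suc b"
    using sylow_thm [OF prime_3 is_group, of "Suc b" "2 ^ e"] n fin by auto
  have Pord: "w [^] ((3::nat) ^ Suc b) = \<one>" if "w \<in> P" for w
    using order_dvd_subgroup [OF P(1) that] subgroup.mem_carrier [OF P(1) that] P(2) by (simp add: pow_eq_id)
  have "P \<lhd> G"
  proof (cases e)
    case 0
    then have "P = carrier G" using P n card_subset_eq [OF fin subgroup.subset [OF P(1)]] by (simp add: order_def)
    then show ?thesis using normal_self by simp
  next
    case (Suc f)
    define S where "S = generate G {x}"
    have S: "subgroup S G" "card S = ord x" "x \<in> S" using x by (auto simp: S_def)
    \<comment> \<open>A generator of the 2-part of the subgroup generated by the square of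
      \<open>x\<close>; the factor 2 in the exponent makes \<open>square_conj_of_index_3\<close>
      applicable.\<close>
    define k where "k = x [^] (3 ^ b * 2 :: nat)"
    have k: "k \<in> carrier G" using x by (simp add: k_def)
    have mk: "ord x div 2 ^ f = 3 ^ b * 2" unfolding m Suc by simp
    have ok: "ord k = 2 ^ f"
      unfolding k_def by (subst ord_pow [OF x(1)]) (auto simp: m Suc)
    have K: "generate G {k} \<lhd> G"
    proof (rule normal_generateI' [OF k])
      fix g assume g: "g \<in> carrier G"
      have "g \<otimes> k \<otimes> inv g = (g \<otimes> x [^] (2::nat) \<otimes> inv g) [^] ((3::nat) ^ b)"
        using conj_pow [OF g, of "x [^] (2::nat)"] x(1) by (simp add: k_def nat_pow_pow mult.commute)
      moreover have "g \<otimes> x [^] (2::nat) \<otimes> inv g \<in> S"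
        by (rule square_conj_of_index_3 [OF S(1) _ S(3) g]) (use x S in simp)
      ultimately have "g \<otimes> k \<otimes> inv g \<in> S" using subgroup_pow_closed [OF S(1)] by simp
      moreover have "(g \<otimes> k \<otimes> inv g) [^] ((2::nat) ^ f) = \<one>"
        using ord_conj [OF g k] g k ok by (simp add: pow_eq_id)
      ultimately show "g \<otimes> k \<otimes> inv g \<in> generate G {k}"
        using mem_generate_of_pow_eq_1 [OF x(1), of "g \<otimes> k \<otimes> inv g" "2 ^ f"]
        by (simp add: mk k_def S_def) (simp add: m Suc)
    qed
    have com: "w \<otimes> k = k \<otimes> w" if w: "w \<in> P" for w
    proof -
      have wc: "w \<in> carrier G" using subgroup.mem_carrier [OF P(1) w] .
      obtain c :: nat where c: "w \<otimes> k \<otimes> inv w = k [^] c" using conj_eq_pow [OF K wc k] by blast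
      have "k [^] (c ^ 3 ^ Suc b) = k [^] (1::nat)"
        using conj_iter [OF wc k c, of "3 ^ Suc b"] Pord [OF w] k by simp
      then have d: "int (2 ^ f) dvd int c ^ 3 ^ Suc b - 1"
        unfolding pow_eq_iff_nat [OF k] ok by simp
      have "int (2 ^ f) dvd int c - 1"
      proof (cases f)
        case (Suc f')
        then have "2 dvd int (2 ^ f)" by simp
        then have "even (int c ^ 3 ^ Suc b - 1)" using d dvd_trans by blast
        then have "int 2 dvd int c - 1" by simp
        then show ?thesis by (rule pow_congruent_1_lift [OF two_is_prime_nat _ _ d]) simp
      qed simp
      then have "k [^] c = k [^] (1::nat)" unfolding pow_eq_iff_nat [OF k] ok by simp
      then show ?thesis using c commute_iff_conj [OF wc k] k by simp
    qed
    have com': "w \<otimes> l = l \<otimes> w" if "w \<in> P" "l \<in> generate G {k}" for w l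
      using commutes_generate [OF _ k com [OF that(1)] that(2)] subgroup.mem_carrier [OF P(1) that(1)] by blast
    define M where "M = P <#> generate G {k}"
    have "coprime (3::nat) 2" by simp
    then have cop: "coprime (card P) (card (generate G {k}))" using P(2) k ok by simp
    have M: "subgroup M G" "card M = 3 ^ Suc b * 2 ^ f"
      using product_subgroup [OF P(1) generate_subgroup [OF k] cop com'] P(2) k ok by (auto simp: M_def)
    have M2: "order G = 2 * card M" unfolding n M(2) Suc by simp
    have MP: "z \<in> P" if z: "z \<in> M" "z [^] ((3::nat) ^ Suc b) = \<one>" for z
    proof -
      obtain w l where wl: "w \<in> P" "l \<in> generate G {k}" "z = w \<otimes> l" using z(1) unfolding M_def set_mult_def by blast
      have c: "w \<in> carrier G" "l \<in> carrier G"
        using wl subgroup.mem_carrier [OF P(1)] generate_in_carrier [of "{k}"] k by auto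
      have "\<one> = w [^] ((3::nat) ^ Suc b) \<otimes> l [^] ((3::nat) ^ Suc b)"
        using pow_mult_distrib [OF com' [OF wl(1,2)] c] z(2) wl(3) by simp
      then have "\<one> = \<one> \<otimes> l [^] ((3::nat) ^ Suc b)" by (simp only: Pord [OF wl(1)])
      then have "l [^] ((3::nat) ^ Suc b) = \<one>"
        unfolding l_one [OF nat_pow_closed [OF c(2)]] by (rule sym)
      then have "ord l dvd 3 ^ Suc b" unfolding pow_eq_id [OF c(2)] .
      moreover have "ord l dvd 2 ^ f" using order_dvd_subgroup [OF generate_subgroup [OF k] wl(2)] k ok by simp
      moreover have "coprime ((3::nat) ^ Suc b) (2 ^ f)" using \<open>coprime (3::nat) 2\<close> by simp
      ultimately have "ord l = 1" by (meson coprime_def nat_dvd_1_iff_1)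
      then have "l = \<one>" using c ord_eq_1 by blast
      then show ?thesis using wl c by simp
    qed
    show ?thesis
    proof (rule normal_invI [OF P(1)])
      fix g w assume g: "g \<in> carrier G" and w: "w \<in> P"
      have wc: "w \<in> carrier G" using subgroup.mem_carrier [OF P(1) w] .
      have z: "(g \<otimes> w \<otimes> inv g) [^] ((3::nat) ^ Suc b) = \<one>" using conj_pow [OF g wc] Pord [OF w] g by simp
      have "ord (g \<otimes> w \<otimes> inv g) dvd 3 ^ Suc b" using z pow_eq_id [of "g \<otimes> w \<otimes> inv g"] g wc by blast
      moreover have "odd ((3::nat) ^ Suc b)" by simp
      ultimately have "odd (ord (g \<otimes> w \<otimes> inv g))" by (meson dvd_trans)
      then have "g \<otimes> w \<otimes> inv g \<in> M" by (rule index_2_odd [OF M(1) M2, rotated]) (use g wc in simp)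
      then show "g \<otimes> w \<otimes> inv g \<in> P" using z by (rule MP)
    qed
  qed
  then show ?thesis using that P by blast
qed

text \<open>\<open>x\<close> supplies a complement \<open>H\<close> of \<open>P\<close>, cyclic of
  order \<open>t\<close>, and a cyclic subgroup \<open>Q\<close> of index 3 in \<open>P\<close>. For
  \<open>w\<close> in \<open>Q\<close> the factors of \<open>w \<otimes> l\<close> commute, so the
  order is at most \<open>ord l * ord w\<close>; for the other \<open>w\<close> it is at most
  \<open>ord l * 3 ^ b\<close>, as \<open>P\<close> has no element of order
  \<open>3 ^ Suc b\<close>. The resulting bound stays below the threshold.\<close>

lemma psi_noncyclic_sylow_3:
  assumes n: "order G = 3 ^ Suc b * t" "\<not> 3 dvd t" and x: "x \<in> carrier G" "order G = 3 * ord x"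
    and P: "P \<lhd> G" "card P = 3 ^ Suc b" "\<And>w. w \<in> P \<Longrightarrow> ord w \<noteq> 3 ^ Suc b"
  shows "43 * psi G < 19 * cpsi (order G)"
proof -
  have PG: "subgroup P G" using P(1) by (rule normal_imp_subgroup)
  have m: "ord x = 3 ^ b * t" using n x(2) by simp
  have t0: "t > 0" using n order_pos by (metis mult_0_right neq0_conv)
  have ct: "coprime (3 ^ i) t" for i using n(2) prime_imp_coprime [OF prime_3] by simp
  have Pord: "ord w dvd 3 ^ b" if "w \<in> P" for w
  proof -
    have "ord w dvd 3 ^ Suc b" using order_dvd_subgroup [OF PG that] P(2) by simp
    then obtain j where j: "j \<le> Suc b" "ord w = 3 ^ j" using divides_primepow_nat [OF prime_3] by blast
    then have "j \<noteq> Suc b" using P(3) [OF that] by auto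
    then have "j \<le> b" using j(1) by simp
    then show ?thesis using j(2) by (simp add: le_imp_power_dvd)
  qed
  have b0: "b > 0"
  proof (rule ccontr)
    assume "\<not> b > 0"
    then have "w = \<one>" if "w \<in> P" for w
      using Pord [OF that] subgroup.mem_carrier [OF PG that] ord_eq_1 by simp
    then have "P \<subseteq> {\<one>}" by blast
    then have "card P \<le> 1" using card_mono [of "{\<one>}" P] by simp
    moreover have "(3::nat) ^ b \<ge> 1" by simp
    ultimately show False using P(2) by simp
  qed
  define h where "h = x [^] ((3::nat) ^ b)"
  define q where "q = x [^] t"
  have hc: "h \<in> carrier G" "q \<in> carrier G" using x by (auto simp: h_def q_def)
  have oh: "ord h = t" unfolding h_def using ord_pow [OF x(1), of "3 ^ b"] m by simp
  have oq: "ord q = 3 ^ b" unfolding q_def using ord_pow [OF x(1), of t] m t0 by simp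
  have "q [^] ((3::nat) ^ b * 3) = \<one>" using hc oq by (simp add: pow_eq_id)
  then have "q [^] ((3::nat) ^ Suc b) = \<one>" by (simp add: mult.commute)
  then have qP: "q \<in> P" using mem_normal_sylow [OF P(1,2) n(1) ct hc(2)] by blast
  define Q where "Q = generate G {q}"
  define H where "H = generate G {h}"
  have QP: "Q \<subseteq> P" unfolding Q_def using qP PG by (simp add: generate_subgroup_incl)
  have H: "subgroup H G" "card H = t" using hc oh by (auto simp: H_def)
  have inj: "inj_on (\<lambda>(w,l). w \<otimes> l) (P \<times> H)"
    by (rule commuting_coprime_inj(2) [OF PG H(1)]) (use P(2) H(2) ct [of "Suc b"] in simp)
  have "(\<lambda>(w,l). w \<otimes> l) ` (P \<times> H) = carrier G"
  proof (rule card_subset_eq [OF fin])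
    show "(\<lambda>(w,l). w \<otimes> l) ` (P \<times> H) \<subseteq> carrier G"
      using subgroup.subset [OF PG] subgroup.subset [OF H(1)] by auto
    show "card ((\<lambda>(w,l). w \<otimes> l) ` (P \<times> H)) = card (carrier G)"
      using card_image [OF inj] n(1) P(2) H(2) by (simp add: card_cartesian_product order_def)
  qed
  then have "psi G = (\<Sum>z\<in>P \<times> H. ord (fst z \<otimes> snd z))"
    unfolding psi_def using sum.reindex [OF inj, of ord] by (simp add: comp_def case_prod_beta)
  also have "\<dots> = (\<Sum>l\<in>H. \<Sum>w\<in>P. ord (w \<otimes> l))"
    by (subst sum.swap) (simp add: sum.cartesian_product case_prod_beta)
  also have "\<dots> \<le> (\<Sum>l\<in>H. ord l * (cpsi (3 ^ b) + 2 * (3 ^ b * 3 ^ b)))"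
  proof (rule sum_mono)
    fix l assume l: "l \<in> H"
    have lc: "l \<in> carrier G" using subgroup.mem_carrier [OF H(1) l] .
    have fP: "finite P" using subgroup_finite [OF PG] .
    have "(\<Sum>w\<in>P. ord (w \<otimes> l)) = (\<Sum>w\<in>P - Q. ord (w \<otimes> l)) + (\<Sum>w\<in>Q. ord (w \<otimes> l))"
      by (rule sum.subset_diff [OF QP fP])
    also have "(\<Sum>w\<in>P - Q. ord (w \<otimes> l)) \<le> (\<Sum>w\<in>P - Q. ord l * 3 ^ b)"
    proof (rule sum_mono)
      fix w assume "w \<in> P - Q"
      then have w: "w \<in> P" "w \<in> carrier G" using subgroup.mem_carrier [OF PG] by auto
      interpret F: fin_group "G Mod P" by (rule fin_group_Mod [OF P(1)])
      have e: "P #> (w \<otimes> l) = P #> l" using w lc PG coset_join2 [OF w(2) PG w(1)]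
        by (simp add: coset_mult_assoc [symmetric] subgroup.subset)
      have "F.ord (P #> l) dvd ord l"
        using ord_rcoset_dvd_iff [OF P(1) lc] subgroup.one_closed [OF PG] lc by simp
      then have "(w \<otimes> l) [^] ord l \<in> P"
        using ord_rcoset_dvd_iff [OF P(1), of "w \<otimes> l" "ord l"] w lc e by simp
      then have "((w \<otimes> l) [^] ord l) [^] ((3::nat) ^ b) = \<one>"
        using Pord [of "(w \<otimes> l) [^] ord l"] w lc by (simp add: pow_eq_id)
      then have "ord (w \<otimes> l) dvd ord l * 3 ^ b" using w lc by (simp add: nat_pow_pow pow_eq_id)
      then show "ord (w \<otimes> l) \<le> ord l * 3 ^ b" using lc by (intro dvd_imp_le) auto
    qed
    also have "(\<Sum>w\<in>P - Q. ord l * 3 ^ b) = ord l * (2 * (3 ^ b * 3 ^ b))"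
      using QP fP P(2) hc(2) oq by (simp add: card_Diff_subset finite_subset Q_def)
    also have "(\<Sum>w\<in>Q. ord (w \<otimes> l)) \<le> (\<Sum>w\<in>Q. ord l * ord w)"
    proof (rule sum_mono)
      fix w assume w: "w \<in> Q"
      then have wc: "w \<in> carrier G" using QP subgroup.mem_carrier [OF PG] by blast
      have "x \<otimes> q = q \<otimes> x" "x \<otimes> h = h \<otimes> x" unfolding q_def h_def using x(1) nat_pow_comm [of x 1] by simp_all
      then have "h \<otimes> q = q \<otimes> h" unfolding h_def using group_commutes_pow [of x q "3 ^ b"] x(1) hc by simp
      then have "h \<otimes> w = w \<otimes> h" using commutes_generate hc w by (simp add: Q_def)
      then have "w \<otimes> l = l \<otimes> w" using commutes_generate [OF wc hc(1)] l by (simp add: H_def)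
      then have "ord (w \<otimes> l) dvd ord w * ord l" using ord_mul_divides wc lc by blast
      then show "ord (w \<otimes> l) \<le> ord l * ord w" using wc lc by (intro dvd_imp_le) (auto simp: mult.commute)
    qed
    also have "(\<Sum>w\<in>Q. ord l * ord w) = ord l * cpsi (3 ^ b)"
      using sum_ord_generate [OF hc(2)] oq by (simp add: Q_def flip: sum_distrib_left)
    finally show "(\<Sum>w\<in>P. ord (w \<otimes> l)) \<le> ord l * (cpsi (3 ^ b) + 2 * (3 ^ b * 3 ^ b))"
      by (simp add: algebra_simps)
  qed
  also have "\<dots> = cpsi t * (cpsi (3 ^ b) + 2 * (3 ^ b * 3 ^ b))"
    using sum_ord_generate [OF hc(1)] oh by (simp add: H_def flip: sum_distrib_right)
  finally have psi: "psi G \<le> cpsi t * (cpsi (3 ^ b) + 2 * (3 ^ b * 3 ^ b))" .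
  have c: "cpsi (order G) = cpsi (3 ^ Suc b) * cpsi t"
    unfolding n(1) by (rule cpsi_mult [OF ct]) (use t0 in auto)
  define Y :: nat where "Y = 3 ^ b * 3 ^ b"
  have Y: "Y > 0" by (simp add: Y_def)
  have "9 * cpsi (3 ^ b) \<le> 7 * Y"
    using cpsi_le_prime [OF prime_3, of "3 ^ b"] b0 by (simp add: Y_def power2_eq_square)
  moreover have "4 * cpsi (3 ^ Suc b) = 27 * Y + 1"
    using cpsi_prime_power [OF prime_3, of "Suc b"] by (simp add: Y_def power2_eq_square)
  \<comment> \<open>\<open>c + 2 * Y\<close> is at most \<open>25 / 9\<close> of \<open>Y\<close>,
    and \<open>d\<close> exceeds \<open>27 / 4\<close> of \<open>Y\<close>; the quotient
    \<open>100 / 243\<close> is below \<open>19 / 43\<close>.\<close>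
  moreover have "43 * (c + 2 * Y) < 19 * d" if "9 * c \<le> 7 * Y" "4 * d = 27 * Y + 1" for c d
  proof -
    have "36 * (43 * (c + 2 * Y)) \<le> 4300 * Y" using that(1) by simp
    also have "\<dots> < 36 * (19 * d)" using that(2) Y by simp
    finally show ?thesis by simp
  qed
  ultimately have "43 * (cpsi (3 ^ b) + 2 * Y) < 19 * cpsi (3 ^ Suc b)" by blast
  then have "cpsi t * (43 * (cpsi (3 ^ b) + 2 * Y)) < cpsi t * (19 * cpsi (3 ^ Suc b))"
    using cpsi_pos [OF t0] by (rule mult_strict_left_mono)
  then show ?thesis using psi unfolding c Y_def by (simp add: algebra_simps)
qed

theorem normal_cyclic_sylow:
  assumes psi: "19 * cpsi (order G) < 43 * psi G"
    and p: "prime p" "p \<ge> 3" "p dvd order G" "\<And>r. prime r \<Longrightarrow> r dvd order G \<Longrightarrow> r \<le> p"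
    and n: "order G = p ^ a * t" "\<not> p dvd t"
  obtains u where "u \<in> carrier G" "ord u = p ^ a" "generate G {u} \<lhd> G"
proof -
  obtain x where x: "x \<in> carrier G" "\<And>y. y \<in> carrier G \<Longrightarrow> ord y \<le> ord x" using ex_max_ord by metis
  have psim: "psi G \<le> order G * ord x" by (rule psi_le_order_mult [OF x(2)])
  obtain d where d: "order G = ord x * d" using ord_dvd_group_order [OF x(1)] by auto
  have a0: "a > 0" using p(3) n by (cases a) auto
  note small = normal_cyclic_of_small_index [OF p(1) n x(1)]
  \<comment> \<open>A lower bound \<open>A / B\<close> for \<open>cpsi n / n^2\<close> limits the
    index of the cyclic subgroup of \<open>x\<close> to less than
    \<open>43 * B / (19 * A)\<close>.\<close>
  have bound: "(19 * A) * order G < (43 * B) * ord x" if "A * (order G)\<^sup>2 \<le> B * cpsi (order G)" "B > 0" for A B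
  proof -
    have "19 * A * (order G)\<^sup>2 \<le> B * (19 * cpsi (order G))" using that(1) by simp
    also have "\<dots> < B * (43 * psi G)" using psi that(2) by (intro mult_strict_left_mono)
    also have "\<dots> \<le> B * (43 * (order G * ord x))" using psim by simp
    finally have "order G * (19 * A * order G) < order G * (43 * B * ord x)"
      by (simp add: power2_eq_square algebra_simps)
    then show ?thesis by (simp only: mult_less_cancel1)
  qed
  have ox: "ord x > 0" using x(1) by simp
  consider "p \<ge> 7" | "p = 5" | "p = 3"
  proof -
    have "p \<noteq> 4" "p \<noteq> 6" using p(1) by (auto simp: prime_nat_numeral_eq)
    then show ?thesis using that p(2) by linarith
  qed
  then show ?thesis
  proof cases
    case 1
    have "35 * (order G)\<^sup>2 \<le> (12 * (p + 1)) * cpsi (order G)"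
      by (rule cpsi_ge_7_bound) (use p 1 in auto)
    then have "(19 * 35) * order G < (43 * (12 * (p + 1))) * ord x" by (rule bound) simp
    moreover have "(43 * (12 * (p + 1))) * ord x \<le> (19 * 35 * p) * ord x" using 1 by (intro mult_le_mono1) simp
    ultimately have "(19 * 35) * order G < (19 * 35) * (p * ord x)" by (simp only: mult.assoc)
    then have "order G < p * ord x" by simp
    then show ?thesis using small that by blast
  next
    case 2
    have pr: "r \<in> {5,3,2}" if "prime r" "r dvd order G" for r
      using prime_le_7 [of r] p(4) [OF that] that(1) 2 by auto
    have "30 * (order G)\<^sup>2 \<le> 72 * cpsi (order G)" by (rule cpsi_ge_235) (use pr in auto)
    then have "(19 * 30) * order G < (43 * 72) * ord x" by (rule bound) simp
    then have "570 * d < 3096" using ox unfolding d by (simp add: mult.commute [of "ord x"] flip: mult.assoc)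
    then have d5: "d \<le> 5" by simp
    show ?thesis
    proof (cases "d = 5")
      case False
      then have "order G < p * ord x" using d5 2 ox by (simp add: d)
      then show ?thesis using small that by blast
    next
      \<comment> \<open>Without the prime 2 or the prime 3 the sharper bounds exclude index 5, so 6
        divides \<open>ord x\<close>. Then \<psi> is at most \<open>4 + 7 / 12\<close> times the
        square of \<open>ord x\<close>, while the hypothesis requires more than
        \<open>(19 * 750) / (43 * 72)\<close>, about 4.60, times that square.\<close>
      case True
      have "2 dvd order G"
      proof (rule ccontr)
        assume "\<not> 2 dvd order G"
        then have "r \<in> {5,3}" if "prime r" "r dvd order G" for r using pr [OF that] that by auto
        then have "15 * (order G)\<^sup>2 \<le> 24 * cpsi (order G)" by (intro cpsi_ge_35) auto
        then have "(19 * 15) * order G < (43 * 24) * ord x" by (rule bound) simp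
        then show False using True by (simp add: d)
      qed
      moreover have "3 dvd order G"
      proof (rule ccontr)
        assume "\<not> 3 dvd order G"
        then have "r \<in> {5,2}" if "prime r" "r dvd order G" for r using pr [OF that] that by auto
        then have "10 * (order G)\<^sup>2 \<le> 18 * cpsi (order G)" by (intro cpsi_ge_25) auto
        then have "(19 * 10) * order G < (43 * 18) * ord x" by (rule bound) simp
        then show False using True by (simp add: d)
      qed
      moreover have "coprime (2::nat) 5" "coprime (3::nat) 5"
        using prime_imp_coprime [OF two_is_prime_nat, of 5] prime_imp_coprime [OF prime_3, of 5] by simp_all
      ultimately have "2 dvd ord x" "3 dvd ord x"
        unfolding d True by (simp_all only: coprime_dvd_mult_left_iff)
      then have "2 * 3 dvd ord x" by (intro divides_mult) auto
      then have "12 * cpsi (ord x) \<le> 7 * (ord x)\<^sup>2" by (intro cpsi_le_6) (use ox in auto)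
      moreover have "psi G \<le> cpsi (ord x) + 4 * (ord x)\<^sup>2"
      proof -
        define S where "S = generate G {x}"
        have S: "subgroup S G" "card S = ord x" using x by (auto simp: S_def)
        have "psi G = (\<Sum>y\<in>S. ord y) + (\<Sum>y\<in>carrier G - S. ord y)"
          by (rule psi_split [OF subgroup.subset [OF S(1)]])
        moreover have "(\<Sum>y\<in>S. ord y) = cpsi (ord x)" unfolding S_def by (rule sum_ord_generate [OF x(1)])
        moreover have "(\<Sum>y\<in>carrier G - S. ord y) \<le> card (carrier G - S) * ord x"
          by (rule psi_le_card_mult) (use x in auto)
        moreover have "card (carrier G - S) = 4 * ord x"
          using card_Diff_subset [OF subgroup_finite [OF S(1)] subgroup.subset [OF S(1)]] S(2) d True
          by (simp add: order_def)
        ultimately show ?thesis by (simp add: power2_eq_square)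
      qed
      moreover have "30 * (25 * (ord x)\<^sup>2) \<le> 72 * cpsi (order G)"
        using \<open>30 * (order G)\<^sup>2 \<le> 72 * cpsi (order G)\<close> by (simp add: d True power_mult_distrib)
      moreover have "(ord x)\<^sup>2 > 0" using ox by simp
      ultimately have False using psi by linarith
      then show ?thesis ..
    qed
  next
    case 3
    note p3 = \<open>p = 3\<close>
    have pr: "r \<in> {3,2}" if "prime r" "r dvd order G" for r
      using prime_le_7 [of r] p(4) [OF that] that(1) p3 by auto
    have c: "6 * (order G)\<^sup>2 \<le> 12 * cpsi (order G)" by (rule cpsi_ge_23) (use pr in auto)
    then have "(19 * 6) * order G < (43 * 12) * ord x" by (rule bound) simp
    then have "114 * d < 516" using ox unfolding d by (simp add: mult.commute [of "ord x"] flip: mult.assoc)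
    then have "d \<le> 4" by simp
    moreover have "d \<noteq> 0" using d order_pos by auto
    ultimately consider "d < 3" | "d = 3" | "d = 4" by linarith
    then show ?thesis
    proof cases
      case 1
      then have "order G < p * ord x" using p3 ox by (simp add: d)
      then show ?thesis using small that by blast
    next
      case 2
      obtain b where b: "a = Suc b" using a0 by (cases a) auto
      have t0: "t > 0" using n order_pos by (metis mult_0_right neq0_conv)
      obtain e m where e: "t = 2 ^ e * m" "\<not> 2 dvd m" "m > 0"
        using decompose_prime_power [OF two_is_prime_nat t0] by metis
      have "m = 1"
      proof (rule ccontr)
        assume "m \<noteq> 1"
        then obtain r where r: "prime r" "r dvd m" using prime_factor_nat by blast
        then have "r dvd t" "r dvd order G" using e n by auto
        then have "r \<noteq> 3" "r \<noteq> 2" using n(2) p3 e(2) r(2) by auto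
        then show False using pr [OF r(1) \<open>r dvd order G\<close>] by auto
      qed
      then have n': "order G = 3 ^ Suc b * 2 ^ e" using n p3 b e by simp
      have x3: "order G = 3 * ord x" using d 2 by simp
      obtain P where P: "P \<lhd> G" "card P = 3 ^ Suc b" by (rule normal_sylow_3_index_3 [OF n' x(1) x3])
      have PG: "subgroup P G" using P(1) by (rule normal_imp_subgroup)
      have "\<exists>w\<in>P. ord w = 3 ^ Suc b"
      proof (rule ccontr)
        assume "\<not> (\<exists>w\<in>P. ord w = 3 ^ Suc b)"
        then have "43 * psi G < 19 * cpsi (order G)"
          using psi_noncyclic_sylow_3 [of b t x P] n p3 b x(1) x3 P by blast
        then show False using psi by simp
      qed
      then obtain w where w: "w \<in> P" "ord w = 3 ^ Suc b" by blast
      then have wc: "w \<in> carrier G" using subgroup.mem_carrier [OF PG] by blast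
      have "generate G {w} = P"
        using card_subset_eq [OF subgroup_finite [OF PG], of "generate G {w}"] generate_subgroup_incl [of "{w}" P] w wc P PG by simp
      then show ?thesis using that [OF wc] w(2) P(1) p3 b by simp
    next
      case 3
      have x4: "order G = 4 * ord x" using d 3 by simp
      have "\<not> 5 dvd order G" using pr [OF prime_5] by auto
      \<comment> \<open>\<open>c\<close> and the hypothesis give more than \<open>19 / 86\<close> of
        the squared order, and \<open>19 / 86 > 31 / 144\<close>.\<close>
      moreover have "31 * (order G)\<^sup>2 < 144 * psi G"
      proof -
        have "(order G)\<^sup>2 > 0" by simp
        then show ?thesis using c psi by linarith
      qed
      ultimately show ?thesis
        using normal_sylow_3_index_4 [of a t x] n p3 a0 x x4 that by blast
    qed
  qed
qed

subsection \<open>Central Hall subgroups\<close>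

text \<open>The complement is the kernel of the transfer to \<open>P\<close>.\<close>

lemma central_complement:
  assumes P: "subgroup P G" and central: "\<And>z g. z \<in> P \<Longrightarrow> g \<in> carrier G \<Longrightarrow> z \<otimes> g = g \<otimes> z"
    and n: "order G = card P * t" and cop: "coprime (card P) t"
  obtains K where "subgroup K G" "card K = t"
proof -
  define A where "A = G\<lparr>carrier := P\<rparr>"
  have Psub: "P \<subseteq> carrier G" using P by (rule subgroup.subset)
  have cA: "carrier A = P" by (simp add: A_def)
  have gA: "group A" unfolding A_def using P by (rule subgroup_imp_group)
  interpret A: comm_group A
    by (rule group.group_comm_groupI [OF gA]) (use central Psub in \<open>auto simp: A_def\<close>)
  have fP: "finite P" using subgroup_finite [OF P] .
  define rep where "rep c = (SOME g. g \<in> carrier G \<and> c = P #> g)" for c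
  have rep: "rep c \<in> carrier G" "P #> rep c = c" if "c \<in> rcosets P" for c
  proof -
    have "\<exists>g. g \<in> carrier G \<and> c = P #> g" using that by (auto simp: RCOSETS_def)
    then have "rep c \<in> carrier G \<and> c = P #> rep c" unfolding rep_def by (rule someI_ex)
    then show "rep c \<in> carrier G" "P #> rep c = c" by auto
  qed
  have act: "c #> g \<in> rcosets P" if c: "c \<in> rcosets P" and g: "g \<in> carrier G" for c g
  proof -
    have "c #> g = P #> (rep c \<otimes> g)"
      using rep [OF c] g coset_mult_assoc [OF Psub] by metis
    then show ?thesis using rcosetsI [OF Psub] rep(1) [OF c] g by simp
  qed
  have fR: "finite (rcosets P)" by (simp add: RCOSETS_def)
  \<comment> \<open>The transfer cocycle: \<open>\<phi> (g \<otimes> h) c\<close> is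
    \<open>\<phi> g c\<close> times \<open>\<phi> h (c #> g)\<close>. Since \<open>c #> g\<close>
    runs through all cosets, the product over the cosets is a homomorphism.\<close>
  define \<phi> where "\<phi> g c = rep c \<otimes> g \<otimes> inv (rep (c #> g))" for g c
  have phi: "\<phi> g c \<in> P" if c: "c \<in> rcosets P" and g: "g \<in> carrier G" for c g
  proof -
    have d: "c #> g \<in> rcosets P" using act [OF c g] .
    have e: "P #> (rep c \<otimes> g) = P #> rep (c #> g)"
      using rep [OF c] rep [OF d] g coset_mult_assoc [OF Psub] by metis
    have "rep c \<otimes> g \<in> P #> rep (c #> g)"
      unfolding e [symmetric] using rcos_self [OF _ P] rep(1) [OF c] g by simp
    then show ?thesis
      unfolding \<phi>_def using subgroup.rcos_module_imp [OF P is_group rep(1) [OF d]] by blast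
  qed
  define V where "V g = finprod A (\<phi> g) (rcosets P)" for g
  have V: "V \<in> hom G A"
  proof (rule homI)
    fix g assume g: "g \<in> carrier G"
    show "V g \<in> carrier A" unfolding V_def using phi g by (intro A.finprod_closed) (auto simp: cA)
  next
    fix g h assume g: "g \<in> carrier G" and h: "h \<in> carrier G"
    have inj: "inj_on (\<lambda>c. c #> g) (rcosets P)"
    proof (rule inj_on_inverseI)
      fix c assume c: "c \<in> rcosets P"
      then have "c \<subseteq> carrier G" using rcosets_part_G [OF P] by blast
      then show "(c #> g) #> inv g = c" using coset_mult_assoc g by simp
    qed
    have im: "(\<lambda>c. c #> g) ` (rcosets P) = rcosets P"
      by (rule card_subset_eq [OF fR]) (use act g card_image [OF inj] in auto)
    have "V h = finprod A (\<phi> h) ((\<lambda>c. c #> g) ` (rcosets P))" by (simp add: V_def im)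
    also have "\<dots> = finprod A (\<lambda>c. \<phi> h (c #> g)) (rcosets P)"
      using phi h by (intro A.finprod_reindex [OF _ inj]) (auto simp: im cA)
    finally have Vh: "V h = finprod A (\<lambda>c. \<phi> h (c #> g)) (rcosets P)" .
    have "V (g \<otimes> h) = finprod A (\<lambda>c. \<phi> g c \<otimes>\<^bsub>A\<^esub> \<phi> h (c #> g)) (rcosets P)"
      unfolding V_def
    proof (rule A.finprod_cong')
      fix c assume c: "c \<in> rcosets P"
      have d: "c #> g \<in> rcosets P" and e: "c #> (g \<otimes> h) \<in> rcosets P" using act c g h by auto
      have "c \<subseteq> carrier G" using c rcosets_part_G [OF P] by blast
      then have eq: "(c #> g) #> h = c #> (g \<otimes> h)" using coset_mult_assoc g h by simp
      show "\<phi> (g \<otimes> h) c = \<phi> g c \<otimes>\<^bsub>A\<^esub> \<phi> h (c #> g)"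
        unfolding \<phi>_def eq A_def using rep(1) [OF c] rep(1) [OF d] rep(1) [OF e] g h
        by (simp add: m_assoc) (simp flip: m_assoc)
    qed (use phi g h act in \<open>auto simp: cA intro!: A.m_closed [unfolded cA]\<close>)
    also have "\<dots> = V g \<otimes>\<^bsub>A\<^esub> V h"
      unfolding Vh unfolding V_def using phi g h act by (intro A.finprod_multf) (auto simp: cA)
    finally show "V (g \<otimes> h) = V g \<otimes>\<^bsub>A\<^esub> V h" .
  qed
  interpret V: group_hom G A V using V by (simp add: group_hom_def group_hom_axioms_def gA)
  have cR: "card (rcosets P) = t"
  proof -
    have "card P > 0" using subgroup.finite_imp_card_positive [OF P fin] .
    then show ?thesis using lagrange_finite [OF fin P] n by simp
  qed
  \<comment> \<open>A central \<open>z\<close> fixes every coset and contributes the factor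
    \<open>z\<close> itself. On \<open>P\<close> the transfer is therefore the \<open>t\<close>-th
    power, which is bijective as \<open>t\<close> is prime to the order of \<open>P\<close>; hence
    the transfer is onto and its kernel has \<open>t\<close> elements.\<close>
  have VP: "V z = z [^] t" if z: "z \<in> P" for z
  proof -
    have zc: "z \<in> carrier G" using z Psub by blast
    have "V z = finprod A (\<lambda>c. z) (rcosets P)"
      unfolding V_def
    proof (rule A.finprod_cong')
      fix c assume c: "c \<in> rcosets P"
      have "c #> z = P #> (z \<otimes> rep c)"
        using rep [OF c] zc coset_mult_assoc [OF Psub rep(1) [OF c] zc] central [OF z rep(1) [OF c]] by simp
      also have "\<dots> = c"
        using coset_mult_assoc [OF Psub zc rep(1) [OF c]] coset_join2 [OF zc P z] rep [OF c] by simp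
      finally have "c #> z = c" .
      then show "\<phi> z c = z"
        unfolding \<phi>_def using central [OF z rep(1) [OF c], symmetric] rep(1) [OF c] zc by (simp add: m_assoc)
    qed (use z in \<open>auto simp: cA\<close>)
    also have "\<dots> = z [^]\<^bsub>A\<^esub> t" using A.finprod_const [of z "rcosets P"] z cR by (simp add: cA)
    finally show ?thesis by (simp add: A_def flip: nat_pow_consistent)
  qed
  have inj: "inj_on V P"
  proof (rule inj_onI)
    fix z w assume zw: "z \<in> P" "w \<in> P" "V z = V w"
    have c: "z \<in> carrier G" "w \<in> carrier G" using zw Psub by auto
    define y where "y = z \<otimes> inv w"
    have y: "y \<in> P" unfolding y_def using zw subgroup.m_closed [OF P] subgroup.m_inv_closed [OF P] by blast
    have yc: "y \<in> carrier G" using y Psub by blast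
    have "z = y \<otimes> w" using c by (simp add: y_def m_assoc)
    then have "z [^] t = y [^] t \<otimes> w [^] t" using pow_mult_distrib [OF central [OF y c(2)] yc c(2)] by simp
    then have "y [^] t = \<one>" using zw VP c yc by simp
    then have "ord y dvd t" using yc by (simp add: pow_eq_id)
    moreover have "ord y dvd card P" using order_dvd_subgroup [OF P y] .
    ultimately have "ord y = 1" using cop by (meson coprime_def nat_dvd_1_iff_1)
    then have "y = \<one>" using yc ord_eq_1 by blast
    then show "z = w" using \<open>z = y \<otimes> w\<close> c by simp
  qed
  have "V ` P \<subseteq> P" using V.hom_closed Psub cA by blast
  then have "V ` P = P" using inj fP by (simp add: endo_inj_surj)
  then have onto: "V ` carrier G = carrier A" using V.hom_closed Psub cA by blast
  define K where "K = kernel G A V"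
  have K: "K \<lhd> G" unfolding K_def by (rule V.normal_kernel)
  have "order (G Mod K) = card P"
    using V.FactGroup_iso [OF onto] iso_same_card unfolding K_def order_def cA [symmetric] by blast
  then have "card K * card P = t * card P" using normal_card_rcosets [OF K] n by (simp add: mult.commute)
  then have "card K = t" using subgroup.finite_imp_card_positive [OF P fin] by simp
  then show ?thesis using that K normal_imp_subgroup by blast
qed

section \<open>Direct products of subgroups of coprime orders, and cyclic groups\<close>

lemma ord_mult_coprime:
  assumes A: "subgroup A G" and B: "subgroup B G" and cop: "coprime (card A) (card B)"
    and ab: "a \<in> A" "b \<in> B" "a \<otimes> b = b \<otimes> a"
  shows "ord (a \<otimes> b) = ord a * ord b"
proof (rule dvd_antisym)
  have c: "a \<in> carrier G" "b \<in> carrier G"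
    using ab subgroup.mem_carrier [OF A] subgroup.mem_carrier [OF B] by blast+
  show "ord (a \<otimes> b) dvd ord a * ord b" using ord_mul_divides ab(3) c by blast
  define k where "k = ord (a \<otimes> b)"
  have "(a \<otimes> b) [^] k = \<one>" using c by (simp add: k_def)
  then have e: "a [^] k \<otimes> b [^] k = \<one>" using pow_mult_distrib [OF ab(3) c] by simp
  then have "a [^] k = inv (b [^] k)" using c by (metis inv_equality nat_pow_closed)
  then have "a [^] k \<in> B" using subgroup.m_inv_closed [OF B subgroup_pow_closed [OF B ab(2)]] by simp
  moreover have "a [^] k \<in> A" by (rule subgroup_pow_closed [OF A ab(1)])
  ultimately have "a [^] k \<in> A \<inter> B" by simp
  then have a1: "a [^] k = \<one>" using commuting_coprime_inj(1) [OF A B cop] by blast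
  then have "b [^] k = \<one>" using e c by simp
  then have "ord a dvd k" "ord b dvd k" using a1 c by (simp_all add: pow_eq_id)
  moreover have "coprime (ord a) (ord b)"
    using order_dvd_subgroup [OF A ab(1)] order_dvd_subgroup [OF B ab(2)] cop by (rule coprime_divisors)
  ultimately show "ord a * ord b dvd ord (a \<otimes> b)" unfolding k_def by (intro divides_mult)
qed

lemma internal_direct_product:
  assumes A: "subgroup A G" and B: "subgroup B G" and cop: "coprime (card A) (card B)"
    and com: "\<And>a b. a \<in> A \<Longrightarrow> b \<in> B \<Longrightarrow> a \<otimes> b = b \<otimes> a"
    and n: "order G = card A * card B"
  shows "G\<lparr>carrier := A\<rparr> \<times>\<times> G\<lparr>carrier := B\<rparr> \<cong> G"
    and "psi G = psi (G\<lparr>carrier := A\<rparr>) * psi (G\<lparr>carrier := B\<rparr>)"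
proof -
  have inj: "inj_on (\<lambda>(a,b). a \<otimes> b) (A \<times> B)" by (rule commuting_coprime_inj(2) [OF A B cop])
  have im: "(\<lambda>(a,b). a \<otimes> b) ` (A \<times> B) = carrier G"
  proof (rule card_subset_eq [OF fin])
    show "(\<lambda>(a,b). a \<otimes> b) ` (A \<times> B) \<subseteq> carrier G"
      using subgroup.subset [OF A] subgroup.subset [OF B] by auto
    show "card ((\<lambda>(a,b). a \<otimes> b) ` (A \<times> B)) = card (carrier G)"
      using card_image [OF inj] n by (simp add: card_cartesian_product order_def)
  qed
  have "(\<lambda>(a,b). a \<otimes> b) \<in> iso (G\<lparr>carrier := A\<rparr> \<times>\<times> G\<lparr>carrier := B\<rparr>) G"
  proof (rule isoI)
    show "(\<lambda>(a,b). a \<otimes> b) \<in> hom (G\<lparr>carrier := A\<rparr> \<times>\<times> G\<lparr>carrier := B\<rparr>) G"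
    proof (rule homI)
      fix v assume "v \<in> carrier (G\<lparr>carrier := A\<rparr> \<times>\<times> G\<lparr>carrier := B\<rparr>)"
      then show "(case v of (a,b) \<Rightarrow> a \<otimes> b) \<in> carrier G" using im by auto
    next
      fix v w assume vw: "v \<in> carrier (G\<lparr>carrier := A\<rparr> \<times>\<times> G\<lparr>carrier := B\<rparr>)"
        "w \<in> carrier (G\<lparr>carrier := A\<rparr> \<times>\<times> G\<lparr>carrier := B\<rparr>)"
      obtain a b c d where e: "v = (a,b)" "w = (c,d)" by (cases v, cases w)
      have m: "a \<in> A" "b \<in> B" "c \<in> A" "d \<in> B" using vw unfolding e by simp_all
      have cc: "a \<in> carrier G" "b \<in> carrier G" "c \<in> carrier G" "d \<in> carrier G"
        using m subgroup.mem_carrier [OF A] subgroup.mem_carrier [OF B] by blast+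
      have "a \<otimes> c \<otimes> (b \<otimes> d) = a \<otimes> (c \<otimes> b) \<otimes> d" using cc by (simp add: m_assoc)
      also have "\<dots> = a \<otimes> b \<otimes> (c \<otimes> d)" unfolding com [OF m(3,2)] using cc by (simp add: m_assoc)
      finally show "(case v \<otimes>\<^bsub>G\<lparr>carrier := A\<rparr> \<times>\<times> G\<lparr>carrier := B\<rparr>\<^esub> w of (a,b) \<Rightarrow> a \<otimes> b)
          = (case v of (a,b) \<Rightarrow> a \<otimes> b) \<otimes> (case w of (a,b) \<Rightarrow> a \<otimes> b)"
        by (simp add: e)
    qed
    show "bij_betw (\<lambda>(a,b). a \<otimes> b) (carrier (G\<lparr>carrier := A\<rparr> \<times>\<times> G\<lparr>carrier := B\<rparr>)) (carrier G)"
      using inj im by (simp add: bij_betw_def)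
  qed
  then show "G\<lparr>carrier := A\<rparr> \<times>\<times> G\<lparr>carrier := B\<rparr> \<cong> G" by (rule is_isoI)
  have "psi G = (\<Sum>z\<in>A \<times> B. ord (fst z \<otimes> snd z))"
    unfolding psi_def im [symmetric] using sum.reindex [OF inj, of ord] by (simp add: comp_def case_prod_beta)
  also have "\<dots> = (\<Sum>z\<in>A \<times> B. ord (fst z) * ord (snd z))"
    by (rule sum.cong) (auto intro!: ord_mult_coprime [OF A B cop] com)
  also have "\<dots> = (\<Sum>a\<in>A. ord a) * (\<Sum>b\<in>B. ord b)"
    by (simp add: sum_product sum.cartesian_product case_prod_beta)
  finally show "psi G = psi (G\<lparr>carrier := A\<rparr>) * psi (G\<lparr>carrier := B\<rparr>)"
    using psi_subgroup A B by simp
qed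

lemma iso_cyc:
  assumes "x \<in> carrier G" "ord x = order G"
  shows "cyc (order G) \<cong> G"
proof -
  have n: "order G \<noteq> 0" using order_pos by linarith
  have "(\<lambda>z. x [^] (z::int)) \<in> iso (cyc (order G)) G"
  proof (rule isoI)
    show "(\<lambda>z. x [^] z) \<in> hom (cyc (order G)) G"
    proof (rule homI)
      fix z w :: int
      have "x [^] ((z + w) mod int (order G)) = x [^] (z + w)"
        using int_pow_eq [OF assms(1)] assms(2) by (simp add: minus_mod_eq_mult_div [symmetric] dvd_minus_mod)
      then show "x [^] (z \<otimes>\<^bsub>cyc (order G)\<^esub> w) = x [^] z \<otimes> x [^] w"
        using assms(1) by (simp add: int_pow_mult)
    qed (use assms in simp)
    have inj: "inj_on (\<lambda>z. x [^] z) {0..<int (order G)}"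
    proof (rule inj_onI)
      fix z w :: int assume zw: "z \<in> {0..<int (order G)}" "w \<in> {0..<int (order G)}" "x [^] z = x [^] w"
      then have "int (order G) dvd w - z" using int_pow_eq [OF assms(1)] assms(2) by simp
      then have "w mod int (order G) = z mod int (order G)" by (simp add: mod_eq_dvd_iff)
      then show "z = w" using zw by simp
    qed
    have "(\<lambda>z. x [^] z) ` {0..<int (order G)} = carrier G"
      by (rule card_subset_eq [OF fin]) (use assms(1) card_image [OF inj] in \<open>auto simp: order_def\<close>)
    then show "bij_betw (\<lambda>z. x [^] z) (carrier (cyc (order G))) (carrier G)"
      unfolding carrier_integer_mod_group if_not_P [OF n] using inj by (simp add: bij_betw_def)
  qed
  then show ?thesis by (rule is_isoI)
qed

lemma cyclic_group_iff: "cyclic_group G \<longleftrightarrow> (\<exists>x\<in>carrier G. ord x = order G)"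
proof -
  have "carrier G = range (\<lambda>i::int. x [^] i) \<longleftrightarrow> ord x = order G" if x: "x \<in> carrier G" for x
  proof -
    have "range (\<lambda>i::int. x [^] i) = generate G {x}" using generate_pow [OF x] by auto
    moreover have "generate G {x} = carrier G \<longleftrightarrow> ord x = order G"
    proof
      assume "generate G {x} = carrier G"
      then show "ord x = order G" unfolding order_def by (metis card_generate [OF x])
    next
      assume "ord x = order G"
      then show "generate G {x} = carrier G"
        using card_subset_eq [OF fin generate_incl [of "{x}"]] x card_generate [OF x] by (simp add: order_def)
    qed
    ultimately show ?thesis by metis
  qed
  then show ?thesis unfolding cyclic_group by blast
qed

lemma cyclic_iff_iso_cyc: "cyclic_group G \<longleftrightarrow> G \<cong> cyc (order G)"
proof
  assume "cyclic_group G"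
  then have "cyc (order G) \<cong> G" using iso_cyc cyclic_group_iff by blast
  then show "G \<cong> cyc (order G)" using group.iso_sym [OF group_integer_mod_group] by blast
next
  assume iso: "G \<cong> cyc (order G)"
  interpret C: fin_group "cyc (order G)" by (rule fin_group_cyc) simp
  have "cyclic_group (cyc (order G))"
  proof (cases "order G = 1")
    case True
    have "C.ord 0 = 1" using C.ord_id by simp
    then show ?thesis unfolding C.cyclic_group_iff using True by (intro bexI [of _ 0]) simp_all
  next
    case False
    have g: "1 \<in> carrier (cyc (order G))" using False by simp
    have "\<forall>k::nat. 1 [^]\<^bsub>cyc (order G)\<^esub> k = \<one>\<^bsub>cyc (order G)\<^esub> \<longleftrightarrow> order G dvd k"
      using False by (simp flip: of_nat_mod dvd_eq_mod_eq_0)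
    then have "C.ord 1 = order G" using C.ord_unique [OF g] by blast
    then show ?thesis unfolding C.cyclic_group_iff using g by auto
  qed
  then show "cyclic_group G" using isomorphic_group_cyclicity [OF iso is_group] by simp
qed

end

lemma cyc_DirProd:
  assumes "coprime m n" "m > 0" "n > 0"
  shows "cyc m \<times>\<times> cyc n \<cong> cyc (m * n)"
proof -
  have "(\<lambda>z. (z mod int m, z mod int n)) \<in> iso (cyc (m * n)) (cyc m \<times>\<times> cyc n)"
  proof (rule isoI)
    show "(\<lambda>z. (z mod int m, z mod int n)) \<in> hom (cyc (m * n)) (cyc m \<times>\<times> cyc n)"
      by (rule homI) (use assms in \<open>auto simp: carrier_integer_mod_group mod_mod_cancel mod_simps\<close>)
    have inj: "inj_on (\<lambda>z. (z mod int m, z mod int n)) {0..<int (m * n)}"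
    proof (rule inj_onI)
      fix z w :: int assume zw: "z \<in> {0..<int (m * n)}" "w \<in> {0..<int (m * n)}"
        "(z mod int m, z mod int n) = (w mod int m, w mod int n)"
      then have "int m dvd z - w" "int n dvd z - w" by (auto simp: mod_eq_dvd_iff)
      then have "int m * int n dvd z - w" using assms(1) by (intro divides_mult) auto
      then have "z mod int (m * n) = w mod int (m * n)" by (simp add: mod_eq_dvd_iff)
      then show "z = w" using zw(1,2) by simp
    qed
    have "(\<lambda>z. (z mod int m, z mod int n)) ` {0..<int (m * n)} = {0..<int m} \<times> {0..<int n}"
      by (rule card_subset_eq) (use assms card_image [OF inj] in \<open>auto simp: nat_mult_distrib\<close>)
    then show "bij_betw (\<lambda>z. (z mod int m, z mod int n)) (carrier (cyc (m * n))) (carrier (cyc m \<times>\<times> cyc n))"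
      using inj assms by (simp add: bij_betw_def carrier_integer_mod_group)
  qed
  then have "cyc (m * n) \<cong> cyc m \<times>\<times> cyc n" by (rule is_isoI)
  then show ?thesis using group.iso_sym [OF group_integer_mod_group] by blast
qed

subsection \<open>Metacyclic groups\<close>

text \<open>The pair \<open>(a, b)\<close> stands for \<open>x\<^sup>a y\<^sup>b\<close>, where \<open>x\<close> has order \<open>M\<close>, \<open>y x y\<^sup>-\<^sup>1 = x\<^sup>c\<close> and \<open>y\<^sup>N = x\<^sup>s\<close>.\<close>

definition is_metacyclic :: "(nat \<times> nat) monoid \<Rightarrow> nat \<Rightarrow> nat \<Rightarrow> nat \<Rightarrow> nat \<Rightarrow> bool" where
  "is_metacyclic E M N c s \<longleftrightarrow> carrier E = {..<M} \<times> {..<N} \<and> \<one>\<^bsub>E\<^esub> = (0, 0) \<and>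
     (\<forall>a b a' b'. a < M \<longrightarrow> b < N \<longrightarrow> a' < M \<longrightarrow> b' < N \<longrightarrow>
        (a, b) \<otimes>\<^bsub>E\<^esub> (a', b') = ((a + a' * c ^ b + s * ((b + b') div N)) mod M, (b + b') mod N))"

lemma is_metacyclicD:
  assumes "is_metacyclic E M N c s"
  shows "carrier E = {..<M} \<times> {..<N}" "\<one>\<^bsub>E\<^esub> = (0, 0)"
    "\<And>a b a' b'. a < M \<Longrightarrow> b < N \<Longrightarrow> a' < M \<Longrightarrow> b' < N \<Longrightarrow>
       (a, b) \<otimes>\<^bsub>E\<^esub> (a', b') = ((a + a' * c ^ b + s * ((b + b') div N)) mod M, (b + b') mod N)"
  using assms unfolding is_metacyclic_def by blast+

text \<open>\<open>c\<close> says that the action of \<open>y\<close> depends only on the exponent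
  modulo \<open>N\<close>, and \<open>s\<close> that \<open>y\<close> commutes with its power
  \<open>y ^ N = x ^ s\<close>. These are the two facts on which associativity rests.\<close>

lemma fin_group_metacyclic:
  assumes E: "is_metacyclic E M N c s" and M: "M > 0" "N > 0"
    and c: "[c ^ N = 1] (mod M)" and s: "[s * c = s] (mod M)"
  shows "fin_group E" "order E = M * N"
proof -
  note D = is_metacyclicD [OF E]
  have sc: "[s * c ^ b = s] (mod M)" for b
  proof (induction b)
    case (Suc b)
    have "[s * c * c ^ b = s * c ^ b] (mod M)" using s cong_mult [OF s cong_refl] by blast
    then show ?case using Suc cong_trans by (simp add: mult.assoc)
  qed simp
  have cm: "[c ^ (b mod N) = c ^ b] (mod M)" for b
  proof -
    have "[c ^ (b mod N) * (c ^ N) ^ (b div N) = c ^ (b mod N) * 1 ^ (b div N)] (mod M)"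
      by (intro cong_mult cong_pow c cong_refl)
    moreover have "c ^ (b mod N) * (c ^ N) ^ (b div N) = c ^ b"
      by (simp flip: power_mult power_add)
    ultimately show ?thesis by (simp add: cong_sym)
  qed
  have "group E"
  proof (rule groupI)
    fix x y assume "x \<in> carrier E" "y \<in> carrier E"
    then show "x \<otimes>\<^bsub>E\<^esub> y \<in> carrier E" using D M by auto
  next
    fix x y z assume "x \<in> carrier E" "y \<in> carrier E" "z \<in> carrier E"
    then obtain a b a' b' a'' b'' where e: "x = (a, b)" "y = (a', b')" "z = (a'', b'')"
      and l: "a < M" "b < N" "a' < M" "b' < N" "a'' < M" "b'' < N" using D(1) by auto
    define e1 where "e1 = (b + b') div N"
    define e2 where "e2 = ((b + b') mod N + b'') div N"
    define e3 where "e3 = (b' + b'') div N"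
    define e4 where "e4 = (b + (b' + b'') mod N) div N"
    have d: "(i mod N + j) div N + i div N = (i + j) div N" for i j
    proof -
      have "i + j = (i mod N + j) + N * (i div N)" by simp
      then show ?thesis using M by (metis add.commute div_mult_self2 less_numeral_extra(3))
    qed
    \<comment> \<open>\<open>(b + b') div N\<close> is the carry of addition modulo
      \<open>N\<close>; the total carry of three summands does not depend on the bracketing.\<close>
    have ee: "e1 + e2 = e3 + e4"
      using d [of "b + b'" b''] d [of "b' + b''" b] by (simp add: e1_def e2_def e3_def e4_def ac_simps)
    have "[(a + a' * c ^ b + s * e1) + a'' * c ^ ((b + b') mod N) + s * e2
        = (a + a' * c ^ b + s * e1) + a'' * c ^ (b + b') + s * e2] (mod M)"
      by (intro cong_add cong_mult cm cong_refl)
    also have "(a + a' * c ^ b + s * e1) + a'' * c ^ (b + b') + s * e2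
        = a + (a' + a'' * c ^ b') * c ^ b + s * (e3 + e4)"
      by (simp flip: ee) (simp add: algebra_simps power_add)
    also have "\<dots> = a + (a' + a'' * c ^ b') * c ^ b + (e3 * s + s * e4)" by (simp add: algebra_simps)
    also have "[a + (a' + a'' * c ^ b') * c ^ b + (e3 * s + s * e4)
        = a + (a' + a'' * c ^ b') * c ^ b + (e3 * (s * c ^ b) + s * e4)] (mod M)"
      by (intro cong_add cong_mult cong_refl cong_sym [OF sc])
    also have "a + (a' + a'' * c ^ b') * c ^ b + (e3 * (s * c ^ b) + s * e4)
        = a + (a' + a'' * c ^ b' + s * e3) * c ^ b + s * e4" by (simp add: algebra_simps)
    finally have main: "[(a + a' * c ^ b + s * e1) + a'' * c ^ ((b + b') mod N) + s * e2
        = a + (a' + a'' * c ^ b' + s * e3) * c ^ b + s * e4] (mod M)" .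
    have "[(a + a' * c ^ b + s * e1) mod M + a'' * c ^ ((b + b') mod N) + s * e2
        = (a + a' * c ^ b + s * e1) + a'' * c ^ ((b + b') mod N) + s * e2] (mod M)"
      by (intro cong_add cong_refl) simp
    moreover have "[a + ((a' + a'' * c ^ b' + s * e3) mod M) * c ^ b + s * e4
        = a + (a' + a'' * c ^ b' + s * e3) * c ^ b + s * e4] (mod M)"
      by (intro cong_add cong_mult cong_refl) simp
    ultimately have "[(a + a' * c ^ b + s * e1) mod M + a'' * c ^ ((b + b') mod N) + s * e2
        = a + ((a' + a'' * c ^ b' + s * e3) mod M) * c ^ b + s * e4] (mod M)"
      using main by (meson cong_sym cong_trans)
    moreover have "((b + b') mod N + b'') mod N = (b + (b' + b'') mod N) mod N"
      by (simp add: mod_simps add.assoc)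
    ultimately show "x \<otimes>\<^bsub>E\<^esub> y \<otimes>\<^bsub>E\<^esub> z = x \<otimes>\<^bsub>E\<^esub> (y \<otimes>\<^bsub>E\<^esub> z)"
      using D(3) l M by (simp add: e e1_def e2_def e3_def e4_def cong_def)
  next
    fix x assume "x \<in> carrier E"
    then obtain a b where e: "x = (a, b)" and l: "a < M" "b < N" using D(1) by auto
    \<comment> \<open>The outer \<open>mod N\<close> takes care of \<open>b = 0\<close>;
      \<open>a'\<close> then cancels \<open>r\<close>, the first entry that \<open>b'\<close> leaves
      behind.\<close>
    define b' where "b' = (N - b) mod N"
    define r where "r = (a * c ^ b' + s * ((b' + b) div N)) mod M"
    define a' where "a' = (M - r) mod M"
    have l': "a' < M" "b' < N" using M by (auto simp: a'_def b'_def)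
    have "(b' + b) mod N = 0" unfolding b'_def using l by (simp add: mod_simps)
    moreover have "(a' + (a * c ^ b' + s * ((b' + b) div N))) mod M = 0"
    proof -
      have "(a' + (a * c ^ b' + s * ((b' + b) div N))) mod M = (a' + r) mod M"
        unfolding r_def by (simp add: mod_simps)
      also have "\<dots> = (M - r + r) mod M" unfolding a'_def by (simp add: mod_simps)
      also have "M - r + r = M" using M by (simp add: r_def less_imp_le)
      finally show ?thesis by simp
    qed
    ultimately have "(a', b') \<otimes>\<^bsub>E\<^esub> x = \<one>\<^bsub>E\<^esub>"
      using D(2,3) l l' by (simp add: e add.assoc)
    then show "\<exists>y\<in>carrier E. y \<otimes>\<^bsub>E\<^esub> x = \<one>\<^bsub>E\<^esub>" using l' D(1) by blast
  qed (use D M in auto)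
  then show "fin_group E" by (simp add: fin_group_def fin_group_axioms_def D(1))
  show "order E = M * N" by (simp add: order_def D(1) card_cartesian_product)
qed

text \<open>The isomorphism sends a pair to the normal form
  \<open>x [^] a \<otimes> y [^] b\<close>. By \<open>nin\<close> the powers of \<open>y\<close>
  below \<open>N\<close> lie in different cosets of the subgroup of \<open>x\<close>, which gives
  injectivity; counting gives the rest.\<close>

lemma (in fin_group) metacyclic_iso:
  assumes E: "is_metacyclic E M N c s" "N > 0"
    and x: "x \<in> carrier G" "ord x = M" and y: "y \<in> carrier G" "y [^] N = x [^] s"
    and conj: "y \<otimes> x \<otimes> inv y = x [^] c"
    and n: "order G = M * N" and nin: "\<And>b. 0 < b \<Longrightarrow> b < N \<Longrightarrow> y [^] b \<notin> generate G {x}"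
  shows "E \<cong> G"
proof -
  note D = is_metacyclicD [OF E(1)]
  let ?f = "\<lambda>(a,b). x [^] (a::nat) \<otimes> y [^] (b::nat)"
  have M: "M > 0" using x by auto
  have swap: "y [^] b \<otimes> x [^] a = x [^] (a * c ^ b) \<otimes> y [^] b" for a b :: nat
  proof -
    have "y [^] b \<otimes> x [^] a \<otimes> inv (y [^] b) = (y [^] b \<otimes> x \<otimes> inv (y [^] b)) [^] a"
      using conj_pow x y by simp
    also have "\<dots> = x [^] (a * c ^ b)"
      using conj_iter [OF y(1) x(1) conj, of b] x by (simp add: nat_pow_pow mult.commute)
    finally have e: "y [^] b \<otimes> x [^] a \<otimes> inv (y [^] b) = x [^] (a * c ^ b)" .
    have "y [^] b \<otimes> x [^] a = y [^] b \<otimes> x [^] a \<otimes> inv (y [^] b) \<otimes> y [^] b"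
      using x y by (simp add: m_assoc)
    then show ?thesis unfolding e .
  qed
  have hom: "?f \<in> hom E G"
  proof (rule homI)
    fix v w assume "v \<in> carrier E" "w \<in> carrier E"
    then obtain a b a' b' where e: "v = (a, b)" "w = (a', b')"
      and l: "a < M" "b < N" "a' < M" "b' < N" using D(1) by auto
    have yy: "y [^] (b + b') = x [^] (s * ((b + b') div N)) \<otimes> y [^] ((b + b') mod N)"
    proof -
      have "y [^] (b + b') = y [^] (N * ((b + b') div N) + (b + b') mod N)" by simp
      also have "\<dots> = (y [^] N) [^] ((b + b') div N) \<otimes> y [^] ((b + b') mod N)"
        using y(1) by (simp add: nat_pow_pow nat_pow_mult)
      finally show ?thesis unfolding y(2) using x by (simp add: nat_pow_pow)
    qed
    have "?f v \<otimes> ?f w = x [^] a \<otimes> (y [^] b \<otimes> x [^] a') \<otimes> y [^] b'"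
      using x y by (simp add: e m_assoc)
    also have "\<dots> = x [^] a \<otimes> x [^] (a' * c ^ b) \<otimes> (y [^] b \<otimes> y [^] b')"
      unfolding swap using x y by (simp add: m_assoc)
    also have "\<dots> = x [^] (a + a' * c ^ b) \<otimes> y [^] (b + b')"
      using x y by (simp add: nat_pow_mult)
    also have "\<dots> = x [^] (a + a' * c ^ b + s * ((b + b') div N)) \<otimes> y [^] ((b + b') mod N)"
      unfolding yy using x y by (simp flip: nat_pow_mult m_assoc)
    also have "x [^] (a + a' * c ^ b + s * ((b + b') div N)) = x [^] ((a + a' * c ^ b + s * ((b + b') div N)) mod M)"
      using pow_mod_ord [OF x(1)] x(2) by simp
    finally show "?f (v \<otimes>\<^bsub>E\<^esub> w) = ?f v \<otimes> ?f w" using D(3) l by (simp add: e)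
  qed (use x y in auto)
  have inj: "inj_on ?f (carrier E)"
  proof -
    have *: "b = b'" if l: "b \<le> b'" "b' < N" and eq: "x [^] a \<otimes> y [^] b = x [^] a' \<otimes> y [^] b'"
      for a b a' b' :: nat
    proof (rule ccontr)
      assume ne: "b \<noteq> b'"
      have "y [^] b' = y [^] (b' - b) \<otimes> y [^] b" using l y by (simp add: nat_pow_mult)
      then have "x [^] a \<otimes> y [^] b = x [^] a' \<otimes> y [^] (b' - b) \<otimes> y [^] b" using eq x y by (simp add: m_assoc)
      then have "x [^] a = x [^] a' \<otimes> y [^] (b' - b)" using x y by simp
      then have "inv (x [^] a') \<otimes> x [^] a = y [^] (b' - b)" using x y by (simp flip: m_assoc)
      moreover have "inv (x [^] a') \<otimes> x [^] a \<in> generate G {x}"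
        using subgroup.m_closed [OF generate_subgroup [OF x(1)]] subgroup.m_inv_closed [OF generate_subgroup [OF x(1)]] x(1)
        by simp
      ultimately show False using nin [of "b' - b"] l ne by simp
    qed
    show ?thesis
    proof (rule inj_onI)
      fix v w assume vw: "v \<in> carrier E" "w \<in> carrier E" "?f v = ?f w"
      obtain a b a' b' where e: "v = (a, b)" "w = (a', b')" by (cases v, cases w)
      have l: "a < M" "b < N" "a' < M" "b' < N" using vw e D(1) by auto
      have eq: "x [^] a \<otimes> y [^] b = x [^] a' \<otimes> y [^] b'" using vw(3) e by simp
      have "b = b'"
        using * [OF _ l(4) eq] * [OF _ l(2) eq [symmetric]] by (cases "b \<le> b'") auto
      then have "x [^] a = x [^] a'" using eq x y by simp
      then have "a = a'" using inj_on_pow [OF x(1)] l x(2) by (auto simp: inj_on_def)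
      then show "v = w" using \<open>b = b'\<close> e by simp
    qed
  qed
  have "?f ` carrier E = carrier G"
    by (rule card_subset_eq [OF fin])
       (use x y n D(1) card_image [OF inj] in \<open>auto simp: card_cartesian_product order_def\<close>)
  then show ?thesis using hom inj by (intro is_isoI [of ?f] isoI) (auto simp: bij_betw_def)
qed

section \<open>The model groups as metacyclic groups\<close>

lemma one_plus_mult_cong: "[1 + q * m = (1::nat)] (mod m)"
  using cong_add [OF cong_refl [of 1 m], of "q * m" 0] by (simp add: cong_0_iff)

lemma sq_cong_1:
  assumes "k \<ge> 3"
  shows "[(2 ^ (k-2) + 1) ^ 2 = (1::nat)] (mod 2 ^ (k-1))"
proof -
  obtain j where k: "k = j + 3" using assms by (metis add.commute le_Suc_ex)
  have "(2 ^ (k-2) + 1) ^ 2 = 1 + (2 ^ j + 1) * (2 ^ (k-1) :: nat)"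
    unfolding k by (simp add: power2_eq_square algebra_simps power_add)
  then show ?thesis using one_plus_mult_cong by metis
qed

lemma pred_power_even:
  assumes "n > 0" "even b"
  shows "[(n - 1) ^ b = (1::nat)] (mod n)"
proof -
  obtain j where b: "b = 2 * j" using assms(2) by auto
  obtain m where m: "n = Suc m" using assms(1) by (cases n) auto
  have "[(n - 1) ^ 2 = 1] (mod n)"
  proof (cases m)
    case (Suc m')
    have "(n - 1)\<^sup>2 = 1 + m' * n" unfolding m Suc by (simp add: power2_eq_square)
    then show ?thesis using one_plus_mult_cong by metis
  qed (simp add: m cong_def)
  then have "[((n - 1) ^ 2) ^ j = 1 ^ j] (mod n)" by (rule cong_pow)
  then show ?thesis by (simp add: b power_mult)
qed

lemma Mgrp_metacyclic: "is_metacyclic (Mgrp k) (2 ^ (k-1)) 2 (2 ^ (k-2) + 1) 0"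
  by (simp add: is_metacyclic_def Mgrp_def)

lemma Q8_metacyclic: "is_metacyclic Q8 4 2 3 2"
proof -
  \<comment> \<open>For bits the carry is the product, which is how \<open>Q8\<close> expresses
    \<open>y^2 = x^2\<close>.\<close>
  have "(b + b') div 2 = b * b'" if "b < 2" "b' < 2" for b b' :: nat
    using that by (auto simp: less_2_cases_iff)
  then show ?thesis by (auto simp: is_metacyclic_def Q8_def)
qed

lemma inv_sdp_metacyclic: "is_metacyclic (inv_sdp n m) n m (n - 1) 0"
  by (simp add: is_metacyclic_def inv_sdp_def)

lemma fin_group_Mgrp:
  assumes "k \<ge> 3" shows "fin_group (Mgrp k)" "order (Mgrp k) = 2 ^ k"
proof -
  have c: "[(2 ^ (k-2) + 1) ^ 2 = (1::nat)] (mod 2 ^ (k-1))" by (rule sq_cong_1 [OF assms])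
  show "fin_group (Mgrp k)" by (rule fin_group_metacyclic(1) [OF Mgrp_metacyclic _ _ c]) auto
  have "order (Mgrp k) = 2 ^ (k-1) * 2" by (rule fin_group_metacyclic(2) [OF Mgrp_metacyclic _ _ c]) auto
  then show "order (Mgrp k) = 2 ^ k" using assms by (simp flip: power_Suc2)
qed

lemma fin_group_Q8: "fin_group Q8" "order Q8 = 8"
proof -
  have "[3 ^ 2 = (1::nat)] (mod 4)" "[2 * 3 = (2::nat)] (mod 4)" by (simp_all add: cong_def)
  then show "fin_group Q8" "order Q8 = 8"
    using fin_group_metacyclic [OF Q8_metacyclic] by simp_all
qed

lemma fin_group_inv_sdp:
  assumes "n > 0" "m > 0" "even m" shows "fin_group (inv_sdp n m)" "order (inv_sdp n m) = n * m"
  using fin_group_metacyclic [OF inv_sdp_metacyclic assms(1,2) pred_power_even [OF assms(1,3)]] by simp_all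

subsection \<open>Modular subgroup lattices\<close>

context group
begin

lemma permuting_subgroups:
  assumes H: "subgroup H G" and K: "subgroup K G" and HK: "H <#> K = K <#> H"
  shows "subgroup (H <#> K) G"
proof (rule subgroupI)
  show "H <#> K \<subseteq> carrier G" using setmult_subset_G subgroup.subset H K by blast
  show "H <#> K \<noteq> {}" using subgroup.one_closed [OF H] subgroup.one_closed [OF K] by (auto simp: set_mult_def)
next
  fix z assume "z \<in> H <#> K"
  then obtain h k where z: "h \<in> H" "k \<in> K" "z = h \<otimes> k" by (auto simp: set_mult_def)
  have "inv z = inv k \<otimes> inv h"
    using z subgroup.mem_carrier [OF H] subgroup.mem_carrier [OF K] by (simp add: inv_mult_group)
  then show "inv z \<in> H <#> K"
    unfolding HK using subgroup.m_inv_closed [OF H z(1)] subgroup.m_inv_closed [OF K z(2)] by (auto simp: set_mult_def)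
next
  fix z w assume "z \<in> H <#> K" "w \<in> H <#> K"
  then obtain h k h' k' where z: "h \<in> H" "k \<in> K" "z = h \<otimes> k" "h' \<in> H" "k' \<in> K" "w = h' \<otimes> k'"
    unfolding set_mult_def by blast
  have "k \<otimes> h' \<in> H <#> K" unfolding HK using z by (auto simp: set_mult_def)
  then obtain h'' k'' where e: "h'' \<in> H" "k'' \<in> K" "k \<otimes> h' = h'' \<otimes> k''" by (auto simp: set_mult_def)
  have c: "h \<in> carrier G" "k \<in> carrier G" "h' \<in> carrier G" "k' \<in> carrier G" "h'' \<in> carrier G" "k'' \<in> carrier G"
    using z e subgroup.mem_carrier [OF H] subgroup.mem_carrier [OF K] by blast+
  have "z \<otimes> w = h \<otimes> (k \<otimes> h') \<otimes> k'" using c by (simp add: z m_assoc)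
  also have "\<dots> = (h \<otimes> h'') \<otimes> (k'' \<otimes> k')" unfolding e(3) using c by (simp add: m_assoc)
  finally show "z \<otimes> w \<in> H <#> K"
    using subgroup.m_closed [OF H z(1) e(1)] subgroup.m_closed [OF K e(2) z(5)] by (auto simp: set_mult_def)
qed

lemma modular_le:
  assumes "subgroup H G" "subgroup K G" "subgroup L G" "H \<subseteq> L"
  shows "generate G (H \<union> (K \<inter> L)) \<subseteq> generate G (H \<union> K) \<inter> L"
proof -
  have "H \<union> K \<subseteq> carrier G" using assms subgroup.subset by blast
  then have "generate G (H \<union> (K \<inter> L)) \<subseteq> generate G (H \<union> K)" by (intro mono_generate) auto
  moreover have "generate G (H \<union> (K \<inter> L)) \<subseteq> L" using assms by (intro generate_subgroup_incl) auto
  ultimately show ?thesis by blast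
qed

text \<open>Dedekind's law: the join is the set product, and if \<open>h \<otimes> k\<close> lies in
  \<open>L\<close> together with \<open>h\<close>, then so does \<open>k\<close>.\<close>

lemma modular_of_permuting:
  assumes H: "subgroup H G" and K: "subgroup K G" and L: "subgroup L G" "H \<subseteq> L" and HK: "H <#> K = K <#> H"
  shows "generate G (H \<union> (K \<inter> L)) = generate G (H \<union> K) \<inter> L"
proof
  show "generate G (H \<union> K) \<inter> L \<subseteq> generate G (H \<union> (K \<inter> L))"
  proof
    fix x assume x: "x \<in> generate G (H \<union> K) \<inter> L"
    have "H \<union> K \<subseteq> H <#> K"
    proof
      fix z assume z: "z \<in> H \<union> K"
      then have "z \<in> carrier G" using subgroup.mem_carrier [OF H] subgroup.mem_carrier [OF K] by blast
      then have "z = z \<otimes> \<one>" "z = \<one> \<otimes> z" by simp_all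
      then show "z \<in> H <#> K"
        using z subgroup.one_closed [OF H] subgroup.one_closed [OF K] unfolding set_mult_def by blast
    qed
    then have "generate G (H \<union> K) \<subseteq> H <#> K"
      using permuting_subgroups [OF H K HK] by (rule generate_subgroup_incl)
    then obtain h k where e: "h \<in> H" "k \<in> K" "x = h \<otimes> k" using x by (auto simp: set_mult_def)
    have c: "h \<in> carrier G" "k \<in> carrier G"
      using e subgroup.mem_carrier [OF H] subgroup.mem_carrier [OF K] by blast+
    have "k = inv h \<otimes> x" using c by (simp add: e(3) flip: m_assoc)
    moreover have "inv h \<otimes> x \<in> L"
      using x e(1) L(2) subgroup.m_closed [OF L(1)] subgroup.m_inv_closed [OF L(1)] by blast
    ultimately have "k \<in> K \<inter> L" using e(2) by simp
    then show "x \<in> generate G (H \<union> (K \<inter> L))"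
      unfolding e(3) using e(1) by (intro generate.eng generate.incl) auto
  qed
qed (rule modular_le [OF H K L])

text \<open>Needed for subgroups \<open>H\<close> that do not permute with every \<open>K\<close>,
  such as the complements in a dihedral group: there nothing lies strictly between \<open>H\<close>
  and the group.\<close>

lemma modular_of_maximal:
  assumes H: "subgroup H G" and K: "subgroup K G" and L: "subgroup L G" "H \<subseteq> L" "L = H \<or> L = carrier G"
  shows "generate G (H \<union> (K \<inter> L)) = generate G (H \<union> K) \<inter> L"
  using L(3)
proof
  assume "L = H"
  then show ?thesis
    using modular_le [OF H K L(1,2)] generate.incl [of _ "H \<union> (K \<inter> L)" G] by blast
next
  assume "L = carrier G"
  then have "K \<inter> L = K" "generate G (H \<union> K) \<subseteq> L"
    using subgroup.subset [OF K] subgroup.subset [OF H] generate_incl by auto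
  then show ?thesis by auto
qed

lemma permuting_of_absorbing:
  assumes H: "subgroup H G" and K: "subgroup K G"
    and "\<And>h k. h \<in> H \<Longrightarrow> k \<in> K \<Longrightarrow> inv k \<otimes> h \<otimes> k \<in> H \<and> k \<otimes> h \<otimes> inv k \<in> H"
  shows "H <#> K = K <#> H"
proof
  have c: "h \<in> H \<Longrightarrow> h \<in> carrier G" "k \<in> K \<Longrightarrow> k \<in> carrier G" for h k
    using subgroup.mem_carrier [OF H] subgroup.mem_carrier [OF K] by blast+
  show "H <#> K \<subseteq> K <#> H"
  proof
    fix z assume "z \<in> H <#> K"
    then obtain h k where e: "h \<in> H" "k \<in> K" "z = h \<otimes> k" by (auto simp: set_mult_def)
    have "z = k \<otimes> (inv k \<otimes> h \<otimes> k)" using c e by (simp flip: m_assoc)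
    then show "z \<in> K <#> H" using assms(3) [OF e(1,2)] e(2) unfolding set_mult_def by blast
  qed
  show "K <#> H \<subseteq> H <#> K"
  proof
    fix z assume "z \<in> K <#> H"
    then obtain h k where e: "h \<in> H" "k \<in> K" "z = k \<otimes> h" by (auto simp: set_mult_def)
    have "z = (k \<otimes> h \<otimes> inv k) \<otimes> k" using c e by (simp add: m_assoc)
    then show "z \<in> H <#> K" using assms(3) [OF e(1,2)] e(2) unfolding set_mult_def by blast
  qed
qed

lemma permuting_of_commuting:
  assumes "\<And>h k. h \<in> H \<Longrightarrow> k \<in> K \<Longrightarrow> h \<otimes> k = k \<otimes> h"
  shows "H <#> K = K <#> H"
proof (intro equalityI subsetI)
  fix z assume "z \<in> H <#> K"
  then obtain h k where "h \<in> H" "k \<in> K" "z = h \<otimes> k" by (auto simp: set_mult_def)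
  then show "z \<in> K <#> H" using assms unfolding set_mult_def by blast
next
  fix z assume "z \<in> K <#> H"
  then obtain h k where "h \<in> H" "k \<in> K" "z = k \<otimes> h" by (auto simp: set_mult_def)
  then have "z = h \<otimes> k" "h \<in> H" "k \<in> K" using assms [of h k] by simp_all
  then show "z \<in> H <#> K" unfolding set_mult_def by blast
qed

text \<open>Commutators are 1 or the central element \<open>t\<close>. A subgroup containing
  \<open>t\<close> is therefore normal, and two subgroups avoiding \<open>t\<close> commute
  elementwise; in each case the two subgroups permute. It covers abelian groups with
  \<open>t\<close> the identity, and the nonabelian 2-groups among the models.\<close>

lemma M_group_of_small_commutators:
  assumes t: "t \<in> carrier G" "\<And>a. a \<in> carrier G \<Longrightarrow> t \<otimes> a = a \<otimes> t"
    and com: "\<And>a b. a \<in> carrier G \<Longrightarrow> b \<in> carrier G \<Longrightarrow> a \<otimes> b = b \<otimes> a \<or> a \<otimes> b = b \<otimes> a \<otimes> t"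
    and ab: "\<And>a b. a \<in> carrier G \<Longrightarrow> b \<in> carrier G \<Longrightarrow> t \<notin> generate G {a} \<Longrightarrow> t \<notin> generate G {b} \<Longrightarrow> a \<otimes> b = b \<otimes> a"
  shows "M_group G"
  unfolding M_group_def
proof (intro allI impI)
  fix H K L assume H: "subgroup H G" and K: "subgroup K G" and L: "subgroup L G" "H \<subseteq> L"
  have perm: "A <#> B = B <#> A" if A: "subgroup A G" and B: "subgroup B G" and tA: "t \<in> A" for A B
  proof (rule permuting_of_absorbing [OF A B])
    fix h k assume "h \<in> A" "k \<in> B"
    then have c: "h \<in> carrier G" "k \<in> carrier G" using subgroup.mem_carrier [OF A] subgroup.mem_carrier [OF B] by blast+
    have *: "inv g \<otimes> h \<otimes> g \<in> A" if g: "g \<in> carrier G" for g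
    proof -
      have "inv g \<otimes> h \<otimes> g = inv g \<otimes> (h \<otimes> g)" using c g by (simp add: m_assoc)
      moreover have "h \<otimes> g = g \<otimes> h \<or> h \<otimes> g = g \<otimes> (h \<otimes> t)" using com [OF c(1) g] c g t by (simp add: m_assoc)
      moreover have "inv g \<otimes> (g \<otimes> z) = z" if "z \<in> carrier G" for z
        using g that by (simp flip: m_assoc)
      ultimately have "inv g \<otimes> h \<otimes> g = h \<or> inv g \<otimes> h \<otimes> g = h \<otimes> t" using c t by auto
      then show ?thesis using \<open>h \<in> A\<close> subgroup.m_closed [OF A _ tA] by auto
    qed
    show "inv k \<otimes> h \<otimes> k \<in> A \<and> k \<otimes> h \<otimes> inv k \<in> A" using * [OF c(2)] * [of "inv k"] c by simp
  qed
  have "H <#> K = K <#> H"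
  proof (cases "t \<in> H \<or> t \<in> K")
    case True
    then show ?thesis using perm [OF H K] perm [OF K H] by auto
  next
    case False
    show ?thesis
    proof (rule permuting_of_commuting)
      fix h k assume hk: "h \<in> H" "k \<in> K"
      then have "generate G {h} \<subseteq> H" "generate G {k} \<subseteq> K" using generate_subgroup_incl [of "{h}" H] generate_subgroup_incl [of "{k}" K] H K by simp_all
      then show "h \<otimes> k = k \<otimes> h"
        using ab [of h k] False hk subgroup.mem_carrier [OF H] subgroup.mem_carrier [OF K] by blast
    qed
  qed
  then show "generate G (H \<union> (K \<inter> L)) = generate G (H \<union> K) \<inter> L" by (rule modular_of_permuting [OF H K L])
qed

lemma M_group_iso:
  assumes "group E" "G \<cong> E" "M_group E"
  shows "M_group G"
  unfolding M_group_def
proof (intro allI impI)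
  fix H K L assume H: "subgroup H G" and K: "subgroup K G" and L: "subgroup L G" "H \<subseteq> L"
  obtain f where f: "f \<in> iso G E" using assms(2) by (auto simp: is_iso_def)
  interpret f: group_hom G E f
    using f assms(1) by (simp add: group_hom_def group_hom_axioms_def iso_imp_homomorphism)
  have inj: "inj_on f (carrier G)" using f by (simp add: iso_def bij_betw_def)
  note sub = subgroup.subset [OF H] subgroup.subset [OF K] subgroup.subset [OF L(1)]
  have g: "generate G (H \<union> K) \<subseteq> carrier G" "generate G (H \<union> (K \<inter> L)) \<subseteq> carrier G"
    using sub by (auto intro!: generate_incl)
  have "f ` generate G (H \<union> (K \<inter> L)) = generate E (f ` H \<union> (f ` K \<inter> f ` L))"
    using f.generate_img [of "H \<union> (K \<inter> L)"] sub inj_on_image_Int [OF inj sub(2,3)] by (auto simp: image_Un)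
  also have "\<dots> = generate E (f ` H \<union> f ` K) \<inter> f ` L"
    using assms(3) f.subgroup_img_is_subgroup H K L unfolding M_group_def by (meson image_mono)
  also have "\<dots> = f ` (generate G (H \<union> K) \<inter> L)"
    using f.generate_img [of "H \<union> K"] sub inj_on_image_Int [OF inj g(1) sub(3)] by (auto simp: image_Un)
  finally show "generate G (H \<union> (K \<inter> L)) = generate G (H \<union> K) \<inter> L"
    using inj_on_image_eq_iff [OF inj g(2), of "generate G (H \<union> K) \<inter> L"] g(1) by blast
qed

end

lemma M_group_comm:
  assumes "comm_group G"
  shows "M_group G"
proof -
  interpret comm_group G by (rule assms)
  show ?thesis by (rule M_group_of_small_commutators [of "\<one>\<^bsub>G\<^esub>"]) (auto simp: m_comm)
qed

lemma DirProd_pow: "(x, y) [^]\<^bsub>E \<times>\<times> Y\<^esub> (n::nat) = (x [^]\<^bsub>E\<^esub> n, y [^]\<^bsub>Y\<^esub> n)"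
  by (induction n) simp_all

text \<open>Coprimality provides exponents that keep one coordinate and kill the other, so every
  subgroup is the product of its projections. The subgroup lattice is then the product of two
  lattices, and the modular law can be checked on each projection.\<close>

lemma M_group_DirProd:
  assumes E: "fin_group E" and Y: "fin_group Y" and cop: "coprime (order E) (order Y)"
    and MX: "M_group E" and MY: "M_group Y"
  shows "M_group (E \<times>\<times> Y)"
proof -
  interpret E: fin_group E by (rule E)
  interpret Y: fin_group Y by (rule Y)
  interpret P: group "E \<times>\<times> Y" using DirProd_group E.is_group Y.is_group by blast
  interpret F: group_hom "E \<times>\<times> Y" E fst
    by (simp add: group_hom_def group_hom_axioms_def hom_def Pi_def)
  interpret S: group_hom "E \<times>\<times> Y" Y snd
    by (simp add: group_hom_def group_hom_axioms_def hom_def Pi_def)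
  have parts: "(fst z, \<one>\<^bsub>Y\<^esub>) \<in> A \<and> (\<one>\<^bsub>E\<^esub>, snd z) \<in> A" if A: "subgroup A (E \<times>\<times> Y)" and z: "z \<in> A" for A z
  proof -
    obtain x y where e: "z = (x, y)" by (cases z)
    have c: "x \<in> carrier E" "y \<in> carrier Y" using z subgroup.mem_carrier [OF A] e by auto
    have pA: "z [^]\<^bsub>E \<times>\<times> Y\<^esub> (n::nat) \<in> A" for n
      by (induction n) (use z subgroup.one_closed [OF A] subgroup.m_closed [OF A] in auto)
    have *: "v [^]\<^bsub>W\<^esub> i = v" if "group W" "v \<in> carrier W" "[i = 1] (mod order W)" for W v and i :: nat
    proof -
      interpret W: group W by (rule that(1))
      have "int (order W) dvd int i - 1" using that(3) by (metis cong_iff_dvd_diff cong_int_iff of_nat_1)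
      then have "int (W.ord v) dvd int i - 1" using W.ord_dvd_group_order [OF that(2)] by (meson dvd_trans int_dvd_int_iff)
      then have "v [^]\<^bsub>W\<^esub> int 1 = v [^]\<^bsub>W\<^esub> int i" using W.int_pow_eq [OF that(2)] by simp
      then show ?thesis using that(2) unfolding int_pow_int by simp
    qed
    have o: "v [^]\<^bsub>W\<^esub> (order W * i) = \<one>\<^bsub>W\<^esub>" if "group W" "v \<in> carrier W" for W v and i :: nat
      using group.pow_order_eq_1 [OF that] that
      by (metis group.is_monoid monoid.nat_pow_one monoid.nat_pow_pow)
    obtain i where i: "[order Y * i = 1] (mod order E)"
      using cong_solve_coprime_nat [of "order Y" "order E"] cop by (auto simp: coprime_commute)
    obtain j where j: "[order E * j = 1] (mod order Y)"
      using cong_solve_coprime_nat [of "order E" "order Y"] cop by auto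
    have "z [^]\<^bsub>E \<times>\<times> Y\<^esub> (order Y * i) = (x, \<one>\<^bsub>Y\<^esub>)"
      unfolding e DirProd_pow using * [OF E.is_group c(1) i] o [OF Y.is_group c(2)] by simp
    moreover have "z [^]\<^bsub>E \<times>\<times> Y\<^esub> (order E * j) = (\<one>\<^bsub>E\<^esub>, y)"
      unfolding e DirProd_pow using * [OF Y.is_group c(2) j] o [OF E.is_group c(1)] by simp
    ultimately show ?thesis using pA e by (metis fst_conv snd_conv)
  qed
  have prod: "A = fst ` A \<times> snd ` A" if A: "subgroup A (E \<times>\<times> Y)" for A
  proof
    show "fst ` A \<times> snd ` A \<subseteq> A"
    proof clarify
      fix x y x' y' assume 1: "(x, y) \<in> A" "(x', y') \<in> A"
      then have "(x, \<one>\<^bsub>Y\<^esub>) \<otimes>\<^bsub>E \<times>\<times> Y\<^esub> (\<one>\<^bsub>E\<^esub>, y') \<in> A"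
        using parts [OF A 1(1)] parts [OF A 1(2)] subgroup.m_closed [OF A] by fastforce
      moreover have "x \<in> carrier E" "y' \<in> carrier Y" using 1 subgroup.mem_carrier [OF A] by fastforce+
      ultimately show "(fst (x, y), snd (x', y')) \<in> A" by simp
    qed
  qed force
  have fint: "fst ` (A \<inter> B) = fst ` A \<inter> fst ` B" "snd ` (A \<inter> B) = snd ` A \<inter> snd ` B"
    if A: "subgroup A (E \<times>\<times> Y)" and B: "subgroup B (E \<times>\<times> Y)" for A B
  proof -
    have "z \<in> fst ` (A \<inter> B)" if z: "z \<in> fst ` A" "z \<in> fst ` B" for z
    proof -
      have "(z, \<one>\<^bsub>Y\<^esub>) \<in> A \<inter> B" using z parts [OF A] parts [OF B] by auto
      then show ?thesis by force
    qed
    then show "fst ` (A \<inter> B) = fst ` A \<inter> fst ` B" by blast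
    have "z \<in> snd ` (A \<inter> B)" if z: "z \<in> snd ` A" "z \<in> snd ` B" for z
    proof -
      have "(\<one>\<^bsub>E\<^esub>, z) \<in> A \<inter> B" using z parts [OF A] parts [OF B] by auto
      then show ?thesis by force
    qed
    then show "snd ` (A \<inter> B) = snd ` A \<inter> snd ` B" by blast
  qed
  show ?thesis
    unfolding M_group_def
  proof (intro allI impI)
    fix H K L assume H: "subgroup H (E \<times>\<times> Y)" and K: "subgroup K (E \<times>\<times> Y)" and L: "subgroup L (E \<times>\<times> Y)" "H \<subseteq> L"
    let ?W1 = "generate (E \<times>\<times> Y) (H \<union> (K \<inter> L))" and ?W = "generate (E \<times>\<times> Y) (H \<union> K)"
    have sub: "H \<union> (K \<inter> L) \<subseteq> carrier (E \<times>\<times> Y)" "H \<union> K \<subseteq> carrier (E \<times>\<times> Y)"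
      using subgroup.subset H K by blast+
    have W: "subgroup ?W1 (E \<times>\<times> Y)" "subgroup ?W (E \<times>\<times> Y)"
      using sub P.generate_is_subgroup by blast+
    have W2: "subgroup (?W \<inter> L) (E \<times>\<times> Y)" using W(2) L(1) by (rule P.subgroups_Inter_pair)
    have "fst ` ?W1 = generate E (fst ` H \<union> (fst ` K \<inter> fst ` L))"
      using F.generate_img [OF sub(1)] fint(1) [OF K L(1)] by (simp add: image_Un)
    also have "\<dots> = generate E (fst ` H \<union> fst ` K) \<inter> fst ` L"
      using MX F.subgroup_img_is_subgroup H K L unfolding M_group_def by (meson image_mono)
    also have "\<dots> = fst ` (?W \<inter> L)"
      using F.generate_img [OF sub(2)] fint(1) [OF W(2) L(1)] by (simp add: image_Un)
    finally have 1: "fst ` ?W1 = fst ` (?W \<inter> L)" .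
    have "snd ` ?W1 = generate Y (snd ` H \<union> (snd ` K \<inter> snd ` L))"
      using S.generate_img [OF sub(1)] fint(2) [OF K L(1)] by (simp add: image_Un)
    also have "\<dots> = generate Y (snd ` H \<union> snd ` K) \<inter> snd ` L"
      using MY S.subgroup_img_is_subgroup H K L unfolding M_group_def by (meson image_mono)
    also have "\<dots> = snd ` (?W \<inter> L)"
      using S.generate_img [OF sub(2)] fint(2) [OF W(2) L(1)] by (simp add: image_Un)
    finally have 2: "snd ` ?W1 = snd ` (?W \<inter> L)" .
    show "?W1 = ?W \<inter> L" using prod [OF W(1)] prod [OF W2] 1 2 by simp
  qed
qed

section \<open>Modularity of the nonabelian models\<close>

lemma (in monoid) nat_pow_2: "x \<in> carrier G \<Longrightarrow> x [^] (2::nat) = x \<otimes> x"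
  by (simp add: numeral_2_eq_2)

lemma (in monoid) nat_pow_3: "x \<in> carrier G \<Longrightarrow> x [^] (3::nat) = x \<otimes> x \<otimes> x"
  by (simp add: numeral_3_eq_3)

lemma mod_double_cases:
  fixes T x y :: nat
  assumes "T > 0"
  shows "(x + y * T) mod (2 * T) = (if even y then x mod (2 * T) else (x + T) mod (2 * T))"
proof (cases "even y")
  case True
  then obtain z where "y = 2 * z" by auto
  then have "x + y * T = x + z * (2 * T)" by simp
  then show ?thesis using True by (simp only: mod_mult_self1 if_True)
next
  case False
  then obtain z where "y = 2 * z + 1" by (auto elim: oddE)
  then have "x + y * T = (x + T) + z * (2 * T)" by (simp add: algebra_simps)
  then show ?thesis using False by (simp only: mod_mult_self1 if_False)
qed

lemma Mgrp_mult:
  assumes "k \<ge> 2" "a < 2 ^ (k-1)" "b < 2" "c < 2 ^ (k-1)" "d < 2"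
  shows "(a, b) \<otimes>\<^bsub>Mgrp k\<^esub> (c, d) = ((a + c + (c * b) * 2 ^ (k-2)) mod (2 * 2 ^ (k-2)), (b + d) mod 2)"
proof -
  have k: "2 ^ (k-1) = (2 * 2 ^ (k-2) :: nat)" using assms(1) by (simp flip: power_Suc add: Suc_diff_Suc numeral_2_eq_2)
  have "b = 0 \<or> b = 1" using assms(3) by auto
  then have "c * (2 ^ (k-2) + 1) ^ b = c + (c * b) * 2 ^ (k-2)" by (auto simp: algebra_simps)
  then show ?thesis unfolding is_metacyclicD(3) [OF Mgrp_metacyclic assms(2-5)] k by (simp add: add.assoc)
qed

lemma Mgrp_carrier: "k \<ge> 2 \<Longrightarrow> carrier (Mgrp k) = {..<2 * 2 ^ (k-2)} \<times> {..<2}" 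
  by (simp add: Mgrp_def Suc_diff_Suc numeral_2_eq_2 flip: power_Suc)

text \<open>With \<open>T = 2 ^ (k-2)\<close>, half of the modulus, multiplication is addition with
  the correction \<open>T\<close> whenever \<open>c * b\<close> is odd. Commutators are thus trivial
  or the central involution \<open>(T, 0)\<close>, and squares have an even first entry, which makes
  them central. For \<open>k \<ge> 4\<close> the number \<open>T\<close> is divisible by 4, so the
  correction does not disturb parity.\<close>

lemma Mgrp_facts:
  assumes k: "k \<ge> 4"
  shows "M_group (Mgrp k)"
    "\<And>a b. a \<in> carrier (Mgrp k) \<Longrightarrow> b \<in> carrier (Mgrp k) \<Longrightarrow>
        a [^]\<^bsub>Mgrp k\<^esub> (2::nat) \<otimes>\<^bsub>Mgrp k\<^esub> b = b \<otimes>\<^bsub>Mgrp k\<^esub> a [^]\<^bsub>Mgrp k\<^esub> (2::nat)"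
    "\<exists>a\<in>carrier (Mgrp k). \<exists>b\<in>carrier (Mgrp k). a \<otimes>\<^bsub>Mgrp k\<^esub> b \<noteq> b \<otimes>\<^bsub>Mgrp k\<^esub> a"
proof -
  interpret fin_group "Mgrp k" by (rule fin_group_Mgrp(1)) (use k in simp)
  define T :: nat where "T = 2 ^ (k-2)"
  have T4: "4 dvd T"
  proof -
    have "(2::nat) ^ 2 dvd 2 ^ (k-2)" by (rule le_imp_power_dvd) (use k in simp)
    then show ?thesis by (simp add: T_def)
  qed
  then obtain T' where T': "T = 4 * T'" by auto
  have T0: "T > 0" by (simp add: T_def)
  have C: "carrier (Mgrp k) = {..<2 * T} \<times> {..<2}" using Mgrp_carrier [of k] k by (simp add: T_def)
  have kk: "2 ^ (k-1) = 2 * T" using k by (simp add: T_def Suc_diff_Suc numeral_2_eq_2 flip: power_Suc)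
  have mult: "(a, b) \<otimes>\<^bsub>Mgrp k\<^esub> (c, d)
      = (if even (c * b) then (a + c) mod (2 * T) else (a + c + T) mod (2 * T), (b + d) mod 2)"
    if "a < 2 * T" "b < 2" "c < 2 * T" "d < 2" for a b c d
    using Mgrp_mult [of k a b c d] that k mod_double_cases [OF T0, of "a + c" "c * b"]
    unfolding kk T_def [symmetric] by simp
  have one: "\<one>\<^bsub>Mgrp k\<^esub> = (0, 0)" by (simp add: Mgrp_def)
  have com: "(a, b) \<otimes>\<^bsub>Mgrp k\<^esub> (c, d) = (c, d) \<otimes>\<^bsub>Mgrp k\<^esub> (a, b)"
    if "a < 2 * T" "b < 2" "c < 2 * T" "d < 2" "even (c * b) \<longleftrightarrow> even (a * d)" for a b c d
    using mult that by (simp add: add.commute)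
  have sq: "(a, b) [^]\<^bsub>Mgrp k\<^esub> (2::nat)
      = (if even (a * b) then (2 * a) mod (2 * T) else (2 * a + T) mod (2 * T), 0)" if "a < 2 * T" "b < 2" for a b
  proof -
    have "(a, b) [^]\<^bsub>Mgrp k\<^esub> (2::nat) = (a, b) \<otimes>\<^bsub>Mgrp k\<^esub> (a, b)" using that C by (intro nat_pow_2) simp
    then show ?thesis unfolding mult [OF that that] by (simp add: mult_2 [symmetric])
  qed
  have ev: "even (x mod (2 * T)) \<longleftrightarrow> even x" for x by (simp add: even_mod_2_iff dvd_mod_iff)
  show "a [^]\<^bsub>Mgrp k\<^esub> (2::nat) \<otimes>\<^bsub>Mgrp k\<^esub> b = b \<otimes>\<^bsub>Mgrp k\<^esub> a [^]\<^bsub>Mgrp k\<^esub> (2::nat)"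
    if ab: "a \<in> carrier (Mgrp k)" "b \<in> carrier (Mgrp k)" for a b
  proof -
    obtain a1 a2 b1 b2 where e: "a = (a1, a2)" "b = (b1, b2)" and l: "a1 < 2 * T" "a2 < 2" "b1 < 2 * T" "b2 < 2"
      using ab C by auto
    obtain z where z: "a [^]\<^bsub>Mgrp k\<^esub> (2::nat) = (z, 0)" "z < 2 * T" "even z"
      using sq [OF l(1,2)] ev T0 T' unfolding e by (simp split: if_splits)
    show ?thesis unfolding z(1) e(2) by (rule com) (use z l in auto)
  qed
  have l1: "0 < 2 * T" "1 < 2 * T" using T0 by auto
  have "(1, 0) \<otimes>\<^bsub>Mgrp k\<^esub> (0, 1) \<noteq> (0, 1) \<otimes>\<^bsub>Mgrp k\<^esub> (1, 0)"
    using mult [of 1 0 0 1] mult [of 0 1 1 0] l1 T0 T' by simp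
  moreover have "(1, 0) \<in> carrier (Mgrp k)" "(0, 1) \<in> carrier (Mgrp k)" using C l1 by auto
  ultimately show "\<exists>a\<in>carrier (Mgrp k). \<exists>b\<in>carrier (Mgrp k). a \<otimes>\<^bsub>Mgrp k\<^esub> b \<noteq> b \<otimes>\<^bsub>Mgrp k\<^esub> a"
    by blast
  have pw: "(a, 0) [^]\<^bsub>Mgrp k\<^esub> (n::nat) = ((n * a) mod (2 * T), 0)" if "a < 2 * T" for a n
  proof (induction n)
    case (Suc n)
    then show ?case using mult [of "(n * a) mod (2 * T)" 0 a 0] that T0 by (simp add: mod_simps add.commute)
  qed (simp add: one)
  show "M_group (Mgrp k)"
  proof (rule M_group_of_small_commutators [of "(T, 0)"])
    show tc: "(T, 0) \<in> carrier (Mgrp k)" using C T0 by simp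
    fix a assume a: "a \<in> carrier (Mgrp k)"
    then obtain a1 a2 where e: "a = (a1, a2)" and l: "a1 < 2 * T" "a2 < 2" using C by auto
    show "(T, 0) \<otimes>\<^bsub>Mgrp k\<^esub> a = a \<otimes>\<^bsub>Mgrp k\<^esub> (T, 0)"
      unfolding e by (rule com) (use l T0 T' in auto)
    fix b assume b: "b \<in> carrier (Mgrp k)"
    then obtain b1 b2 where e': "b = (b1, b2)" and l': "b1 < 2 * T" "b2 < 2" using C by auto
    show "a \<otimes>\<^bsub>Mgrp k\<^esub> b = b \<otimes>\<^bsub>Mgrp k\<^esub> a \<or> a \<otimes>\<^bsub>Mgrp k\<^esub> b = b \<otimes>\<^bsub>Mgrp k\<^esub> a \<otimes>\<^bsub>Mgrp k\<^esub> (T, 0)"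
    proof (cases "even (b1 * a2) \<longleftrightarrow> even (a1 * b2)")
      case True
      then show ?thesis using com [OF l l'] e e' by simp
    next
      case False
      have m1: "a \<otimes>\<^bsub>Mgrp k\<^esub> b = (if even (b1 * a2) then (a1 + b1) mod (2 * T) else (a1 + b1 + T) mod (2 * T), (a2 + b2) mod 2)"
        unfolding e e' by (rule mult [OF l l'])
      have m2: "b \<otimes>\<^bsub>Mgrp k\<^esub> a = (if even (a1 * b2) then (b1 + a1) mod (2 * T) else (b1 + a1 + T) mod (2 * T), (b2 + a2) mod 2)"
        unfolding e e' by (rule mult [OF l' l])
      have m3: "(x mod (2 * T), y) \<otimes>\<^bsub>Mgrp k\<^esub> (T, 0) = ((x + T) mod (2 * T), y)" if "y < 2" for x y
        using mult [of "x mod (2 * T)" y T 0] that T0 T' by (simp add: mod_simps)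
      have TT: "(x + T + T) mod (2 * T) = x mod (2 * T)" for x
        using mod_mult_self1 [of x 1 "2 * T"] by (simp add: add.assoc mult_2)
      show ?thesis
        using False unfolding m1 m2
        by (cases "even (b1 * a2)") (simp_all only: if_True if_False simp_thms m3 mod_less_divisor zero_less_numeral TT add.commute [of b1 a1] add.commute [of b2 a2])
    qed
    \<comment> \<open>The \<open>T\<close>-th power, computed as the \<open>2 * T'\<close>-th power
      of the square, is \<open>(T, 0)\<close> for odd \<open>c\<close>. A correction
      \<open>T\<close> in the square is harmless, as \<open>2 * T' * T\<close> is a multiple of
      \<open>2 * T\<close>.\<close>
    have gen: "(T, 0) \<in> generate (Mgrp k) {(c, d)}" if c: "odd c" "c < 2 * T" "d < 2" for c d
    proof -
      have cc: "(c, d) \<in> carrier (Mgrp k)" using c C by auto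
      define z where "z = (if even (c * d) then (2 * c) mod (2 * T) else (2 * c + T) mod (2 * T))"
      have z: "z < 2 * T" using T0 by (auto simp: z_def)
      have z2: "(c, d) [^]\<^bsub>Mgrp k\<^esub> (2::nat) = (z, 0)" unfolding z_def by (rule sq [OF c(2,3)])
      have "(c, d) [^]\<^bsub>Mgrp k\<^esub> ((2::nat) * (2 * T')) = (z, 0) [^]\<^bsub>Mgrp k\<^esub> (2 * T')"
        unfolding nat_pow_pow [OF cc, symmetric] z2 ..
      also have "\<dots> = ((2 * T' * z) mod (2 * T), 0)" by (rule pw [OF z])
      also have "(2 * T' * z) mod (2 * T) = T"
      proof -
        have "(2 * T' * z) mod (2 * T) = (c * T) mod (2 * T)"
        proof (cases "even (c * d)")
          case True
          then have "(2 * T' * z) mod (2 * T) = (2 * T' * (2 * c)) mod (2 * T)" by (simp only: z_def if_True mod_mult_right_eq)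
          also have "2 * T' * (2 * c) = c * T" by (simp add: T')
          finally show ?thesis .
        next
          case False
          then have "(2 * T' * z) mod (2 * T) = (2 * T' * (2 * c + T)) mod (2 * T)" by (simp only: z_def if_False mod_mult_right_eq)
          also have "2 * T' * (2 * c + T) = c * T + T' * (2 * T)" by (simp add: T' algebra_simps)
          finally show ?thesis by (simp only: mod_mult_self1)
        qed
        also have "\<dots> = T" using mod_double_cases [OF T0, of 0 c] c(1) T0 by simp
        finally show ?thesis .
      qed
      finally show ?thesis using pow_in_generate [OF cc, of "2 * (2 * T')"] by simp
    qed
    assume "(T, 0) \<notin> generate (Mgrp k) {a}" "(T, 0) \<notin> generate (Mgrp k) {b}"
    then have "even a1" "even b1" using gen e e' l l' by blast+
    then show "a \<otimes>\<^bsub>Mgrp k\<^esub> b = b \<otimes>\<^bsub>Mgrp k\<^esub> a" unfolding e e' by (intro com l l') auto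
  qed
qed

lemma Q8_facts:
  shows "M_group Q8"
    "\<And>a b. a \<in> carrier Q8 \<Longrightarrow> b \<in> carrier Q8 \<Longrightarrow>
        a [^]\<^bsub>Q8\<^esub> (2::nat) \<otimes>\<^bsub>Q8\<^esub> b = b \<otimes>\<^bsub>Q8\<^esub> a [^]\<^bsub>Q8\<^esub> (2::nat)"
    "\<exists>a\<in>carrier Q8. \<exists>b\<in>carrier Q8. a \<otimes>\<^bsub>Q8\<^esub> b \<noteq> b \<otimes>\<^bsub>Q8\<^esub> a"
proof -
  interpret fin_group Q8 by (rule fin_group_Q8)
  have C: "carrier Q8 = {(0,0),(1,0),(2,0),(3,0),(0,1),(1,1),(2,1),(3,1)}"
  proof -
    have "{..<4::nat} = {0,1,2,3}" "{..<2::nat} = {0,1}" by auto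
    then show ?thesis by (auto simp: Q8_def)
  qed
  have mult: "(a, b) \<otimes>\<^bsub>Q8\<^esub> (c, d) = ((a + c * 3 ^ b + 2 * (b * d)) mod 4, (b + d) mod 2)" for a b c d
    by (simp add: Q8_def)
  have one: "\<one>\<^bsub>Q8\<^esub> = (0, 0)" by (simp add: Q8_def)
  have sq: "a [^]\<^bsub>Q8\<^esub> (2::nat) \<in> {(0, 0), (2, 0)}" if "a \<in> carrier Q8" for a
    using that unfolding C by (auto simp: numeral_2_eq_2 one mult)
  have t: "(2, 0) \<otimes>\<^bsub>Q8\<^esub> a = a \<otimes>\<^bsub>Q8\<^esub> (2, 0)" if "a \<in> carrier Q8" for a
    using that unfolding C by (auto simp: mult)
  show "a [^]\<^bsub>Q8\<^esub> (2::nat) \<otimes>\<^bsub>Q8\<^esub> b = b \<otimes>\<^bsub>Q8\<^esub> a [^]\<^bsub>Q8\<^esub> (2::nat)"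
    if "a \<in> carrier Q8" "b \<in> carrier Q8" for a b
    using sq [OF that(1)] t [OF that(2)] l_one [OF that(2)] r_one [OF that(2)] by (auto simp: one)
  show "\<exists>a\<in>carrier Q8. \<exists>b\<in>carrier Q8. a \<otimes>\<^bsub>Q8\<^esub> b \<noteq> b \<otimes>\<^bsub>Q8\<^esub> a"
    by (rule bexI [of _ "(1,0)"], rule bexI [of _ "(0,1)"]) (auto simp: mult C)
  show "M_group Q8"
  proof (rule M_group_of_small_commutators [of "(2, 0)"])
    show "(2, 0) \<in> carrier Q8" by (simp add: C)
    fix a assume a: "a \<in> carrier Q8"
    show "(2, 0) \<otimes>\<^bsub>Q8\<^esub> a = a \<otimes>\<^bsub>Q8\<^esub> (2, 0)" by (rule t [OF a])
    fix b assume b: "b \<in> carrier Q8"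
    show "a \<otimes>\<^bsub>Q8\<^esub> b = b \<otimes>\<^bsub>Q8\<^esub> a \<or> a \<otimes>\<^bsub>Q8\<^esub> b = b \<otimes>\<^bsub>Q8\<^esub> a \<otimes>\<^bsub>Q8\<^esub> (2, 0)"
      using a b unfolding C by (elim insertE emptyE) (simp_all add: mult)
    \<comment> \<open>Every nontrivial element of the quaternion group is -1, here
      \<open>(2, 0)\<close>, or squares to it; only the identity generates a subgroup avoiding
      it.\<close>
    assume na: "(2, 0) \<notin> generate Q8 {a}"
    have "a [^]\<^bsub>Q8\<^esub> (2::nat) \<noteq> (2, 0)" "a \<noteq> (2, 0)"
      using na pow_in_generate [OF a, of 2] self_in_generate [OF a] by auto
    then have "a = \<one>\<^bsub>Q8\<^esub>" using a unfolding C by (auto simp: numeral_2_eq_2 one mult)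
    then show "a \<otimes>\<^bsub>Q8\<^esub> b = b \<otimes>\<^bsub>Q8\<^esub> a" using b by simp
  qed
qed

lemma inv_sdp_mult:
  assumes "a < n" "b < m" "c < n" "d < m"
  shows "(a, b) \<otimes>\<^bsub>inv_sdp n m\<^esub> (c, d) = ((if even b then a + c else a + c * (n - 1)) mod n, (b + d) mod m)"
proof -
  have n: "n > 0" using assms by simp
  have "[c * (n - 1) ^ b = c * (if even b then 1 else n - 1)] (mod n)"
  proof (cases "even b")
    case True
    then show ?thesis using cong_mult [OF cong_refl pred_power_even [OF n True]] by simp
  next
    case False
    then obtain i where b: "b = 2 * i + 1" by (auto elim: oddE)
    have "[(n - 1) ^ (2 * i) * (n - 1) = 1 * (n - 1)] (mod n)"
      by (intro cong_mult pred_power_even n cong_refl) simp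
    then have "[(n - 1) ^ b = n - 1] (mod n)" by (simp add: b mult.commute)
    then show ?thesis using False cong_mult [OF cong_refl] by simp
  qed
  then have "[a + c * (n - 1) ^ b = a + c * (if even b then 1 else n - 1)] (mod n)"
    by (rule cong_add [OF cong_refl])
  then show ?thesis
    using is_metacyclicD(3) [OF inv_sdp_metacyclic assms] by (simp add: cong_def split: if_splits)
qed

text \<open>Case \<open>P\<close>: \<open>H\<close> contains the normal subgroup of order
  \<open>p\<close> and is normal, because the quotient is abelian. Case \<open>Z\<close>:
  \<open>H\<close> consists of central elements. Case \<open>D\<close>: \<open>H\<close> maps onto
  the cyclic quotient, and as \<open>p\<close> is prime no subgroup lies strictly between
  \<open>H\<close> and the group. Case \<open>no\<close> cannot occur, since the
  \<open>2 ^ k\<close>-th power of \<open>g\<close> would be a nontrivial element of the subgroup of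
  order \<open>p\<close>.\<close>

lemma M_group_inv_sdp:
  assumes p: "prime p" "p > 2" and k: "k \<ge> 1"
  shows "M_group (inv_sdp p (2 ^ k))"
proof -
  define N :: nat where "N = 2 ^ k"
  have N: "N > 0" "even N" using k by (auto simp: N_def)
  have p0: "p > 0" using p by simp
  interpret fin_group "inv_sdp p N" by (rule fin_group_inv_sdp(1) [OF p0 N])
  define E where "E = inv_sdp p N"
  have C: "carrier E = {..<p} \<times> {..<N}" by (simp add: inv_sdp_def E_def)
  have one: "\<one>\<^bsub>E\<^esub> = (0, 0)" by (simp add: inv_sdp_def E_def)
  note mult = inv_sdp_mult [of _ p _ N, folded E_def]
  have snd_mult: "snd (v \<otimes>\<^bsub>E\<^esub> w) = (snd v + snd w) mod N" if "v \<in> carrier E" "w \<in> carrier E" for v w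
  proof -
    obtain a b c d where "v = (a, b)" "w = (c, d)" "a < p" "b < N" "c < p" "d < N" using \<open>v \<in> carrier E\<close> \<open>w \<in> carrier E\<close> unfolding C by auto
    then show ?thesis using mult by simp
  qed
  have snd_pow: "snd (v [^]\<^bsub>E\<^esub> (j::nat)) = (j * snd v) mod N" if "v \<in> carrier E" for v j
  proof (induction j)
    case (Suc j)
    have "v [^]\<^bsub>E\<^esub> j \<in> carrier E" using that by (simp add: E_def)
    then show ?case using Suc snd_mult that by (simp add: mod_simps add.commute)
  qed (simp add: one)
  have snd_less: "snd v < N" if "v \<in> carrier E" for v using that unfolding C by (cases v) simp
  have add_cancel: "(i + j) mod N = (i' + j) mod N \<Longrightarrow> i < N \<Longrightarrow> i' < N \<Longrightarrow> i = i'" for i j i' :: nat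
    using cong_add_rcancel_nat [of i j i' N] by (simp add: cong_def)
  have Ppow: "(e, 0) [^]\<^bsub>E\<^esub> (j::nat) = ((j * e) mod p, 0)" if "e < p" for e j
  proof (induction j)
    case (Suc j)
    then show ?case using mult [of "(j * e) mod p" 0 e 0] that p0 N by (simp add: mod_simps add.commute)
  qed (simp add: one)
  have Pfull: "(x, 0) \<in> S" if S: "subgroup S E" "(e, 0) \<in> S" "0 < e" "e < p" "x < p" for S e x
  proof -
    have "coprime e p"
      using that(3,4) p(1) by (metis coprime_commute dvd_imp_le not_less prime_imp_coprime)
    then obtain i where "[e * i = 1] (mod p)" using cong_solve_coprime_nat by auto
    then have "[x * (e * i) = x * 1] (mod p)" by (intro cong_mult cong_refl)
    then have "(x * i * e) mod p = x" using that(5) by (simp add: cong_def mult_ac)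
    then have "(e, 0) [^]\<^bsub>E\<^esub> (x * i) = (x, 0)" using Ppow [OF that(4)] by simp
    moreover have "(e, 0) [^]\<^bsub>E\<^esub> (x * i) \<in> S" using subgroup_pow_closed S unfolding E_def by blast
    ultimately show ?thesis by simp
  qed
  have "M_group E"
    unfolding M_group_def
  proof (intro allI impI)
    fix H K L assume H: "subgroup H E" and K: "subgroup K E" and L: "subgroup L E" "H \<subseteq> L"
    have HC: "h \<in> carrier E" if "h \<in> H" for h using subgroup.mem_carrier [OF H that] .
    have KC: "h \<in> carrier E" if "h \<in> K" for h using subgroup.mem_carrier [OF K that] .
    have LC: "h \<in> carrier E" if "h \<in> L" for h using subgroup.mem_carrier [OF L(1) that] .
    have gE: "group E" by (simp add: E_def)
    interpret E: group E by (rule gE)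
    consider (P) e where "(e, 0) \<in> H" "0 < e"
      | (Z) "\<forall>h\<in>H. fst h = 0 \<and> even (snd h)"
      | (D) g where "g \<in> H" "odd (snd g)"
      | (no) g where "g \<in> H" "even (snd g)" "fst g > 0" "\<forall>e. (e, 0) \<in> H \<longrightarrow> e = 0"
    proof (cases "\<exists>e>0. (e, 0) \<in> H")
      case True
      then show ?thesis using P by blast
    next
      case n1: False
      show ?thesis
      proof (cases "\<exists>g\<in>H. odd (snd g)")
        case True
        then show ?thesis using D by blast
      next
        case n2: False
        show ?thesis
        proof (cases "\<exists>g\<in>H. fst g > 0")
          case True
          then obtain g where g: "g \<in> H" "fst g > 0" by blast
          have "\<forall>e. (e, 0) \<in> H \<longrightarrow> e = 0" using n1 by (metis gr0I)
          then show ?thesis using no [OF g(1) _ g(2)] g(1) n2 by metis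
        next
          case False
          then show ?thesis using Z n2 by simp
        qed
      qed
    qed
    then show "generate E (H \<union> (K \<inter> L)) = generate E (H \<union> K) \<inter> L"
    proof cases
      case P
      have e: "e < p" using HC [OF P(1)] C by auto
      \<comment> \<open>\<open>H\<close> contains all pairs \<open>(x, 0)\<close>, so it is
        determined by second entries, and these are unchanged by conjugation.\<close>
      have same: "h' \<in> H" if h: "h \<in> H" and h': "h' \<in> carrier E" "snd h' = snd h" for h h'
      proof -
        define z where "z = h' \<otimes>\<^bsub>E\<^esub> inv\<^bsub>E\<^esub> h"
        have zc: "z \<in> carrier E" using h' HC [OF h] by (simp add: z_def)
        have zh: "z \<otimes>\<^bsub>E\<^esub> h = h'" using h' HC [OF h] by (simp add: z_def E.m_assoc)
        then have "(snd z + snd h) mod N = (0 + snd h) mod N"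
          using snd_mult [OF zc HC [OF h]] h'(2) snd_less [OF HC [OF h]] by simp
        then have "snd z = 0" using add_cancel [of "snd z" "snd h" 0] snd_less [OF zc] N by simp
        then obtain x where "z = (x, 0)" "x < p" using zc C by (cases z) auto
        then have "z \<in> H" using Pfull [OF H P(1,2) e] by simp
        then show ?thesis using zh subgroup.m_closed [OF H _ h] by blast
      qed
      have sc: "snd (inv\<^bsub>E\<^esub> k \<otimes>\<^bsub>E\<^esub> h \<otimes>\<^bsub>E\<^esub> k) = snd h" if c: "h \<in> carrier E" "k \<in> carrier E" for h k
      proof -
        define w where "w = inv\<^bsub>E\<^esub> k \<otimes>\<^bsub>E\<^esub> h \<otimes>\<^bsub>E\<^esub> k"
        have wc: "w \<in> carrier E" using c by (simp add: w_def)
        have "k \<otimes>\<^bsub>E\<^esub> w = h \<otimes>\<^bsub>E\<^esub> k" using c by (simp add: w_def flip: E.m_assoc)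
        then have "(snd w + snd k) mod N = (snd h + snd k) mod N"
          using snd_mult [OF c(2) wc] snd_mult [OF c] by (simp add: add.commute)
        then have "snd w = snd h" by (rule add_cancel [OF _ snd_less [OF wc] snd_less [OF c(1)]])
        then show ?thesis by (simp add: w_def)
      qed
      have "H <#>\<^bsub>E\<^esub> K = K <#>\<^bsub>E\<^esub> H"
      proof (rule E.permuting_of_absorbing [OF H K])
        fix h k assume hk: "h \<in> H" "k \<in> K"
        have c: "h \<in> carrier E" "k \<in> carrier E" using hk HC KC by auto
        have "inv\<^bsub>E\<^esub> k \<otimes>\<^bsub>E\<^esub> h \<otimes>\<^bsub>E\<^esub> k \<in> H" by (rule same [OF hk(1) _ sc [OF c]]) (use c in simp)
        moreover have "k \<otimes>\<^bsub>E\<^esub> h \<otimes>\<^bsub>E\<^esub> inv\<^bsub>E\<^esub> k \<in> H"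
          by (rule same [OF hk(1)]) (use c sc [of h "inv\<^bsub>E\<^esub> k"] in simp_all)
        ultimately show "inv\<^bsub>E\<^esub> k \<otimes>\<^bsub>E\<^esub> h \<otimes>\<^bsub>E\<^esub> k \<in> H \<and> k \<otimes>\<^bsub>E\<^esub> h \<otimes>\<^bsub>E\<^esub> inv\<^bsub>E\<^esub> k \<in> H" ..
      qed
      then show ?thesis by (rule E.modular_of_permuting [OF H K L])
    next
      case Z
      have "H <#>\<^bsub>E\<^esub> K = K <#>\<^bsub>E\<^esub> H"
      proof (rule E.permuting_of_commuting)
        fix h w assume hw: "h \<in> H" "w \<in> K"
        obtain b where b: "h = (0, b)" "even b" "b < N" using Z hw(1) HC [OF hw(1)] C by (cases h) auto
        obtain c d where w: "w = (c, d)" "c < p" "d < N" using KC [OF hw(2)] C by auto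
        show "h \<otimes>\<^bsub>E\<^esub> w = w \<otimes>\<^bsub>E\<^esub> h"
          using mult [of 0 b c d] mult [of c d 0 b] b w p0 by (simp add: add.commute)
      qed
      then show ?thesis by (rule E.modular_of_permuting [OF H K L])
    next
      case D
      have gc: "g \<in> carrier E" using HC D by blast
      have "coprime (snd g) N" using D(2) by (simp add: N_def coprime_right_2_iff_odd)
      then obtain i where i: "[snd g * i = 1] (mod N)" using cong_solve_coprime_nat by auto
      have "L = H \<or> L = carrier E"
      proof (rule disjCI)
        assume "L \<noteq> carrier E"
        have LH: "l \<in> H" if l: "l \<in> L" for l
        proof (rule ccontr)
          assume "l \<notin> H"
          have *: "\<exists>x w. x < p \<and> w \<in> H \<and> (x, 0) \<otimes>\<^bsub>E\<^esub> w = v" if v: "v \<in> carrier E" for v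
          proof -
            define w where "w = g [^]\<^bsub>E\<^esub> (snd v * i)"
            have wH: "w \<in> H" using subgroup_pow_closed H D(1) unfolding E_def w_def by blast
            have wc: "w \<in> carrier E" using HC wH by blast
            have "[snd v * (snd g * i) = snd v * 1] (mod N)" using i by (intro cong_mult cong_refl)
            then have sw: "snd w = snd v" using snd_pow [OF gc] snd_less [OF v] by (simp add: w_def cong_def mult_ac)
            define z where "z = v \<otimes>\<^bsub>E\<^esub> inv\<^bsub>E\<^esub> w"
            have zc: "z \<in> carrier E" using v wc by (simp add: z_def)
            have zw: "z \<otimes>\<^bsub>E\<^esub> w = v" using v wc by (simp add: z_def E.m_assoc)
            then have "(snd z + snd w) mod N = (0 + snd w) mod N"
              using snd_mult [OF zc wc] sw snd_less [OF wc] by simp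
            then have "snd z = 0" using add_cancel [of "snd z" "snd w" 0] snd_less [OF zc] N by simp
            then obtain x where "z = (x, 0)" "x < p" using zc C by (cases z) auto
            then show ?thesis using wH zw by blast
          qed
          obtain x w where xw: "x < p" "w \<in> H" "(x, 0) \<otimes>\<^bsub>E\<^esub> w = l" using * [OF LC [OF l]] by blast
          have xc: "(x, 0) \<in> carrier E" using xw(1) C N by simp
          have "x \<noteq> 0"
          proof
            assume "x = 0"
            then have "l = w" using xw HC [OF xw(2)] E.l_one by (simp add: one)
            then show False using xw(2) \<open>l \<notin> H\<close> by simp
          qed
          have "(x, 0) = l \<otimes>\<^bsub>E\<^esub> inv\<^bsub>E\<^esub> w"
            using xw(3) xc HC [OF xw(2)] by (metis E.inv_solve_right LC l)
          moreover have "w \<in> L" using xw(2) L(2) by blast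
          ultimately have xL: "(x, 0) \<in> L"
            using l subgroup.m_closed [OF L(1)] subgroup.m_inv_closed [OF L(1)] by metis
          have "v \<in> L" if v: "v \<in> carrier E" for v
          proof -
            obtain y u where yu: "y < p" "u \<in> H" "(y, 0) \<otimes>\<^bsub>E\<^esub> u = v" using * [OF v] by blast
            have "(y, 0) \<in> L" using Pfull [OF L(1) xL] \<open>x \<noteq> 0\<close> xw(1) yu(1) by simp
            then show ?thesis using yu L(2) subgroup.m_closed [OF L(1)] by blast
          qed
          then show False using \<open>L \<noteq> carrier E\<close> LC by blast
        qed
        then show "L = H" using L(2) by blast
      qed
      then show ?thesis by (rule E.modular_of_maximal [OF H K L])
    next
      case no
      obtain a b where g: "g = (a, b)" "a < p" "b < N" "even b" "a > 0" using HC [OF no(1)] no C by auto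
      have pw: "g [^]\<^bsub>E\<^esub> (j::nat) = ((j * a) mod p, (j * b) mod N)" for j
      proof (induction j)
        case (Suc j)
        have "even ((j * b) mod N)" using g(4) N(2) by (simp add: dvd_mod_iff)
        then show ?case using Suc mult [of "(j * a) mod p" "(j * b) mod N" a b] g p0 N
          by (simp add: mod_simps add.commute)
      qed (simp add: one)
      have "g [^]\<^bsub>E\<^esub> N \<in> H" using subgroup_pow_closed H no(1) unfolding E_def by blast
      then have "(N * a) mod p = 0" using pw [of N] no(4) by simp
      then have "p dvd N * a" by (simp add: dvd_eq_mod_eq_0)
      then have "p dvd N \<or> p dvd a" using p(1) by (simp add: prime_dvd_mult_iff)
      moreover have "\<not> p dvd a" using g nat_dvd_not_less by blast
      moreover have "\<not> p dvd N"
        using p prime_dvd_power [OF p(1), of 2 k] primes_dvd_imp_eq [OF p(1) two_is_prime_nat] by (auto simp: N_def)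
      ultimately show ?thesis by blast
    qed
  qed
  then show ?thesis by (simp add: E_def N_def)
qed

subsection \<open>The seven classes\<close>

text \<open>The isomorphism invariant that, together with cyclicity and the order of the group, tells the
  seven classes apart.\<close>

definition commpow :: "nat \<Rightarrow> ('a, 'b) monoid_scheme \<Rightarrow> bool" where
  "commpow e G \<longleftrightarrow> (\<forall>a\<in>carrier G. \<forall>b\<in>carrier G. a [^]\<^bsub>G\<^esub> e \<otimes>\<^bsub>G\<^esub> b = b \<otimes>\<^bsub>G\<^esub> a [^]\<^bsub>G\<^esub> e)"

lemma commpow_mono:
  assumes "group G" "commpow e G" "e dvd f"
  shows "commpow f G"
proof -
  interpret group G by (rule assms(1))
  obtain i where "f = e * i" using assms(3) by auto
  then show ?thesis
    using assms(2) unfolding commpow_def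
    by (metis group_commutes_pow nat_pow_closed nat_pow_pow)
qed

lemma commpow_iso:
  assumes "group G" "group H" "G \<cong> H" "commpow e G"
  shows "commpow e H"
proof -
  obtain f where f: "f \<in> iso G H" using assms(3) by (auto simp: is_iso_def)
  interpret f: group_hom G H f
    using f assms by (simp add: group_hom_def group_hom_axioms_def iso_imp_homomorphism)
  have im: "f ` carrier G = carrier H" using f by (simp add: iso_def bij_betw_def)
  show ?thesis
    unfolding commpow_def
  proof (intro ballI)
    fix a b assume "a \<in> carrier H" "b \<in> carrier H"
    then obtain x y where xy: "x \<in> carrier G" "y \<in> carrier G" "a = f x" "b = f y" unfolding im [symmetric] by blast
    have "f (x [^]\<^bsub>G\<^esub> e \<otimes>\<^bsub>G\<^esub> y) = f (y \<otimes>\<^bsub>G\<^esub> x [^]\<^bsub>G\<^esub> e)" using assms(4) xy unfolding commpow_def by simp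
    then show "a [^]\<^bsub>H\<^esub> e \<otimes>\<^bsub>H\<^esub> b = b \<otimes>\<^bsub>H\<^esub> a [^]\<^bsub>H\<^esub> e" using xy by (simp add: f.hom_nat_pow)
  qed
qed

lemma commpow_DirProd_cyc:
  assumes "m > 0"
  shows "commpow e (A \<times>\<times> cyc m) \<longleftrightarrow> commpow e A"
proof -
  interpret C: comm_group "cyc m" by simp
  have "carrier (cyc m) \<noteq> {}" using C.carrier_not_empty .
  then show ?thesis unfolding commpow_def by (auto simp: DirProd_pow add.commute)
qed

lemma iso_DirProd_cyc_facts:
  assumes "group G" "fin_group A" "m > 0" "G \<cong> A \<times>\<times> cyc m"
  shows "order G = order A * m" "commpow e G \<longleftrightarrow> commpow e A"
    "coprime (order A) m \<Longrightarrow> M_group A \<Longrightarrow> M_group G"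
proof -
  interpret A: fin_group A by (rule assms(2))
  interpret G: group G by (rule assms(1))
  have g: "group (A \<times>\<times> cyc m)" by (rule DirProd_group [OF A.is_group group_integer_mod_group])
  show "order G = order A * m"
    using iso_same_card [OF assms(4)] order_cyc [of m] by (simp add: order_def card_cartesian_product)
  show "commpow e G \<longleftrightarrow> commpow e A"
    using commpow_iso [OF assms(1) g assms(4)] commpow_iso [OF g assms(1) G.iso_sym [OF assms(4)]]
      commpow_DirProd_cyc [OF assms(3)] by blast
  assume "coprime (order A) m" "M_group A"
  then have "M_group (A \<times>\<times> cyc m)"
    using M_group_DirProd [OF assms(2) fin_group_cyc [OF assms(3)] _ _ M_group_comm [OF abelian_integer_mod_group]]
    by simp
  then show "M_group G" using G.M_group_iso [OF g assms(4)] by blast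
qed

text \<open>A square has an even second entry, and its cube loses the component of order 3, so sixth
  powers are central. The square of \<open>(1, 0)\<close> still generates the subgroup of order 3,
  which is inverted by \<open>(0, 1)\<close>.\<close>

lemma commpow_inv_sdp_3:
  assumes "even N" "N > 0"
  shows "commpow 6 (inv_sdp 3 N)" "\<not> commpow 2 (inv_sdp 3 N)"
proof -
  interpret fin_group "inv_sdp 3 N" by (rule fin_group_inv_sdp(1)) (use assms in auto)
  define E where "E = inv_sdp 3 N"
  have C: "carrier E = {..<3} \<times> {..<N}" by (simp add: inv_sdp_def E_def)
  have one: "\<one>\<^bsub>E\<^esub> = (0, 0)" by (simp add: inv_sdp_def E_def)
  note mult = inv_sdp_mult [of _ 3 _ N, folded E_def]
  have ev: "even (x mod N) \<longleftrightarrow> even x" for x using assms by (simp add: dvd_mod_iff)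
  have N2: "1 < N" using assms by (cases "N = 1") auto
  show "commpow 6 (inv_sdp 3 N)"
    unfolding commpow_def E_def [symmetric]
  proof (intro ballI)
    fix v w assume vw: "v \<in> carrier E" "w \<in> carrier E"
    obtain a b where v: "v = (a, b)" "a < 3" "b < N" using vw C by auto
    obtain c d where w: "w = (c, d)" "c < 3" "d < N" using vw C by auto
    have "v [^]\<^bsub>E\<^esub> (2::nat) = v \<otimes>\<^bsub>E\<^esub> v" using vw by (simp add: numeral_2_eq_2 E_def)
    then obtain x y where xy: "v [^]\<^bsub>E\<^esub> (2::nat) = (x, y)" "x < 3" "y < N" "even y"
      using mult [of a b a b] v ev [of "b + b"] assms by simp
    have "v [^]\<^bsub>E\<^esub> (6::nat) = (v [^]\<^bsub>E\<^esub> (2::nat)) [^]\<^bsub>E\<^esub> (3::nat)"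
      using vw nat_pow_pow [of v 2 3] by (simp add: E_def)
    also have "\<dots> = (x, y) \<otimes>\<^bsub>E\<^esub> (x, y) \<otimes>\<^bsub>E\<^esub> (x, y)"
      using xy C unfolding E_def by (simp add: nat_pow_3)
    also have "\<dots> = (0, ((y + y) mod N + y) mod N)"
      using mod_mult_self1_is_0 [of 3 x] mult [of x y x y] mult [of "(x + x) mod 3" "(y + y) mod N" x y] xy ev [of "y + y"] assms
      by (simp add: mod_simps flip: mult_2)
    finally obtain z where z: "v [^]\<^bsub>E\<^esub> (6::nat) = (0, z)" "z < N" "even z"
      using ev xy assms by simp
    show "v [^]\<^bsub>E\<^esub> (6::nat) \<otimes>\<^bsub>E\<^esub> w = w \<otimes>\<^bsub>E\<^esub> v [^]\<^bsub>E\<^esub> (6::nat)"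
      unfolding z(1) w(1) using mult [of 0 z c d] mult [of c d 0 z] z w by (simp add: add.commute)
  qed
  have "(1, 0) [^]\<^bsub>E\<^esub> (2::nat) = (2, 0)"
    using mult [of 1 0 1 0] mult [of 0 0 1 0] N2 by (simp add: numeral_2_eq_2 one)
  moreover have "(2, 0) \<otimes>\<^bsub>E\<^esub> (0, 1) \<noteq> (0, 1) \<otimes>\<^bsub>E\<^esub> (2, 0)"
    using mult [of 2 0 0 1] mult [of 0 1 2 0] N2 by simp
  moreover have "(1, 0) \<in> carrier E" "(0, 1) \<in> carrier E" using C N2 by auto
  ultimately show "\<not> commpow 2 (inv_sdp 3 N)" unfolding commpow_def E_def by metis
qed

text \<open>As 6 is 1 modulo 5, the noncentral element \<open>(1, 0)\<close> is its own sixth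
  power.\<close>

lemma not_commpow_inv_sdp_5:
  assumes "even N" "N > 0"
  shows "\<not> commpow 6 (inv_sdp 5 N)"
proof -
  interpret fin_group "inv_sdp 5 N" by (rule fin_group_inv_sdp(1)) (use assms in auto)
  define E where "E = inv_sdp 5 N"
  have C: "carrier E = {..<5} \<times> {..<N}" by (simp add: inv_sdp_def E_def)
  have one: "\<one>\<^bsub>E\<^esub> = (0, 0)" by (simp add: inv_sdp_def E_def)
  note mult = inv_sdp_mult [of _ 5 _ N, folded E_def]
  have N2: "1 < N" using assms by (cases "N = 1") auto
  have pw: "(1, 0) [^]\<^bsub>E\<^esub> (n::nat) = (n mod 5, 0)" for n
  proof (induction n)
    case (Suc n)
    then show ?case using mult [of "n mod 5" 0 1 0] N2 by (simp add: mod_simps)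
  qed (simp add: one)
  have "(1, 0) [^]\<^bsub>E\<^esub> (6::nat) = (1, 0)" using pw [of 6] by simp
  moreover have "(1, 0) \<otimes>\<^bsub>E\<^esub> (0, 1) \<noteq> (0, 1) \<otimes>\<^bsub>E\<^esub> (1, 0)"
    using mult [of 1 0 0 1] mult [of 0 1 1 0] N2 by simp
  moreover have "(1, 0) \<in> carrier E" "(0, 1) \<in> carrier E" using C N2 by auto
  ultimately show ?thesis unfolding commpow_def E_def by metis
qed

lemma fin_group_DirProd:
  assumes "fin_group A" "fin_group B"
  shows "fin_group (A \<times>\<times> B)" "order (A \<times>\<times> B) = order A * order B"
proof -
  interpret A: fin_group A by (rule assms(1))
  interpret B: fin_group B by (rule assms(2))
  show "fin_group (A \<times>\<times> B)"
    using DirProd_group [OF A.is_group B.is_group] by (simp add: fin_group_def fin_group_axioms_def)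
  show "order (A \<times>\<times> B) = order A * order B" by (simp add: order_def card_cartesian_product)
qed

lemma fin_group_cyc2:
  "fin_group (cyc (2 ^ n) \<times>\<times> cyc 2)" "order (cyc (2 ^ n) \<times>\<times> cyc 2) = 2 ^ Suc n"
  using fin_group_DirProd [of "cyc (2 ^ n)" "cyc 2"] fin_group_cyc by simp_all

lemma comm_group_DirProd:
  assumes "comm_group A" "comm_group B"
  shows "comm_group (A \<times>\<times> B)"
proof -
  interpret A: comm_group A by (rule assms(1))
  interpret B: comm_group B by (rule assms(2))
  show ?thesis
    by (rule group.group_comm_groupI [OF DirProd_group [OF A.is_group B.is_group]])
       (auto simp: A.m_comm B.m_comm)
qed

lemma commpow_comm: "comm_group G \<Longrightarrow> commpow e G"
  unfolding commpow_def by (metis comm_group.axioms(1) comm_monoid.m_comm comm_group.axioms(2) group.is_monoid monoid.nat_pow_closed)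

lemma coprime_2_power: "odd m \<Longrightarrow> coprime ((2::nat) ^ k) m"
  by (simp add: coprime_left_2_iff_odd)

lemma gcd_6: "gcd (m::nat) 6 = 1 \<longleftrightarrow> odd m \<and> \<not> 3 dvd m"
proof -
  have "coprime m 6 \<longleftrightarrow> coprime m 2 \<and> coprime m 3"
    using coprime_mult_right_iff [of m 2 3] by simp
  moreover have "coprime m 3 \<longleftrightarrow> \<not> 3 dvd m"
    using prime_3 by (metis coprime_commute prime_imp_coprime coprime_absorb_left not_prime_unit)
  ultimately show ?thesis unfolding coprime_iff_gcd_eq_1 [symmetric] by (simp add: coprime_right_2_iff_odd)
qed

lemma gcd_10: "gcd (m::nat) 10 = 1 \<longleftrightarrow> odd m \<and> \<not> 5 dvd m"
proof -
  have "coprime m 10 \<longleftrightarrow> coprime m 2 \<and> coprime m 5"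
    using coprime_mult_right_iff [of m 2 5] by simp
  moreover have "coprime m 5 \<longleftrightarrow> \<not> 5 dvd m"
    using prime_5 by (metis coprime_commute prime_imp_coprime coprime_absorb_left not_prime_unit)
  ultimately show ?thesis unfolding coprime_iff_gcd_eq_1 [symmetric] by (simp add: coprime_right_2_iff_odd)
qed

section \<open>Invariants and modularity, class by class\<close>

lemma in_class_1:
  assumes "group G" "in_class 1 G"
  shows "commpow 1 G" "cyclic_group G" "M_group G"
proof -
  show c: "cyclic_group G" using assms(2) by (simp add: in_class_def)
  then have "comm_group G" using group.cyclic_imp_abelian_group assms(1) by blast
  then show "commpow 1 G" "M_group G" by (auto intro: commpow_comm M_group_comm)
qed

lemma in_class_2:
  assumes "group G" "in_class 2 G"
  shows "commpow 1 G" "\<not> cyclic_group G" "M_group G"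
proof -
  obtain k m where k: "k \<ge> 2" "odd m" and iso: "G \<cong> (cyc (2 ^ (k-1)) \<times>\<times> cyc 2) \<times>\<times> cyc m"
    using assms(2) by (auto simp: in_class_def)
  define A where "A = cyc (2 ^ (k-1)) \<times>\<times> cyc 2"
  have m: "m > 0" using k by (auto intro: gr0I)
  have A: "fin_group A" "order A = 2 ^ k" "comm_group A"
    using fin_group_cyc2 [of "k - 1"] k by (auto simp: A_def comm_group_DirProd)
  have iso': "G \<cong> A \<times>\<times> cyc m" using iso by (simp add: A_def)
  note F = iso_DirProd_cyc_facts [OF assms(1) A(1) m iso']
  show "commpow 1 G" using F(2) commpow_comm [OF A(3)] by blast
  show "M_group G" by (rule F(3)) (use A k M_group_comm coprime_2_power in auto)
  interpret P: fin_group "A \<times>\<times> cyc m" by (rule fin_group_DirProd) (use A fin_group_cyc m in auto)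
  show "\<not> cyclic_group G"
  proof
    assume "cyclic_group G"
    then have "cyclic_group (A \<times>\<times> cyc m)"
      using isomorphic_group_cyclicity [OF iso' assms(1) P.is_group] by simp
    then obtain z where z: "z \<in> carrier (A \<times>\<times> cyc m)" "P.ord z = order (A \<times>\<times> cyc m)"
      unfolding P.cyclic_group_iff by blast
    obtain a b c where e: "z = ((a, b), c)" by (metis surj_pair)
    have "z [^]\<^bsub>A \<times>\<times> cyc m\<^esub> (2 ^ (k-1) * m) = \<one>\<^bsub>A \<times>\<times> cyc m\<^esub>"
    proof -
      \<comment> \<open>This is where \<open>k \<ge> 2\<close> enters: the exponent
        \<open>2 ^ (k-1) * m\<close> kills the factor \<open>cyc 2\<close> as well, and it is only
        half the group order.\<close>
      have "even ((2::nat) ^ (k-1))" using k by simp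
      then have "(int (2 ^ (k-1) * m) * b) mod 2 = 0" by simp
      then show ?thesis unfolding e A_def by (simp add: DirProd_pow)
    qed
    then have "P.ord z dvd 2 ^ (k-1) * m" using P.pow_eq_id [OF z(1)] by blast
    then have "2 ^ k * m \<le> 2 ^ (k-1) * m"
      using z(2) fin_group_DirProd(2) [OF A(1) fin_group_cyc [OF m]] A(2) m by (simp add: dvd_imp_le)
    moreover have "(2::nat) ^ k = 2 * 2 ^ (k-1)" using k by (simp flip: power_Suc)
    ultimately show False using m by simp
  qed
qed

lemma in_class_3:
  assumes "group G" "in_class 3 G"
  shows "\<not> commpow 1 G" "commpow 2 G" "16 dvd order G" "M_group G"
proof -
  obtain k m where k: "k \<ge> 4" "odd m" and iso: "G \<cong> Mgrp k \<times>\<times> cyc m"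
    using assms(2) by (auto simp: in_class_def)
  have m: "m > 0" using k by (auto intro: gr0I)
  have A: "fin_group (Mgrp k)" "order (Mgrp k) = 2 ^ k" using fin_group_Mgrp [of k] k by auto
  note F = iso_DirProd_cyc_facts [OF assms(1) A(1) m iso]
  interpret A: fin_group "Mgrp k" by (rule A)
  have "\<not> commpow 1 (Mgrp k)" using Mgrp_facts(3) [OF k(1)] unfolding commpow_def by fastforce
  then show "\<not> commpow 1 G" using F(2) by blast
  have "commpow 2 (Mgrp k)" using Mgrp_facts(2) [OF k(1)] unfolding commpow_def by blast
  then show "commpow 2 G" using F(2) by blast
  have "(2::nat) ^ 4 dvd 2 ^ k" using k(1) by (rule le_imp_power_dvd)
  then show "16 dvd order G" using F(1) A(2) by simp
  show "M_group G" by (rule F(3)) (use A k coprime_2_power Mgrp_facts(1) in auto)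
qed

lemma in_class_4:
  assumes "group G" "in_class 4 G"
  shows "\<not> commpow 1 G" "commpow 2 G" "\<not> 16 dvd order G" "M_group G"
proof -
  obtain m where k: "odd m" and iso: "G \<cong> Q8 \<times>\<times> cyc m"
    using assms(2) by (auto simp: in_class_def)
  have m: "m > 0" using k by (auto intro: gr0I)
  note F = iso_DirProd_cyc_facts [OF assms(1) fin_group_Q8(1) m iso]
  interpret A: fin_group Q8 by (rule fin_group_Q8)
  have "\<not> commpow 1 Q8" using Q8_facts(3) unfolding commpow_def by fastforce
  then show "\<not> commpow 1 G" using F(2) by blast
  have "commpow 2 Q8" using Q8_facts(2) unfolding commpow_def by blast
  then show "commpow 2 G" using F(2) by blast
  show "\<not> 16 dvd order G" unfolding F(1) fin_group_Q8(2) using k by presburger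
  show "M_group G"
    by (rule F(3)) (use coprime_2_power [OF k, of 3] fin_group_Q8(2) Q8_facts(1) in auto)
qed

lemma in_class_5:
  assumes "group G" "in_class 5 G"
  shows "\<not> commpow 2 G" "commpow 6 G" "M_group G"
proof -
  obtain k m where k: "k \<ge> 1" "gcd m 6 = 1" and iso: "G \<cong> inv_sdp 3 (2 ^ k) \<times>\<times> cyc m"
    using assms(2) by (auto simp: in_class_def)
  have m: "odd m" "\<not> 3 dvd m" "m > 0" using k gcd_6 by (auto intro: gr0I)
  have e: "even ((2::nat) ^ k)" using k by simp
  have A: "fin_group (inv_sdp 3 (2 ^ k))" "order (inv_sdp 3 (2 ^ k)) = 3 * 2 ^ k"
    using fin_group_inv_sdp [OF _ _ e, of 3] by auto
  note F = iso_DirProd_cyc_facts [OF assms(1) A(1) m(3) iso]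
  show "\<not> commpow 2 G" "commpow 6 G" using F(2) commpow_inv_sdp_3 [OF e] by auto
  have "coprime (3 * 2 ^ k) m"
    using coprime_2_power [OF m(1), of k] prime_imp_coprime [OF prime_3 m(2)] by simp
  then show "M_group G" using F(3) A(2) M_group_inv_sdp [OF prime_3 _ k(1)] by simp
qed

lemma in_class_67:
  fixes b :: nat
  assumes "group G" "in_class 6 G \<and> b = 1 \<or> in_class 7 G \<and> b = 2"
  shows "\<not> commpow 6 G" "4 dvd order G \<longleftrightarrow> b = 2" "M_group G"
proof -
  have "\<exists>m. gcd m 10 = 1 \<and> G \<cong> inv_sdp 5 (2 ^ b) \<times>\<times> cyc m"
    using assms(2) by (auto simp: in_class_def)
  then obtain m where k: "gcd m 10 = 1" and iso: "G \<cong> inv_sdp 5 (2 ^ b) \<times>\<times> cyc m" by auto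
  have b: "b = 1 \<or> b = 2" using assms(2) by auto
  have m: "odd m" "\<not> 5 dvd m" "m > 0" using k gcd_10 by (auto intro: gr0I)
  have e: "even ((2::nat) ^ b)" using b by auto
  have A: "fin_group (inv_sdp 5 (2 ^ b))" "order (inv_sdp 5 (2 ^ b)) = 5 * 2 ^ b"
    using fin_group_inv_sdp [OF _ _ e, of 5] by auto
  note F = iso_DirProd_cyc_facts [OF assms(1) A(1) m(3) iso]
  show "\<not> commpow 6 G" using F(2) not_commpow_inv_sdp_5 [OF e] by auto
  have "\<not> 4 dvd 10 * m" using m(1) by presburger
  then show "4 dvd order G \<longleftrightarrow> b = 2" unfolding F(1) A(2) using b by auto
  have "coprime (5 * 2 ^ b) m"
    using coprime_2_power [OF m(1), of b] prime_imp_coprime [OF prime_5 m(2)] by simp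
  then show "M_group G" using F(3) A(2) M_group_inv_sdp [OF prime_5, of b] b by auto
qed

lemma seven_cases: "i \<in> {1..7} \<Longrightarrow> i = 1 \<or> i = 2 \<or> i = 3 \<or> i = 4 \<or> i = 5 \<or> i = 6 \<or> i = (7::nat)"
  by auto

lemma in_class_M_group:
  assumes "group G" "in_class i G" "i \<in> {1..7}"
  shows "M_group G"
proof -
  have "in_class 6 G \<Longrightarrow> M_group G" "in_class 7 G \<Longrightarrow> M_group G"
    using in_class_67(3) [OF assms(1), of 1] in_class_67(3) [OF assms(1), of 2] by blast+
  then show ?thesis
    using seven_cases [OF assms(3)] assms(2) in_class_1(3) [OF assms(1)] in_class_2(3) [OF assms(1)]
      in_class_3(4) [OF assms(1)] in_class_4(4) [OF assms(1)] in_class_5(3) [OF assms(1)] by blast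
qed

lemma in_class_unique:
  assumes "group G" "in_class i G" "i \<in> {1..7}" "in_class j G" "j \<in> {1..7}"
  shows "i = j"
proof -
  \<comment> \<open>\<open>commpow 1\<close> is commutativity. Classes 3 and 4 have central squares
    and differ in whether 16 divides the order; class 5 has central sixth powers; classes 6 and 7
    have not, and differ in whether 4 divides the order.\<close>
  have *: "i = (if commpow 1 G then if cyclic_group G then 1 else 2
     else if commpow 2 G then if 16 dvd order G then 3 else 4
     else if commpow 6 G then 5 else if 4 dvd order G then 7 else 6)"
    if i: "in_class i G" "i \<in> {1..7}" for i
  proof -
    have m: "commpow 1 G \<Longrightarrow> commpow 2 G" "commpow 2 G \<Longrightarrow> commpow 6 G"
      using commpow_mono [OF assms(1), of 1 2] commpow_mono [OF assms(1), of 2 6] by auto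
    have 6: "in_class 6 G \<Longrightarrow> \<not> commpow 6 G \<and> \<not> 4 dvd order G"
      and 7: "in_class 7 G \<Longrightarrow> \<not> commpow 6 G \<and> 4 dvd order G"
      using in_class_67(1,2) [OF assms(1), of 1] in_class_67(1,2) [OF assms(1), of 2] by simp_all
    from seven_cases [OF i(2)] show ?thesis
    proof (elim disjE)
      assume "i = 1" then show ?thesis using i(1) in_class_1 [OF assms(1)] by simp
    next
      assume "i = 2" then show ?thesis using i(1) in_class_2 [OF assms(1)] by simp
    next
      assume "i = 3" then show ?thesis using i(1) in_class_3 [OF assms(1)] by simp
    next
      assume "i = 4" then show ?thesis using i(1) in_class_4 [OF assms(1)] by simp
    next
      assume "i = 5" then show ?thesis using i(1) in_class_5 [OF assms(1)] m by auto
    next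
      assume "i = 6" then show ?thesis using i(1) 6 m by auto
    next
      assume "i = 7" then show ?thesis using i(1) 7 m by auto
    qed
  qed
  show ?thesis using * [OF assms(2,3)] * [OF assms(4,5)] by simp
qed

section \<open>Models with the trivial cyclic factor\<close>

lemma iso_DirProd_cyc_1: "group E \<Longrightarrow> E \<cong> E \<times>\<times> cyc 1"
proof -
  assume "group E"
  have "(\<lambda>v. (v, 0)) \<in> iso E (E \<times>\<times> cyc 1)"
    by (rule isoI) (auto simp: hom_def bij_betw_def inj_on_def carrier_integer_mod_group)
  then show ?thesis by (rule is_isoI)
qed

lemma iso_sym_to_product:
  assumes "fin_group G" "fin_group E" "E \<cong> G"
  shows "G \<cong> E \<times>\<times> cyc 1"
proof -
  interpret E: fin_group E by (rule assms(2))
  show ?thesis using E.iso_sym [OF assms(3)] iso_DirProd_cyc_1 [OF E.is_group] iso_trans by blast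
qed

text \<open>The product of cyclic groups of orders \<open>M\<close> and 2, encoded on pairs of
  naturals so that \<open>metacyclic_iso\<close> treats it like the other models.\<close>

definition cyc2_model :: "nat \<Rightarrow> (nat \<times> nat) monoid" where
  "cyc2_model M = \<lparr>carrier = {..<M} \<times> {..<2},
     monoid.mult = (\<lambda>(a,b) (c,d). ((a + c) mod M, (b + d) mod 2)), one = (0, 0)\<rparr>"

lemma cyc2_model_metacyclic: "is_metacyclic (cyc2_model M) M 2 1 0"
  by (simp add: is_metacyclic_def cyc2_model_def)

lemma cyc2_model_iso:
  assumes "M > 0" shows "cyc2_model M \<cong> cyc M \<times>\<times> cyc 2"
proof -
  have "(\<lambda>(a,b). (int a, int b)) \<in> iso (cyc2_model M) (cyc M \<times>\<times> cyc 2)"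
  proof (rule isoI)
    show "(\<lambda>(a,b). (int a, int b)) \<in> hom (cyc2_model M) (cyc M \<times>\<times> cyc 2)"
      by (rule homI) (use assms in \<open>auto simp: cyc2_model_def carrier_integer_mod_group zmod_int\<close>)
    have inj: "inj_on (\<lambda>(a,b). (int a, int b)) ({..<M} \<times> {..<2})" by (auto simp: inj_on_def)
    have "(\<lambda>(a,b). (int a, int b)) ` ({..<M} \<times> {..<2}) = {0..<int M} \<times> {0..<2}"
      by (rule card_subset_eq) (use card_image [OF inj] in \<open>auto simp: card_cartesian_product\<close>)
    then show "bij_betw (\<lambda>(a,b). (int a, int b)) (carrier (cyc2_model M)) (carrier (cyc M \<times>\<times> cyc 2))"
      using inj assms by (simp add: bij_betw_def cyc2_model_def carrier_integer_mod_group)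
  qed
  then show ?thesis by (rule is_isoI)
qed

subsection \<open>2-groups\<close>

context fin_group
begin

text \<open>\<open>y x y^-1\<close> equals \<open>(y x)^2 x^-1 y^-2\<close>, and squares lie in a
  subgroup of index 2.\<close>

lemma index_2_conj:
  assumes S: "subgroup S G" "order G = 2 * card S" "x \<in> S" and y: "y \<in> carrier G"
  shows "y \<otimes> x \<otimes> inv y \<in> S"
proof -
  have xc: "x \<in> carrier G" using subgroup.mem_carrier [OF S(1,3)] .
  have "(y \<otimes> x) [^] (2::nat) \<in> S" "y [^] (2::nat) \<in> S" using index_2_square [OF S(1,2)] y xc by auto
  then have m: "y \<otimes> x \<otimes> (y \<otimes> x) \<in> S" "y \<otimes> y \<in> S" using y xc by (simp_all add: nat_pow_2)
  have "y \<otimes> x \<otimes> (y \<otimes> x) \<otimes> inv x \<otimes> inv (y \<otimes> y) \<in> S"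
    using m S subgroup.m_closed [OF S(1)] subgroup.m_inv_closed [OF S(1)] by simp
  moreover have "y \<otimes> x \<otimes> (y \<otimes> x) \<otimes> inv x \<otimes> inv (y \<otimes> y) = y \<otimes> x \<otimes> inv y"
  proof -
    have "y \<otimes> (inv y \<otimes> inv y) = inv y" using y by (simp flip: m_assoc)
    then show ?thesis using y xc by (simp add: m_assoc inv_mult_group)
  qed
  ultimately show ?thesis by simp
qed

text \<open>Let \<open>y\<close> lie outside a cyclic subgroup \<open>\<langle>x\<rangle>\<close> of index 2, and let \<open>c\<close> satisfy
  \<open>y x y\<^sup>-\<^sup>1 = x\<^sup>c\<close>. If \<open>c\<close> is 3 modulo 4, then all elements outside \<open>\<langle>x\<rangle>\<close> have order at most 4, which makes
  \<open>\<psi>(G)\<close> too small unless \<open>G\<close> is the quaternion group of order 8. Otherwise \<open>c\<close> is 1 or \<open>1 + ord x / 2\<close>, and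
  \<open>y\<close> can be chosen to be an involution.\<close>

lemma two_group_class:
  assumes n: "order G = 2 ^ k" and psi: "19 * cpsi (order G) < 43 * psi G"
  shows "\<exists>i\<in>{1..4}. in_class i G"
proof (cases "cyclic_group G")
  case True
  then show ?thesis by (intro bexI [of _ 1]) (auto simp: in_class_def)
next
  case nc: False
  have ncyc: "ord z \<noteq> order G" if "z \<in> carrier G" for z using nc that unfolding cyclic_group_iff by blast
  obtain x where x: "x \<in> carrier G" "\<And>y. y \<in> carrier G \<Longrightarrow> ord y \<le> ord x" using ex_max_ord by metis
  have psim: "psi G \<le> order G * ord x" by (rule psi_le_order_mult [OF x(2)])
  obtain d where d: "order G = ord x * d" using ord_dvd_group_order [OF x(1)] by auto
  have o0: "ord x > 0" using x by simp
  \<comment> \<open>The index \<open>d\<close> of the cyclic subgroup of \<open>x\<close> is below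
    \<open>129 / 38 < 4\<close>. Index 1 means cyclic, and 3 does not divide a power of 2.\<close>
  have "2 * (order G)\<^sup>2 \<le> 3 * cpsi (order G)"
    using cpsi_2_power_ge [of k] by (simp add: n)
  then have "38 * (order G * order G) < 129 * (order G * ord x)"
    using psi psim unfolding power2_eq_square by linarith
  then have "order G * (38 * order G) < order G * (129 * ord x)" by (simp only: mult.left_commute)
  then have "38 * order G < 129 * ord x" by (simp only: mult_less_cancel1)
  then have "38 * d < 129" using o0 by (simp add: d)
  then have "d = 0 \<or> d = 1 \<or> d = 2 \<or> d = 3" by linarith
  moreover have "d \<noteq> 0" using d order_pos by (intro notI) simp
  moreover have "d \<noteq> 1" using d ncyc [OF x(1)] by auto
  moreover have "d \<noteq> 3"
  proof
    assume "d = 3"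
    then have "3 dvd (2::nat) ^ k" using d n by (metis dvd_triv_right)
    then have "3 dvd (2::nat)" using prime_3 prime_dvd_power by blast
    then show False by simp
  qed
  ultimately have d2: "d = 2" by blast
  define M where "M = ord x"
  have nM: "order G = 2 * M" using d d2 by (simp add: M_def)
  have k0: "k > 0" using nM n by (cases k) auto
  have M: "M = 2 ^ (k-1)" using nM n k0 by (cases k) auto
  define S where "S = generate G {x}"
  have S: "subgroup S G" "card S = M" "x \<in> S" using x by (auto simp: S_def M_def)
  have nS: "order G = 2 * card S" using nM S(2) by simp
  have Sx: "\<exists>i::nat. z = x [^] i" if "z \<in> S" for z
    using that generate_singleton_nat [OF x(1)] by (auto simp: S_def)
  have pc: "x [^] (i::nat) = x [^] (j::nat) \<longleftrightarrow> [i = j] (mod M)" for i j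
    unfolding pow_eq_iff_nat [OF x(1)] M_def [symmetric] by (metis cong_iff_dvd_diff cong_int_iff)
  have "S \<noteq> carrier G"
  proof
    assume "S = carrier G"
    then have "card S = order G" by (simp add: order_def)
    then show False using nM S(2) o0 by (simp add: M_def)
  qed
  then obtain y where y: "y \<in> carrier G" "y \<notin> S" using subgroup.subset [OF S(1)] by blast
  have yx: "y \<otimes> x \<otimes> inv y \<in> S" by (rule index_2_conj [OF S(1) nS S(3) y(1)])
  obtain c where c: "y \<otimes> x \<otimes> inv y = x [^] (c::nat)" "c < M"
    using yx unfolding S_def generate_singleton [OF x(1)] M_def by auto
  have y2: "y [^] (2::nat) \<in> S" by (rule index_2_square [OF S(1) nS y(1)])
  obtain s where s: "y [^] (2::nat) = x [^] (s::nat)" using Sx [OF y2] by blast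
  have M1: "M \<noteq> 1"
  proof
    assume "M = 1"
    then have "x = \<one>" "order G = 2" using nM x ord_eq_1 by (auto simp: M_def)
    then have "y [^] (2::nat) = \<one>" using s by simp
    then have "ord y dvd 2" using y by (simp add: pow_eq_id)
    moreover have "ord y \<noteq> 1" using y S(1) subgroup.one_closed ord_eq_1 by blast
    ultimately have "ord y = 2" by (metis prime_nat_iff two_is_prime_nat)
    then show False using ncyc [OF y(1)] \<open>order G = 2\<close> by simp
  qed
  have evM: "even M" using M M1 by (cases "k - 1") auto
  have cc: "[c\<^sup>2 = 1] (mod M)"
  proof -
    have "x [^] (c ^ 2) = y [^] (2::nat) \<otimes> x \<otimes> inv (y [^] (2::nat))"
      using conj_iter [OF y(1) x(1) c(1), of 2] by simp
    also have "\<dots> = x [^] (1::nat)"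
      unfolding s using x(1) nat_pow_comm [of x s 1] by (simp add: m_assoc)
    finally show ?thesis unfolding pc .
  qed
  have cs: "[c * s = s] (mod M)"
  proof -
    have "x [^] (c * s) = y \<otimes> y [^] (2::nat) \<otimes> inv y"
      using conj_pow [OF y(1) x(1), of s] x(1) unfolding c(1) s by (simp add: nat_pow_pow)
    also have "\<dots> = x [^] s" unfolding s [symmetric] using y(1) nat_pow_comm [of y 1 2] by (simp add: m_assoc)
    finally show ?thesis unfolding pc .
  qed
  have "odd c"
  proof
    assume "even c"
    moreover have "[c\<^sup>2 = 1] (mod 2)" using cc evM by (metis cong_dvd_modulus_nat)
    ultimately show False by (simp add: cong_def power2_eq_square)
  qed
  have sq: "(x [^] i \<otimes> y) [^] (2::nat) = x [^] (i + i * c + s)" for i :: nat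
  proof -
    have "(x [^] i \<otimes> y) [^] (2::nat) = x [^] i \<otimes> (y \<otimes> x [^] i \<otimes> inv y) \<otimes> (y \<otimes> y)"
      using x(1) y(1) by (simp add: nat_pow_2 m_assoc) (simp flip: m_assoc)
    also have "y \<otimes> x [^] i \<otimes> inv y = x [^] (i * c)"
      using conj_pow [OF y(1) x(1), of i] x(1) unfolding c(1) by (simp add: nat_pow_pow mult.commute)
    also have "y \<otimes> y = x [^] s" using s y(1) by (simp add: nat_pow_2)
    finally show ?thesis using x(1) by (simp add: nat_pow_mult)
  qed
  have out: "\<exists>i::nat. z = x [^] i \<otimes> y" if z: "z \<in> carrier G" "z \<notin> S" for z
  proof -
    have ne: "\<one> \<noteq> y" using y subgroup.one_closed [OF S(1)] by blast
    have iy: "inv y \<notin> S" using y subgroup.m_inv_closed [OF S(1), of "inv y"] by auto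
    obtain r where r: "r \<in> {\<one>, y}" "z \<otimes> inv r \<in> S"
      by (rule transversal_covers [OF S(1), of "{\<one>, y}" z]) (use ne iy y z nS in auto)
    then have "r = y" using z by auto
    then obtain i :: nat where "z \<otimes> inv y = x [^] i" using Sx r(2) by blast
    then have "z = x [^] i \<otimes> y" using z(1) y(1) x(1) by (metis inv_solve_right nat_pow_closed)
    then show ?thesis by blast
  qed
  have outS: "x [^] i \<otimes> y \<notin> S" for i :: nat
  proof
    assume "x [^] i \<otimes> y \<in> S"
    moreover have "x [^] i \<in> S" using x(1) by (simp add: S_def)
    ultimately have "inv (x [^] i) \<otimes> (x [^] i \<otimes> y) \<in> S"
      using subgroup.m_closed [OF S(1)] subgroup.m_inv_closed [OF S(1)] by blast
    then show False using y x(1) by (simp flip: m_assoc)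
  qed
  have nin: "z [^] b \<notin> generate G {x}" if "z \<notin> S" "z \<in> carrier G" "0 < b" "b < 2" for z and b :: nat
  proof -
    have "b = 1" using that(3,4) by simp
    then show ?thesis using that(1,2) by (simp add: S_def)
  qed
  have conj: "(x [^] i \<otimes> y) \<otimes> x \<otimes> inv (x [^] i \<otimes> y) = x [^] c" for i :: nat
  proof -
    have "(x [^] i \<otimes> y) \<otimes> x \<otimes> inv (x [^] i \<otimes> y) = x [^] i \<otimes> (y \<otimes> x \<otimes> inv y) \<otimes> inv (x [^] i)"
      using x(1) y(1) by (simp add: m_assoc inv_mult_group)
    also have "\<dots> = x [^] c" unfolding c(1) using x(1) nat_pow_comm [of x i c] by (simp add: m_assoc)
    finally show ?thesis .
  qed
  have copM: "coprime M w" if "odd w" for w unfolding M using coprime_2_power [OF that] .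
  have copD: "M dvd z" if "odd w" "M dvd w * z" for w z
    using copM [OF that(1)] that(2) by (simp add: coprime_dvd_mult_right_iff)
  \<comment> \<open>All elements \<open>x [^] i \<otimes> y\<close> conjugate \<open>x\<close> as
    \<open>y\<close> does, so it remains to match \<open>c\<close> with a model and to choose
    \<open>i\<close> such that the square of this element is the one prescribed by the
    model.\<close>
  have model: "in_class j G"
    if "is_metacyclic E M 2 c' s'" "fin_group E" "[c = c'] (mod M)" "(x [^] i \<otimes> y) [^] (2::nat) = x [^] s'"
      "G \<cong> E \<times>\<times> cyc 1 \<Longrightarrow> in_class j G" for E c' s' j and i :: nat
  proof (rule that(5))
    have "E \<cong> G"
    proof (rule metacyclic_iso [OF that(1) _ x(1) _ _ that(4)])
      show "x [^] i \<otimes> y \<otimes> x \<otimes> inv (x [^] i \<otimes> y) = x [^] c'" unfolding conj pc by (rule that(3))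
      show "order G = M * 2" using nM by simp
      show "\<And>b::nat. 0 < b \<Longrightarrow> b < 2 \<Longrightarrow> (x [^] i \<otimes> y) [^] b \<notin> generate G {x}"
        using nin [OF outS] x(1) y(1) by simp
    qed (use x y in \<open>auto simp: M_def\<close>)
    then show "G \<cong> E \<times>\<times> cyc 1" using iso_sym_to_product that(2) fin_group_axioms by blast
  qed
  have cases4: "c mod 4 = 1 \<or> c mod 4 = 3" using \<open>odd c\<close> by presburger
  show ?thesis
  proof (cases "c mod 4 = 1")
    case True
    then obtain e where e: "c = 4 * e + 1" by (metis mult.commute div_mult_mod_eq)
    \<comment> \<open>\<open>c^2 - 1\<close> is \<open>8 * e\<close> times the odd number
      \<open>2 * e + 1\<close>. So \<open>M\<close> divides \<open>8 * e\<close>, and either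
      \<open>c\<close> is 1 modulo \<open>M\<close> or \<open>4 * e\<close> is an odd multiple of
      \<open>M / 2\<close>.\<close>
    have "M dvd 2 * (4 * e)"
    proof -
      have "c\<^sup>2 = 1 + (2 * e + 1) * (2 * (4 * e))" unfolding e by (simp add: power2_eq_square algebra_simps)
      then have "[1 + (2 * e + 1) * (2 * (4 * e)) = 1 + 0] (mod M)" using cc by simp
      then have "M dvd (2 * e + 1) * (2 * (4 * e))" by (simp only: cong_add_lcancel_nat cong_0_iff)
      then show ?thesis by (rule copD [rotated]) simp
    qed
    show ?thesis
    proof (cases "M dvd 4 * e")
      case T: True
      have c1: "[c = 1] (mod M)"
        unfolding e using T cong_add [OF _ cong_refl [of 1], of "4 * e" 0 M] by (simp add: cong_0_iff)
      \<comment> \<open>For odd \<open>s\<close> the square of \<open>y\<close> would generate the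
        subgroup of \<open>x\<close>, and \<open>y\<close> would have order
        \<open>2 * M\<close>.\<close>
      have "even s"
      proof (rule ccontr)
        assume "odd s"
        have "ord (y [^] (2::nat)) = M"
          unfolding s using copM [OF \<open>odd s\<close>] x(1) o0 by (auto simp: ord_pow_gen M_def)
        moreover have "even (ord y)" using index_2_odd [OF S(1) nS y(1)] y(2) by blast
        then have "ord (y [^] (2::nat)) = ord y div 2" using ord_pow [OF y(1), of 2] by simp
        ultimately have "ord y = 2 * M" using \<open>even (ord y)\<close> by auto
        then show False using ncyc [OF y(1)] nM by simp
      qed
      then obtain r where r: "s = 2 * r" by auto
      \<comment> \<open>\<open>M - 1\<close> acts as -1 modulo \<open>M\<close>, so \<open>i\<close>
        is \<open>-r\<close> and \<open>2 * i + s\<close> vanishes: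
        \<open>x [^] i \<otimes> y\<close> is an involution.\<close>
      define i where "i = (M - 1) * r"
      have "[i + i * c + s = i + i * 1 + s] (mod M)" by (intro cong_add cong_mult cong_refl c1)
      also have "i + i * 1 + s = 2 * r * M"
      proof -
        obtain M' where "M = Suc M'" using o0 unfolding M_def [symmetric] by (cases M) auto
        then show ?thesis by (simp add: i_def r algebra_simps)
      qed
      also have "[2 * r * M = 0] (mod M)" by (simp add: cong_0_iff)
      finally have e0: "(x [^] i \<otimes> y) [^] (2::nat) = x [^] (0::nat)" unfolding sq pc .
      have k2: "k \<ge> 2" using M M1 by (cases "k - 1") auto
      have isoto: "G \<cong> (cyc (2 ^ (k-1)) \<times>\<times> cyc 2) \<times>\<times> cyc 1"
        if iso: "G \<cong> cyc2_model M \<times>\<times> cyc 1"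
      proof -
        have fg: "fin_group (cyc2_model M)"
          by (rule fin_group_metacyclic(1) [OF cyc2_model_metacyclic]) (use o0 M_def in auto)
        have "cyc2_model M \<times>\<times> cyc 1 \<cong> (cyc M \<times>\<times> cyc 2) \<times>\<times> cyc 1"
          by (rule group.DirProd_iso_trans) (use fg fin_group.axioms(1) cyc2_model_iso o0 M_def in auto)
        then show ?thesis using iso_trans [OF iso] M by simp
      qed
      have fg: "fin_group (cyc2_model M)"
        by (rule fin_group_metacyclic(1) [OF cyc2_model_metacyclic]) (use o0 M_def in auto)
      have cls: "in_class 2 G" if "k \<ge> 2" "G \<cong> (cyc (2 ^ (k-1)) \<times>\<times> cyc 2) \<times>\<times> cyc 1"
      proof -
        have "\<exists>k m. k \<ge> 2 \<and> odd m \<and> G \<cong> (cyc (2 ^ (k-1)) \<times>\<times> cyc 2) \<times>\<times> cyc m"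
          using that by (intro exI [of _ k] exI [of _ "1::nat"]) simp
        then show ?thesis by (simp add: in_class_def)
      qed
      have "in_class 2 G"
        by (rule model [OF cyc2_model_metacyclic fg c1 e0]) (rule cls [OF k2 isoto])
      then show ?thesis by (intro bexI [of _ 2]) auto
    next
      case F: False
      have k4: "k \<ge> 4"
      proof (rule ccontr)
        assume "\<not> k \<ge> 4"
        then have "k - 1 \<le> 2" by simp
        then have "M dvd 2 ^ 2" unfolding M by (rule le_imp_power_dvd)
        then show False using F by (simp add: dvd_mult2)
      qed
      define T where "T = (2::nat) ^ (k-2)"
      have MT: "M = 2 * T" unfolding M T_def using k4 by (simp add: Suc_diff_Suc numeral_2_eq_2 flip: power_Suc)
      have "4 dvd T"
      proof -
        have "(2::nat) ^ 2 dvd 2 ^ (k-2)" by (rule le_imp_power_dvd) (use k4 in simp)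
        then show ?thesis by (simp add: T_def)
      qed
      have "T dvd 4 * e" using \<open>M dvd 2 * (4 * e)\<close> unfolding MT by simp
      then obtain w where w: "4 * e = T * w" by auto
      have "odd w"
      proof
        assume "even w"
        then obtain w' where "w = 2 * w'" by auto
        then have "4 * e = M * w'" using w MT by simp
        then show False using F by simp
      qed
      have ce: "[c = T + 1] (mod M)"
      proof -
        obtain w' where w': "w = 2 * w' + 1" using \<open>odd w\<close> by (auto elim: oddE)
        have "c = (T + 1) + w' * M" unfolding e w w' MT by (simp add: algebra_simps)
        then show ?thesis by (simp add: cong_def)
      qed
      have "even s"
      proof -
        have "c * s = s + s * (T * w)" unfolding e using w by (simp add: algebra_simps)
        then have "[s + s * (T * w) = s + 0] (mod M)" using cs by simp
        then have "M dvd s * (T * w)" by (simp only: cong_add_lcancel_nat cong_0_iff)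
        then have "2 dvd s * w" unfolding MT using T_def by (simp add: mult.left_commute)
        then show ?thesis using \<open>odd w\<close> by simp
      qed
      then obtain r where r: "s = 2 * r" by auto
      \<comment> \<open>An involution requires \<open>i * (1 + c) + s\<close> to vanish modulo
        \<open>2 * T\<close>, that is, \<open>v * i\<close> to be \<open>-r\<close> modulo
        \<open>T\<close>. As \<open>v\<close> is odd it has an inverse \<open>j\<close>, and
        \<open>T' = T - 1\<close> plays the role of -1.\<close>
      define v where "v = 2 * e + 1"
      have cv: "1 + c = 2 * v" by (simp add: e v_def)
      have "coprime v T" using coprime_2_power [of v "k-2"] by (simp add: T_def v_def coprime_commute)
      then obtain j where j: "[v * j = 1] (mod T)" using cong_solve_coprime_nat by auto
      have "T > 0" by (simp add: T_def)
      then obtain T' where T': "T = Suc T'" by (cases T) auto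
      define i where "i = j * (r * T')"
      have "[v * j * (r * T') + r = 1 * (r * T') + r] (mod T)" by (intro cong_add cong_mult cong_refl j)
      also have "1 * (r * T') + r = r * T" by (simp add: T')
      also have "[r * T = 0] (mod T)" by (simp add: cong_0_iff)
      finally have "T dvd v * j * (r * T') + r" by (simp add: cong_0_iff)
      then have "M dvd 2 * (v * j * (r * T') + r)" unfolding MT by (rule mult_dvd_mono [OF dvd_refl])
      moreover have "i + i * c + s = i * (1 + c) + s" by (simp add: algebra_simps)
      then have "i + i * c + s = 2 * (v * j * (r * T') + r)" unfolding cv by (simp add: i_def r algebra_simps)
      ultimately have "M dvd i + i * c + s" by simp
      then have e0: "(x [^] i \<otimes> y) [^] (2::nat) = x [^] (0::nat)" unfolding sq pc cong_0_iff .
      have cls: "in_class 3 G" if "G \<cong> Mgrp k \<times>\<times> cyc 1"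
      proof -
        have "\<exists>k m. k \<ge> 4 \<and> odd m \<and> G \<cong> Mgrp k \<times>\<times> cyc m"
          using that k4 by (intro exI [of _ k] exI [of _ "1::nat"]) simp
        then show ?thesis by (simp add: in_class_def)
      qed
      have fg: "fin_group (Mgrp k)" using fin_group_Mgrp(1) [of k] k4 by simp
      have "in_class 3 G"
        by (rule model [OF Mgrp_metacyclic [of k, folded M] fg ce [unfolded T_def] e0]) (rule cls)
      then show ?thesis by (intro bexI [of _ 3]) auto
    qed
  next
    case False
    then have "c mod 4 = 3" using cases4 by simp
    then obtain e where e: "c = 4 * e + 3" by (metis mult.commute div_mult_mod_eq)
    \<comment> \<open>\<open>c - 1\<close> is twice the odd number \<open>2 * e + 1\<close>, so the
      congruences \<open>cs\<close> and \<open>cc\<close> leave only a factor 2 in front of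
      \<open>s\<close> and of \<open>1 + c\<close>.\<close>
    have M2s: "M dvd 2 * s"
    proof -
      have "c * s = s + (2 * e + 1) * (2 * s)" unfolding e by (simp add: algebra_simps)
      then have "[s + (2 * e + 1) * (2 * s) = s + 0] (mod M)" using cs by simp
      then have "M dvd (2 * e + 1) * (2 * s)" by (simp only: cong_add_lcancel_nat cong_0_iff)
      then show ?thesis by (rule copD [rotated]) simp
    qed
    have M2c: "M dvd 2 * (1 + c)"
    proof -
      have "c\<^sup>2 = 1 + (2 * e + 1) * (2 * (1 + c))" unfolding e by (simp add: power2_eq_square algebra_simps)
      then have "[1 + (2 * e + 1) * (2 * (1 + c)) = 1 + 0] (mod M)" using cc by simp
      then have "M dvd (2 * e + 1) * (2 * (1 + c))" by (simp only: cong_add_lcancel_nat cong_0_iff)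
      then show ?thesis by (rule copD [rotated]) simp
    qed
    have ord4: "ord z dvd 4" if z: "z \<in> carrier G" "z \<notin> S" for z
    proof -
      obtain i :: nat where i: "z = x [^] i \<otimes> y" using out [OF z] by blast
      have "z [^] (4::nat) = (z [^] (2::nat)) [^] (2::nat)" using z(1) by (simp add: nat_pow_pow)
      also have "\<dots> = x [^] ((i + i * c + s) * 2)" unfolding i sq using x(1) by (simp add: nat_pow_pow)
      also have "(i + i * c + s) * 2 = i * (2 * (1 + c)) + 2 * s" by (simp add: algebra_simps)
      also have "x [^] (i * (2 * (1 + c)) + 2 * s) = x [^] (0::nat)"
        unfolding pc cong_0_iff by (rule dvd_add [OF dvd_mult [OF M2c] M2s])
      finally show ?thesis using z(1) by (simp add: pow_eq_id)
    qed
    have split: "psi G = cpsi M + (\<Sum>z\<in>carrier G - S. ord z)"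
      using psi_split [OF subgroup.subset [OF S(1)]] sum_ord_generate [OF x(1)] by (simp add: S_def M_def)
    have cout: "card (carrier G - S) = M"
      using card_Diff_subset [OF subgroup_finite [OF S(1)] subgroup.subset [OF S(1)]] S(2) nM by (simp add: order_def)
    have cM: "3 * cpsi M = 2 * M\<^sup>2 + 1" using cpsi_2_power_ge [of "k-1"] by (simp add: M)
    have cn: "3 * cpsi (order G) = 8 * M\<^sup>2 + 1"
      using cpsi_2_power_ge [of k] by (simp flip: n) (simp add: nM power_mult_distrib)
    have "M \<noteq> 2" using c(2) e by simp
    have "(\<Sum>z\<in>carrier G - S. ord z) \<le> M * 4"
    proof -
      have "ord z \<le> 4" if "z \<in> carrier G - S" for z using ord4 [of z] that by (intro dvd_imp_le) auto
      then show ?thesis using psi_le_card_mult [of "carrier G - S" 4] cout by simp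
    qed
    \<comment> \<open>The threshold now bounds a quadratic in \<open>M\<close> by a linear one and
      gives \<open>M < 8\<close>; as \<open>c\<close> is 3 modulo 4 and below \<open>M\<close>, only
      \<open>M = 4\<close> remains.\<close>
    then have "psi G \<le> cpsi M + 4 * M" using split by simp
    then have le: "43 * (3 * psi G) \<le> 43 * (3 * cpsi M + 12 * M)" by simp
    have "19 * (3 * cpsi (order G)) < 43 * (3 * psi G)" using psi by simp
    then have "19 * (8 * M\<^sup>2 + 1) < 43 * (2 * M\<^sup>2 + 1 + 12 * M)"
      using le unfolding cM cn by (rule less_le_trans)
    then have "66 * M\<^sup>2 < 516 * M + 24" by simp
    have "M < 8"
    proof (rule ccontr)
      assume "\<not> M < 8"
      then have "8 * M \<le> M\<^sup>2" by (simp add: power2_eq_square)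
      then show False using \<open>66 * M\<^sup>2 < 516 * M + 24\<close> \<open>\<not> M < 8\<close> by linarith
    qed
    then have "(2::nat) ^ (k-1) < 2 ^ 3" by (simp add: M)
    then have "k - 1 < 3" by (rule power_less_imp_less_exp [rotated]) simp
    then have "k - 1 = 0 \<or> k - 1 = 1 \<or> k - 1 = 2" by linarith
    then have "M = 1 \<or> M = 2 \<or> M = 4" using M by auto
    then have M4: "M = 4" using M1 \<open>M \<noteq> 2\<close> by blast
    have "even s" using M2s unfolding M4 by presburger
    \<comment> \<open>For \<open>s\<close> divisible by 4 the group is D_8: then \<psi> is at most
      \<open>11 + 4 * 2 = 19\<close> while \<open>cpsi 8 = 43\<close>, and the strict inequality
      fails with equality.\<close>
    have s2: "[s = 2] (mod 4)"
    proof (rule ccontr)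
      assume "\<not> [s = 2] (mod 4)"
      then have s0: "4 dvd s" using \<open>even s\<close> unfolding cong_def by presburger
      have "ord z \<le> 2" if z: "z \<in> carrier G" "z \<notin> S" for z
      proof -
        obtain i :: nat where i: "z = x [^] i \<otimes> y" using out [OF z] by blast
        have "i + i * c + s = 4 * (i * (e + 1)) + s" unfolding e by (simp add: algebra_simps)
        then have "4 dvd i + i * c + s" using s0 by (simp only: dvd_add_right_iff dvd_triv_left)
        then have "z [^] (2::nat) = x [^] (0::nat)" unfolding i sq pc by (simp add: M4 cong_0_iff)
        then have "ord z dvd 2" using z(1) by (simp add: pow_eq_id)
        then show ?thesis by (simp add: dvd_imp_le)
      qed
      then have "(\<Sum>z\<in>carrier G - S. ord z) \<le> M * 2"
        using psi_le_card_mult [of "carrier G - S" 2] cout by simp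
      then show False using split psi cM cn by (simp add: M4)
    qed
    have e2: "(x [^] (0::nat) \<otimes> y) [^] (2::nat) = x [^] (2::nat)" unfolding sq pc using s2 by (simp add: M4)
    have c3: "[c = 3] (mod M)" using \<open>c mod 4 = 3\<close> by (simp add: M4 cong_def)
    have cls: "in_class 4 G" if "G \<cong> Q8 \<times>\<times> cyc 1"
    proof -
      have "\<exists>m. odd m \<and> G \<cong> Q8 \<times>\<times> cyc m" using that by (intro exI [of _ "1::nat"]) simp
      then show ?thesis by (simp add: in_class_def)
    qed
    have "in_class 4 G"
      by (rule model [OF Q8_metacyclic [folded M4] fin_group_Q8(1) c3 e2]) (rule cls)
    then show ?thesis by (intro bexI [of _ 4]) auto
  qed
qed

end

subsection \<open>The classification\<close>

lemma DirProd_assoc_iso: "(A \<times>\<times> B) \<times>\<times> C \<cong> A \<times>\<times> (B \<times>\<times> C)"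
proof -
  have "(\<lambda>((x, y), z). (x, (y, z))) \<in> iso ((A \<times>\<times> B) \<times>\<times> C) (A \<times>\<times> (B \<times>\<times> C))"
    by (rule isoI) (force simp: hom_def bij_betw_def inj_on_def image_def)+
  then show ?thesis by (rule is_isoI)
qed

lemma iso_DirProd_cyc_cyc:
  assumes "fin_group G" "fin_group K" "fin_group E" "fin_group P"
    and "K \<times>\<times> P \<cong> G" "K \<cong> E \<times>\<times> cyc m" "P \<cong> cyc q" "m > 0" "q > 0" "coprime m q"
  shows "G \<cong> E \<times>\<times> cyc (m * q)"
proof -
  interpret K: fin_group K by (rule assms(2))
  interpret E: fin_group E by (rule assms(3))
  interpret P: fin_group P by (rule assms(4))
  interpret KP: fin_group "K \<times>\<times> P" by (rule fin_group_DirProd(1) [OF assms(2,4)])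
  have "G \<cong> K \<times>\<times> P" by (rule KP.iso_sym [OF assms(5)])
  also have "K \<times>\<times> P \<cong> (E \<times>\<times> cyc m) \<times>\<times> cyc q" by (rule K.DirProd_iso_trans [OF assms(6,7)])
  also have "(E \<times>\<times> cyc m) \<times>\<times> cyc q \<cong> E \<times>\<times> (cyc m \<times>\<times> cyc q)"
    by (rule DirProd_assoc_iso)
  also have "E \<times>\<times> (cyc m \<times>\<times> cyc q) \<cong> E \<times>\<times> cyc (m * q)"
    by (rule E.DirProd_iso_trans [OF iso_refl cyc_DirProd [OF assms(10,8,9)]])
  finally show ?thesis .
qed

lemma iso_DirProd_cyc_extend:
  assumes "fin_group G" "fin_group K" "fin_group P"
    and "K \<times>\<times> P \<cong> G" "P \<cong> cyc q" "odd q" "coprime (order K) q"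
    and "fin_group E" "m > 0" "K \<cong> E \<times>\<times> cyc m"
  shows "G \<cong> E \<times>\<times> cyc (m * q)"
proof -
  interpret K: fin_group K by (rule assms(2))
  have "order K = order E * m" using iso_DirProd_cyc_facts(1) [OF K.is_group assms(8-10)] .
  then have "coprime m q" using assms(7) by simp
  moreover have "q > 0" using assms(6) by (auto intro: gr0I)
  ultimately show ?thesis by (intro iso_DirProd_cyc_cyc [OF assms(1,2,8,3,4,10,5,9)])
qed

text \<open>By the Chinese remainder theorem the coprime factor \<open>cyc q\<close> merges with the
  factor \<open>cyc m\<close> of the class. The conditions on \<open>m\<close> survive because
  \<open>q\<close> is odd and prime to the order of \<open>K\<close>, hence to 3 or 5 where the
  model has that factor.\<close>

lemma in_class_extend:
  assumes G: "fin_group G" and K: "fin_group K" and P: "fin_group P"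
    and iso: "K \<times>\<times> P \<cong> G" "P \<cong> cyc q" and q: "odd q" "coprime (order K) q"
    and i: "in_class i K" "i \<in> {1..7}"
  shows "in_class i G"
proof -
  interpret G: fin_group G by (rule G)
  interpret K: fin_group K by (rule K)
  interpret P: fin_group P by (rule P)
  have q0: "q > 0" using q by (auto intro: gr0I)
  note ext = iso_DirProd_cyc_extend [OF G K P iso q]
  have oE: "coprime (order E) q" if "fin_group E" "m > 0" "K \<cong> E \<times>\<times> cyc m"
    for E :: "(nat \<times> nat) monoid" and m
    using iso_DirProd_cyc_facts(1) [OF K.is_group that] q(2) by simp
  from seven_cases [OF i(2)] show ?thesis
  proof (elim disjE)
    assume i1: "i = 1"
    then have "cyclic_group K" using i(1) by (simp add: in_class_def)
    then have "K \<cong> cyc (order K)" using K.cyclic_iff_iso_cyc by blast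
    have KP: "group (K \<times>\<times> P)" by (rule DirProd_group [OF K.is_group P.is_group])
    have "K \<times>\<times> P \<cong> cyc (order K) \<times>\<times> cyc q"
      by (rule K.DirProd_iso_trans [OF \<open>K \<cong> cyc (order K)\<close> iso(2)])
    also have "cyc (order K) \<times>\<times> cyc q \<cong> cyc (order K * q)"
      by (rule cyc_DirProd [OF q(2) _ q0]) simp
    finally have "K \<times>\<times> P \<cong> cyc (order K * q)" .
    then have GK: "G \<cong> cyc (order K * q)" using iso_trans [OF group.iso_sym [OF KP iso(1)]] by blast
    then have "order G = order K * q" using iso_same_card [OF GK] order_cyc by (simp add: order_def)
    then have "cyclic_group G" using GK G.cyclic_iff_iso_cyc by simp
    then show ?thesis by (simp add: in_class_def i1)
  next
    assume i2: "i = 2"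
    then obtain k m where k: "k \<ge> 2" "odd m" "K \<cong> (cyc (2 ^ (k-1)) \<times>\<times> cyc 2) \<times>\<times> cyc m"
      using i(1) by (auto simp: in_class_def)
    have "m > 0" using k by (auto intro: gr0I)
    then have "G \<cong> (cyc (2 ^ (k-1)) \<times>\<times> cyc 2) \<times>\<times> cyc (m * q)"
      using ext [OF fin_group_cyc2(1) _ k(3)] by blast
    then have "\<exists>k m. k \<ge> 2 \<and> odd m \<and> G \<cong> (cyc (2 ^ (k-1)) \<times>\<times> cyc 2) \<times>\<times> cyc m"
      using k(1,2) q(1) by (intro exI [of _ k] exI [of _ "m * q"]) simp
    then show ?thesis by (simp add: in_class_def i2)
  next
    assume i3: "i = 3"
    then obtain k m where k: "k \<ge> 4" "odd m" "K \<cong> Mgrp k \<times>\<times> cyc m"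
      using i(1) by (auto simp: in_class_def)
    have "m > 0" using k by (auto intro: gr0I)
    then have "G \<cong> Mgrp k \<times>\<times> cyc (m * q)"
      using ext [OF fin_group_Mgrp(1) _ k(3)] k(1) by simp
    then have "\<exists>k m. k \<ge> 4 \<and> odd m \<and> G \<cong> Mgrp k \<times>\<times> cyc m"
      using k(1,2) q(1) by (intro exI [of _ k] exI [of _ "m * q"]) simp
    then show ?thesis by (simp add: in_class_def i3)
  next
    assume i4: "i = 4"
    then obtain m where k: "odd m" "K \<cong> Q8 \<times>\<times> cyc m"
      using i(1) by (auto simp: in_class_def)
    have "m > 0" using k by (auto intro: gr0I)
    then have "G \<cong> Q8 \<times>\<times> cyc (m * q)"
      using ext [OF fin_group_Q8(1) _ k(2)] by simp
    then have "\<exists>m. odd m \<and> G \<cong> Q8 \<times>\<times> cyc m"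
      using k(1) q(1) by (intro exI [of _ "m * q"]) simp
    then show ?thesis by (simp add: in_class_def i4)
  next
    assume i5: "i = 5"
    then obtain k m where k: "k \<ge> 1" "gcd m 6 = 1" "K \<cong> inv_sdp 3 (2 ^ k) \<times>\<times> cyc m"
      using i(1) by (auto simp: in_class_def)
    have m: "odd m" "\<not> 3 dvd m" "m > 0" using k(2) gcd_6 by (auto intro: gr0I)
    have e: "even ((2::nat) ^ k)" using k by simp
    note A = fin_group_inv_sdp [OF _ _ e, of 3, simplified]
    have "coprime 3 q" using oE [OF A(1) m(3) k(3)] A(2) by simp
    then have "\<not> 3 dvd q" using coprime_absorb_left [of 3 q] by auto
    then have "\<not> 3 dvd m * q" using m(2) prime_dvd_mult_nat [OF prime_3] by blast
    then have "gcd (m * q) 6 = 1" using gcd_6 m(1) q(1) by simp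
    moreover have "G \<cong> inv_sdp 3 (2 ^ k) \<times>\<times> cyc (m * q)" using ext [OF A(1) m(3) k(3)] by simp
    ultimately have "\<exists>k m. k \<ge> 1 \<and> gcd m 6 = 1 \<and> G \<cong> inv_sdp 3 (2 ^ k) \<times>\<times> cyc m" using k(1) by (intro exI [of _ k] exI [of _ "m * q"] conjI)
    then show ?thesis by (simp add: in_class_def i5)
  next
    assume i6: "i = 6"
    then obtain m where k: "gcd m 10 = 1" "K \<cong> inv_sdp 5 2 \<times>\<times> cyc m"
      using i(1) by (auto simp: in_class_def)
    have m: "odd m" "\<not> 5 dvd m" "m > 0" using k(1) gcd_10 by (auto intro: gr0I)
    note A = fin_group_inv_sdp [of 5 2, simplified]
    have "coprime (5 * 2) q" using oE [OF A(1) m(3) k(2)] A(2) by simp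
    then have "coprime 5 q" using coprime_mult_left_iff [of 5 _ q] by blast
    then have "\<not> 5 dvd q" using coprime_absorb_left [of 5 q] by auto
    then have "\<not> 5 dvd m * q" using m(2) prime_dvd_mult_nat [OF prime_5] by blast
    then have "gcd (m * q) 10 = 1" using gcd_10 m(1) q(1) by simp
    moreover have "G \<cong> inv_sdp 5 2 \<times>\<times> cyc (m * q)" using ext [OF A(1) m(3) k(2)] by simp
    ultimately have "\<exists>m. gcd m 10 = 1 \<and> G \<cong> inv_sdp 5 2 \<times>\<times> cyc m" by (intro exI [of _ "m * q"] conjI)
    then show ?thesis by (simp add: in_class_def i6)
  next
    assume i7: "i = 7"
    then obtain m where k: "gcd m 10 = 1" "K \<cong> inv_sdp 5 4 \<times>\<times> cyc m"
      using i(1) by (auto simp: in_class_def)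
    have m: "odd m" "\<not> 5 dvd m" "m > 0" using k(1) gcd_10 by (auto intro: gr0I)
    note A = fin_group_inv_sdp [of 5 4, simplified]
    have "coprime (5 * 4) q" using oE [OF A(1) m(3) k(2)] A(2) by simp
    then have "coprime 5 q" using coprime_mult_left_iff [of 5 _ q] by blast
    then have "\<not> 5 dvd q" using coprime_absorb_left [of 5 q] by auto
    then have "\<not> 5 dvd m * q" using m(2) prime_dvd_mult_nat [OF prime_5] by blast
    then have "gcd (m * q) 10 = 1" using gcd_10 m(1) q(1) by simp
    moreover have "G \<cong> inv_sdp 5 4 \<times>\<times> cyc (m * q)" using ext [OF A(1) m(3) k(2)] by simp
    ultimately have "\<exists>m. gcd m 10 = 1 \<and> G \<cong> inv_sdp 5 4 \<times>\<times> cyc m" by (intro exI [of _ "m * q"] conjI)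
    then show ?thesis by (simp add: in_class_def i7)
  qed
qed

lemma cpsi_ge_self: "n \<le> cpsi n"
proof -
  have "(\<Sum>i<n. 1) \<le> cpsi n"
    unfolding cpsi_def
  proof (rule sum_mono)
    fix i assume "i \<in> {..<n}"
    then have "n > 0" by auto
    then show "1 \<le> n div gcd n i" by (simp add: Suc_le_eq div_greater_zero_iff dvd_imp_le)
  qed
  then show ?thesis by simp
qed

lemma cpsi_small: "cpsi 3 = 7" "cpsi 5 = 21" "cpsi 2 = 3" "cpsi 4 = 11"
proof -
  show "cpsi 3 = 7" using cpsi_prime_power [OF prime_3, of 1] by simp
  show "cpsi 5 = 21" using cpsi_prime_power [OF prime_5, of 1] by simp
  show "cpsi 2 = 3" using cpsi_prime_power [OF two_is_prime_nat, of 1] by simp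
  show "cpsi 4 = 11" using cpsi_prime_power [OF two_is_prime_nat, of 2] by simp
qed

text \<open>The order of the Sylow subgroup is bounded because a proper subgroup \<open>K\<close> of the quotient
  satisfies \<open>\<psi>(K) \<le> \<psi>(C) / 3\<close> for the cyclic group \<open>C\<close> of the same order as the quotient.\<close>

lemma odd_prime_power_bound:
  fixes p a :: nat
  assumes p: "prime p" "p \<ge> 3" and a: "a > 0" and b: "7 * cpsi (p ^ a) < 43 * p ^ a"
  shows "p ^ a = 3 \<or> p ^ a = 5"
proof -
  define q where "q = p ^ a"
  have "3 * (p + 1) * q\<^sup>2 \<le> 4 * (p * q\<^sup>2)" using p(2) by (simp add: algebra_simps)
  also have "\<dots> \<le> 4 * ((p + 1) * cpsi q)" using cpsi_prime_power [OF p(1), of a] by (simp add: q_def)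
  finally have "(p + 1) * (3 * q\<^sup>2) \<le> (p + 1) * (4 * cpsi q)" by (simp add: algebra_simps)
  then have "3 * q\<^sup>2 \<le> 4 * cpsi q" by (metis Suc_eq_plus1 Suc_mult_le_cancel1)
  then have "7 * (3 * q\<^sup>2) \<le> 4 * (7 * cpsi q)" by simp
  also have "\<dots> < 4 * (43 * q)" using b by (simp add: q_def)
  finally have "(21 * q) * q < 172 * q" by (simp add: power2_eq_square)
  then have "21 * q < 172" by (simp only: mult_less_cancel2)
  then have "q < 9" by simp
  have "odd p" using p prime_odd_nat by simp
  then have "odd q" by (simp add: q_def)
  have "p \<le> q" using a p by (simp add: q_def self_le_power)
  then have "q = 3 \<or> q = 5 \<or> q = 7" using \<open>q < 9\<close> \<open>odd q\<close> p(2)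
  proof -
    have "q = 3 \<or> q = 4 \<or> q = 5 \<or> q = 6 \<or> q = 7 \<or> q = 8" using \<open>p \<le> q\<close> p(2) \<open>q < 9\<close> by linarith
    then show ?thesis using \<open>odd q\<close> by auto
  qed
  \<comment> \<open>Again a case of equality: \<open>cpsi 7 = 43\<close>, so both sides of
    \<open>b\<close> would be \<open>7 * 43\<close>.\<close>
  moreover have "q \<noteq> 7"
  proof
    assume "q = 7"
    have "8 * cpsi (7 ^ 1) = 7 * (7 ^ 1)\<^sup>2 + 1" using cpsi_prime_power [OF prime_7, of 1] by simp
    then have "cpsi 7 = 43" by simp
    then show False using b \<open>q = 7\<close> by (simp add: q_def)
  qed
  ultimately show ?thesis by (simp add: q_def)
qed

section \<open>Central and noncentral Sylow subgroups\<close>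

context fin_group
begin

text \<open>\<psi> and \<open>cpsi\<close> are both multiplicative here, so cancelling
  \<open>cpsi (ord u)\<close> hands the hypothesis on to the complement. The prime of
  \<open>u\<close> is not fixed, because the noncentral case applies this to a central Sylow
  3-subgroup while the largest prime is 5.\<close>

lemma class_of_central_sylow:
  assumes IH: "\<And>K. subgroup K G \<Longrightarrow> card K < order G \<Longrightarrow>
      19 * cpsi (card K) < 43 * psi (G\<lparr>carrier := K\<rparr>) \<Longrightarrow> \<exists>i\<in>{1..7}. in_class i (G\<lparr>carrier := K\<rparr>)"
    and psi: "19 * cpsi (order G) < 43 * psi G"
    and u: "u \<in> carrier G" "\<And>g. g \<in> carrier G \<Longrightarrow> g \<otimes> u = u \<otimes> g"
    and n: "order G = ord u * t" "coprime (ord u) t" "odd (ord u)" "ord u > 1"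
  shows "\<exists>i\<in>{1..7}. in_class i G"
proof -
  define P where "P = generate G {u}"
  have P: "subgroup P G" "card P = ord u" using u by (auto simp: P_def)
  have central: "z \<otimes> g = g \<otimes> z" if "z \<in> P" "g \<in> carrier G" for z g
    using commutes_generate [OF that(2) u(1) u(2) [OF that(2)]] that(1) by (simp add: P_def)
  obtain K where K: "subgroup K G" "card K = t"
    using central_complement [OF P(1) central, of t] n(1,2) P(2) by auto
  have cop: "coprime (card K) (card P)" using n(2) K P by (simp add: coprime_commute)
  have comm: "a \<otimes> b = b \<otimes> a" if "a \<in> K" "b \<in> P" for a b
    using central [OF that(2)] subgroup.mem_carrier [OF K(1) that(1)] by simp
  have oG: "order G = card K * card P" using n(1) K P by simp
  note prod = internal_direct_product [OF K(1) P(1) cop comm oG]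
  have t0: "t > 0" using n(1) order_pos by (intro gr0I) simp
  have "psi (G\<lparr>carrier := P\<rparr>) = cpsi (ord u)"
    using psi_subgroup [OF P(1)] sum_ord_generate [OF u(1)] by (simp add: P_def)
  then have "psi G = psi (G\<lparr>carrier := K\<rparr>) * cpsi (ord u)" using prod(2) by simp
  moreover have "cpsi (order G) = cpsi (card K) * cpsi (ord u)"
    unfolding oG K(2) P(2) using cpsi_mult [of t "ord u"] n t0 by (simp add: coprime_commute)
  ultimately have "(19 * cpsi (card K)) * cpsi (ord u) < (43 * psi (G\<lparr>carrier := K\<rparr>)) * cpsi (ord u)"
    using psi by simp
  then have "19 * cpsi (card K) < 43 * psi (G\<lparr>carrier := K\<rparr>)" by simp
  moreover have "card K < order G" using n(1,4) K(2) t0 by simp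
  ultimately obtain i where i: "i \<in> {1..7}" "in_class i (G\<lparr>carrier := K\<rparr>)" using IH [OF K(1)] by blast
  interpret FP: fin_group "G\<lparr>carrier := P\<rparr>" by (rule subgroup_fin_group [OF P(1)])
  have "FP.ord u = order (G\<lparr>carrier := P\<rparr>)"
    using ord_subgroup [OF P(1), of u] u(1) P(2) by (simp add: P_def order_def)
  then have "cyclic_group (G\<lparr>carrier := P\<rparr>)"
    unfolding FP.cyclic_group_iff using u(1) by (intro bexI [of _ u]) (auto simp: P_def)
  then have "G\<lparr>carrier := P\<rparr> \<cong> cyc (ord u)"
    using FP.cyclic_iff_iso_cyc P(2) by (simp add: order_subgroup)
  then have "in_class i G"
    using in_class_extend [OF fin_group_axioms subgroup_fin_group [OF K(1)] FP.fin_group_axioms prod(1) _ n(3) _ i(2,1)]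
      cop P(2) by (simp add: order_subgroup)
  then show ?thesis using i(1) by blast
qed

text \<open>If the maximal cyclic subgroups of largest order have index at least 4, the average
  order is at most a quarter of the group order. For index 2 write the order as
  \<open>4 * m\<close>: the squares of \<open>x\<close> generate \<open>m\<close> elements of order
  at most \<open>m\<close>, and the other \<open>3 * m\<close> have order at most
  \<open>2 * m\<close>, in total \<open>7 * m^2\<close>.\<close>

lemma psi_noncyclic_2_group:
  assumes n: "order G = 2 ^ k" and nc: "\<not> cyclic_group G"
  shows "16 * psi G \<le> 7 * (order G)\<^sup>2"
proof -
  obtain x where x: "x \<in> carrier G" "\<And>y. y \<in> carrier G \<Longrightarrow> ord y \<le> ord x" using ex_max_ord by metis
  have psim: "psi G \<le> order G * ord x" by (rule psi_le_order_mult [OF x(2)])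
  obtain d where d: "order G = ord x * d" using ord_dvd_group_order [OF x(1)] by auto
  have "d dvd 2 ^ k" using d n by (metis dvd_triv_right)
  then obtain j where j: "d = 2 ^ j" using divides_primepow_nat [OF two_is_prime_nat] by blast
  have "d \<noteq> 1" using nc d x(1) unfolding cyclic_group_iff by auto
  show ?thesis
  proof (cases "d = 2")
    case False
    then have "j \<noteq> 0" "j \<noteq> 1" using j \<open>d \<noteq> 1\<close> by auto
    then have "(2::nat) ^ 2 dvd 2 ^ j" by (intro le_imp_power_dvd) simp
    then obtain w where w: "d = 4 * w" using j by auto
    then have "w > 0" using d order_pos by (intro gr0I) simp
    then have "4 * ord x \<le> order G" unfolding d w by simp
    then have "4 * (order G * ord x) \<le> (order G)\<^sup>2" by (simp add: power2_eq_square)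
    then show ?thesis using psim by linarith
  next
    case True
    have ox1: "ord x \<noteq> 1"
    proof
      assume "ord x = 1"
      then have o2: "order G = 2" using d True by simp
      obtain y where y: "y \<in> carrier G" "y \<noteq> \<one>"
      proof -
        have "carrier G \<noteq> {\<one>}" using o2 by (auto simp: order_def)
        then show ?thesis using that by blast
      qed
      then have "ord y \<noteq> 1" using ord_eq_1 by blast
      moreover have "ord y \<le> 1" using x(2) [OF y(1)] \<open>ord x = 1\<close> by simp
      moreover have "ord y > 0" using y by simp
      ultimately show False by linarith
    qed
    have "ord x dvd 2 ^ k" using d n by (metis dvd_triv_left)
    then obtain l where l: "ord x = 2 ^ l" using divides_primepow_nat [OF two_is_prime_nat] by blast
    then obtain m where m: "ord x = 2 * m" using ox1 by (cases l) auto
    have m0: "m > 0" using m x(1) ord_pos [of x] by simp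
    define T where "T = generate G {x [^] (2::nat)}"
    have "ord (x [^] (2::nat)) = m" using ord_pow [OF x(1), of 2] m by simp
    then have T: "subgroup T G" "card T = m" using x(1) by (auto simp: T_def)
    have "ord z \<le> m" if "z \<in> T" for z
      using order_dvd_subgroup [OF T(1) that] T(2) m0 by (simp add: dvd_imp_le)
    then have 1: "(\<Sum>z\<in>T. ord z) \<le> m * m"
      using psi_le_card_mult [OF subgroup.subset [OF T(1)], of m] T(2) by simp
    have "card (carrier G - T) = 3 * m"
      using card_Diff_subset [OF subgroup_finite [OF T(1)] subgroup.subset [OF T(1)]] T(2) d True m by (simp add: order_def)
    then have 2: "(\<Sum>z\<in>carrier G - T. ord z) \<le> 3 * m * (2 * m)"
      using psi_le_card_mult [of "carrier G - T" "2 * m"] x(2) m by simp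
    have "psi G \<le> 7 * (m * m)" using psi_split [OF subgroup.subset [OF T(1)]] 1 2 by simp
    then show ?thesis using d True m by (simp add: power2_eq_square)
  qed
qed

lemma psi_noncyclic_le_half:
  assumes "\<not> cyclic_group G" "y \<in> carrier G"
  shows "2 * ord y \<le> order G"
proof -
  obtain d where d: "order G = ord y * d" using ord_dvd_group_order [OF assms(2)] by auto
  have "d \<noteq> 1" using assms d unfolding cyclic_group_iff by auto
  moreover have "d \<noteq> 0" using d order_pos by (intro notI) simp
  ultimately show ?thesis unfolding d by simp
qed

text \<open>Every coset has a representative of the same order as the coset, by
  \<open>coprime_part\<close>; a generator of the quotient thus lifts without growing.\<close>

lemma lift_generator:
  assumes P: "P \<lhd> G" "card P = q" and n: "order G = q * t" "coprime q t"
    and c: "c \<in> carrier (G Mod P)" "group.ord (G Mod P) c = t"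
  obtains y where "y \<in> c" "y \<in> carrier G" "ord y = t"
proof -
  have PG: "subgroup P G" using P(1) by (rule normal_imp_subgroup)
  obtain g where g: "g \<in> carrier G" "c = P #> g" using c(1) by (auto simp: carrier_FactGroup)
  have "g [^] t \<in> P" using ord_rcoset_dvd_iff [OF P(1) g(1), of t] c(2) g(2) by simp
  then obtain h where h: "h \<in> P #> g" "h [^] t = \<one>" using coprime_part [OF P g(1) _ n(2)] by blast
  have hc: "h \<in> carrier G" using h(1) g(1) r_coset_subset_G subgroup.subset [OF PG] by blast
  have ch: "c = P #> h" using repr_independence [OF h(1) g(1) PG] g(2) by simp
  have "ord h dvd t" using h(2) hc by (simp add: pow_eq_id)
  moreover have "t dvd ord h"
    using ord_rcoset_dvd_iff [OF P(1) hc, of "ord h"] c(2) ch hc subgroup.one_closed [OF PG] by simp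
  ultimately have "ord h = t" by (rule dvd_antisym)
  then show ?thesis using that h(1) hc g(2) by blast
qed

lemma dihedral_like_iso:
  assumes u: "u \<in> carrier G" "ord u = p" and y: "y \<in> carrier G" "ord y = t"
    and conj: "y \<otimes> u \<otimes> inv y = u [^] (p - 1)" and n: "order G = p * t" "coprime p t" "even t"
  shows "G \<cong> inv_sdp p t \<times>\<times> cyc 1"
proof -
  have t0: "t > 0" "p > 0" using n(1) order_pos by (auto intro!: gr0I)
  have "inv_sdp p t \<cong> G"
  proof (rule metacyclic_iso [OF inv_sdp_metacyclic t0(1) u y(1) _ conj n(1)])
    show "y [^] t = u [^] (0::nat)" using y by (simp add: pow_eq_id)
    fix b assume b: "0 < b" "b < t"
    show "y [^] b \<notin> generate G {u}"
    proof
      assume "y [^] b \<in> generate G {u}"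
      then have "ord (y [^] b) dvd p" using order_dvd_subgroup [OF generate_subgroup [OF u(1)]] u by simp
      moreover have "ord (y [^] b) dvd t"
        using y by (simp flip: pow_eq_id add: nat_pow_pow mult.commute) (simp add: pow_eq_id nat_pow_pow)
      ultimately have "ord (y [^] b) = 1" using n(2) by (meson coprime_def nat_dvd_1_iff_1)
      then have "y [^] b = \<one>" using ord_eq_1 y(1) by simp
      then have "t dvd b" using y by (simp add: pow_eq_id)
      then show False using b by (simp add: dvd_imp_le leD)
    qed
  qed
  moreover have "fin_group (inv_sdp p t)" using fin_group_inv_sdp(1) t0 n(3) by blast
  ultimately show ?thesis using iso_sym_to_product [OF fin_group_axioms] by blast
qed

end

text \<open>An element outside \<open>K\<close> has even order. As \<open>card K\<close> is odd, its
  index in the group is odd, and it is not 1, so it is at least 3.\<close>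

lemma psi_index_2_noncyclic:
  assumes "fin_group H" "subgroup K H" "order H = 2 * card K" "odd (card K)" "\<not> cyclic_group H"
  shows "3 * psi H \<le> 3 * (\<Sum>z\<in>K. group.ord H z) + 2 * (card K)\<^sup>2"
proof -
  interpret fin_group H by (rule assms(1))
  have "ord z * 3 \<le> 2 * card K" if z: "z \<in> carrier H - K" for z
  proof -
    have zc: "z \<in> carrier H" using z by blast
    have "even (ord z)" using index_2_odd [OF assms(2,3) zc] z by blast
    then obtain j where j: "ord z = 2 * j" by auto
    obtain d where d: "order H = ord z * d" using ord_dvd_group_order [OF zc] by auto
    then have dK: "card K = j * d" using j assms(3) by simp
    have "d \<noteq> 1" using assms(5) zc d unfolding cyclic_group_iff by auto
    moreover have "odd d" using assms(4) dK by simp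
    ultimately have "d \<ge> 3" by presburger
    then have "j * 3 \<le> card K" unfolding dK by simp
    then show ?thesis using j by simp
  qed
  then have "(\<Sum>z\<in>carrier H - K. ord z * 3) \<le> (\<Sum>z\<in>carrier H - K. 2 * card K)" by (intro sum_mono)
  moreover have "card (carrier H - K) = card K"
    using card_Diff_subset [OF subgroup_finite [OF assms(2)] subgroup.subset [OF assms(2)]] assms(3) by (simp add: order_def)
  ultimately have "(\<Sum>z\<in>carrier H - K. ord z) * 3 \<le> 2 * (card K)\<^sup>2"
    by (simp add: sum_distrib_right power2_eq_square)
  then show ?thesis using psi_split [OF subgroup.subset [OF assms(2)]] by linarith
qed

context fin_group
begin

text \<open>\<open>K\<close>, the image of the centralizer, is a proper subgroup of the quotient
  \<open>H\<close>, of index \<open>r \<ge> 2\<close>; since \<psi> is largest on cyclic groups, the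
  sum \<open>s\<close> over \<open>K\<close> is a small part of \<open>cpsi t\<close>. The same
  inequality is spent three times: to limit \<open>q\<close>, to limit \<open>r\<close> and the
  2-part of \<open>t\<close>, and to force \<open>H\<close> to be cyclic.\<close>

lemma noncentral_sylow_class:
  assumes IH: "\<And>K. subgroup K G \<Longrightarrow> card K < order G \<Longrightarrow>
      19 * cpsi (card K) < 43 * psi (G\<lparr>carrier := K\<rparr>) \<Longrightarrow> \<exists>i\<in>{1..7}. in_class i (G\<lparr>carrier := K\<rparr>)"
    and psi: "19 * cpsi (order G) < 43 * psi G"
    and p: "prime p" "p \<ge> 3" "\<And>r. prime r \<Longrightarrow> r dvd order G \<Longrightarrow> r \<le> p"
    and n: "order G = p ^ a * t" "\<not> p dvd t" "a > 0"
    and u: "u \<in> carrier G" "ord u = p ^ a" "generate G {u} \<lhd> G"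
    and nc: "\<not> (\<forall>g\<in>carrier G. g \<otimes> u = u \<otimes> g)"
  shows "\<exists>i\<in>{1..7}. in_class i G"
proof -
  define q where "q = p ^ a"
  define H where "H = G Mod generate G {u}"
  define K where "K = {c \<in> carrier H. \<forall>g\<in>c. g \<otimes> u = u \<otimes> g}"
  define s where "s = (\<Sum>c\<in>K. group.ord H c)"
  note B = psi_le_cyclic_normal_sylow [OF p(1) n(1,2) u, folded H_def, folded K_def, folded s_def q_def]
  interpret H: fin_group H by (rule B(2))
  have oH: "order H = t" by (rule B(1))
  have KH: "subgroup K H" by (rule B(3))
  have Kne: "K \<noteq> carrier H" using B(4) nc by blast
  have q0: "q > 0" using p by (simp add: q_def prime_gt_0_nat)
  have t0: "t > 0" using oH H.order_pos by simp
  have ct: "coprime q t" using n(2) p(1) by (simp add: q_def prime_imp_coprime)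
  obtain w where w: "w = card K" by simp
  have wt: "w dvd t" using H.subgroup_card_dvd [OF KH] oH w by simp
  then obtain r where r: "t = r * w" by (metis dvd_def mult.commute)
  have w0: "w > 0" using r t0 by (intro gr0I) simp
  have r2: "r \<ge> 2"
  proof (rule ccontr)
    assume "\<not> r \<ge> 2"
    moreover have "r \<noteq> 0" using r t0 by (intro notI) simp
    ultimately have "r = 1" by linarith
    then have "card K = card (carrier H)" using r w oH by (simp add: order_def)
    then have "K = carrier H" using card_subset_eq [OF H.fin subgroup.subset [OF KH]] by blast
    then show False using Kne by contradiction
  qed
  have sw: "s \<le> cpsi w"
  proof -
    interpret FK: fin_group "H\<lparr>carrier := K\<rparr>" by (rule H.subgroup_fin_group [OF KH])
    show ?thesis using FK.psi_le_cpsi H.psi_subgroup [OF KH] w by (simp add: s_def H.order_subgroup)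
  qed
  have c3: "3 * cpsi w \<le> cpsi t" unfolding r by (rule cpsi_mult_ge3 [OF r2 w0])
  have Hc: "psi H \<le> cpsi t" using H.psi_le_cpsi oH by simp
  have cG: "cpsi (order G) = cpsi q * cpsi t"
    unfolding n(1) q_def [symmetric] by (rule cpsi_mult [OF ct q0 t0])
  obtain d where d: "cpsi q = q + d" using cpsi_ge_self [of q] by (metis le_add_diff_inverse)
  have main: "psi G \<le> q * psi H + d * s" using B(5) unfolding d by (simp add: algebra_simps)
  have "19 * ((q + d) * cpsi t) < 43 * psi G" using psi unfolding cG d .
  then have main': "19 * ((q + d) * cpsi t) < 43 * (q * psi H + d * s)"
    using mult_le_mono2 [OF main, of 43] by (rule less_le_trans)
  \<comment> \<open>Inserting \<open>psi H \<le> cpsi t\<close> and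
    \<open>3 * s \<le> cpsi t\<close> leaves \<open>57 * (q + d) < 129 * q + 43 * d\<close>, that
    is, \<open>7 * d < 36 * q\<close>.\<close>
  have "7 * cpsi q < 43 * q"
  proof (rule ccontr)
    assume "\<not> 7 * cpsi q < 43 * q"
    then have "43 * q \<le> 7 * (q + d)" using d by simp
    then have dq: "36 * q \<le> 7 * d" by simp
    have ds: "3 * (d * s) \<le> d * cpsi t"
      using mult_le_mono2 [of "3 * s" "cpsi t" d] sw c3 by (simp only: mult.left_commute [of d 3])
    have qH: "q * psi H \<le> q * cpsi t" using Hc by simp
    have arith: "3 * x < 43 * (3 * A + C)" if "x < 43 * (B + E)" "3 * E \<le> C" "B \<le> A" for x A B C E :: nat
      using that by simp
    have "3 * (19 * ((q + d) * cpsi t)) < 43 * (3 * (q * cpsi t) + d * cpsi t)"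
      by (rule arith [OF main' ds qH])
    then have "(57 * (q + d)) * cpsi t < (129 * q + 43 * d) * cpsi t" by (simp add: algebra_simps)
    then have "57 * (q + d) < 129 * q + 43 * d" by (simp only: mult_less_cancel2)
    then show False using dq by simp
  qed
  then have q35: "q = 3 \<or> q = 5" using odd_prime_power_bound [OF p(1,2) n(3)] by (simp add: q_def)
  have pq: "p = q"
  proof -
    have "p dvd q" using n(3) by (simp add: q_def)
    moreover have "prime q" using q35 prime_3 prime_5 by auto
    ultimately show ?thesis using p(1) primes_dvd_imp_eq by blast
  qed
  have pt: "r' < q \<and> r' \<noteq> q" if "prime r'" "r' dvd t" for r'
  proof -
    have "r' dvd order G" using that(2) n(1) by simp
    then have "r' \<le> q" using p(3) that(1) pq by simp
    moreover have "r' \<noteq> q" using that n(2) pq by auto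
    ultimately show ?thesis by simp
  qed
  have P: "card (generate G {u}) = q" using u by (simp add: q_def)
  have nq: "order G = q * t" using n(1) by (simp add: q_def)
  have uq: "ord u = q" using u(2) by (simp add: q_def)
  \<comment> \<open>\<open>y\<close> lifts a generator of \<open>H\<close>. If it centralized
    \<open>u\<close>, the order of the centralizer would be divisible by \<open>q\<close> and by
    \<open>t\<close>, making \<open>u\<close> central.\<close>
  have gen: "\<exists>y c. y \<in> carrier G \<and> ord y = t \<and> y \<otimes> u \<otimes> inv y = u [^] (c::nat) \<and> \<not> [c = 1] (mod q)
      \<and> (\<exists>c0\<in>carrier H. y \<in> c0)"
    if cyc: "cyclic_group H"
  proof -
    obtain c0 where c0: "c0 \<in> carrier H" "H.ord c0 = t"
      using cyc oH unfolding H.cyclic_group_iff by auto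
    obtain y where y: "y \<in> c0" "y \<in> carrier G" "ord y = t"
      using lift_generator [OF u(3) P nq ct] c0 unfolding H_def by blast
    obtain c :: nat where c: "y \<otimes> u \<otimes> inv y = u [^] c" using conj_eq_pow [OF u(3) y(2) u(1)] by blast
    have "\<not> [c = 1] (mod q)"
    proof
      assume "[c = 1] (mod q)"
      then have "int q dvd int c - int 1" by (metis cong_iff_dvd_diff cong_int_iff)
      then have "u [^] c = u [^] (1::nat)" unfolding pow_eq_iff_nat [OF u(1)] uq .
      then have yu: "y \<otimes> u = u \<otimes> y" using c commute_iff_conj [OF y(2) u(1)] u(1) by simp
      define C where "C = {g \<in> carrier G. g \<otimes> u = u \<otimes> g}"
      have C: "subgroup C G" unfolding C_def by (rule centralizer_subgroup [OF u(1)])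
      have "q dvd card C" using order_dvd_subgroup [OF C, of u] u(1) uq by (simp add: C_def)
      moreover have "t dvd card C" using order_dvd_subgroup [OF C, of y] y yu by (simp add: C_def)
      ultimately have "order G dvd card C" unfolding nq using ct by (intro divides_mult)
      moreover have "card C > 0" using subgroup.finite_imp_card_positive [OF C fin] .
      ultimately have "order G \<le> card C" by (intro dvd_imp_le)
      then have "C = carrier G"
        using card_seteq [OF fin subgroup.subset [OF C]] by (simp add: order_def)
      then show False using nc unfolding C_def by blast
    qed
    then show ?thesis using y c c0(1) by blast
  qed
  show ?thesis
  proof (cases "q = 3")
    case q3: True
    have d4: "d = 4" using d cpsi_small q3 by simp
    obtain e m where e: "t = 2 ^ e * m" "\<not> 2 dvd m" "m > 0"
      using decompose_prime_power [OF two_is_prime_nat t0] by metis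
    have "m = 1"
    proof (rule ccontr)
      assume "m \<noteq> 1"
      then obtain r' where r': "prime r'" "r' dvd m" using prime_factor_nat by blast
      then have "r' < 3" using pt [of r'] e(1) q3 by simp
      then have "r' = 2" using prime_ge_2_nat [OF r'(1)] by linarith
      then show False using r'(2) e(2) by simp
    qed
    then have te: "t = 2 ^ e" using e by simp
    have "e \<noteq> 0"
    proof
      assume "e = 0"
      then have "r * w = 1" using te r by simp
      then show False using r2 by simp
    qed
    then have et: "even t" using te by simp
    have "even r"
    proof -
      have "r dvd 2 ^ e" using r te by (metis dvd_triv_left)
      then obtain j where "r = 2 ^ j" using divides_primepow_nat [OF two_is_prime_nat] by blast
      then show ?thesis using r2 by (cases j) auto
    qed
    then obtain r' where r': "r = 2 * r'" by auto
    define h where "h = t div 2"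
    have h: "t = 2 * h" using et by (simp add: h_def)
    have hr: "h = r' * w" using h r r' by simp
    have "r' > 0" using r2 r' by simp
    then have "cpsi w \<le> cpsi h" unfolding hr using cpsi_mono_mult w0 by blast
    then have sh: "s \<le> cpsi h" using sw by simp
    have h2: "h = 2 ^ (e - 1)" using h te \<open>e \<noteq> 0\<close> by (cases e) auto
    have ch: "3 * cpsi h = 2 * h\<^sup>2 + 1" using cpsi_2_power_ge [of "e - 1"] by (simp add: h2)
    have ctt: "3 * cpsi t = 8 * h\<^sup>2 + 1" using cpsi_2_power_ge [of e] by (simp flip: te) (simp add: h power_mult_distrib)
    have "cyclic_group H"
    proof (rule ccontr)
      \<comment> \<open>In terms of \<open>h = t / 2\<close>, the bounds
        \<open>psi H \<le> 7 * h^2 / 4\<close> and \<open>s \<le> (2 * h^2 + 1) / 3\<close> meet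
        \<open>cpsi t = (8 * h^2 + 1) / 3\<close>; what remains is
        \<open>171 * h^2 < 156\<close>.\<close>
      assume ncy: "\<not> cyclic_group H"
      have "16 * psi H \<le> 7 * t\<^sup>2" using H.psi_noncyclic_2_group [OF _ ncy, of e] oH te by simp
      then have 1: "4 * psi H \<le> 7 * h\<^sup>2" by (simp add: h power_mult_distrib)
      have "19 * (7 * cpsi t) < 43 * (3 * psi H + 4 * s)" using main' by (simp add: q3 d4)
      then have "12 * (19 * (7 * cpsi t)) < 12 * (43 * (3 * psi H + 4 * s))" by simp
      moreover have "12 * (43 * (3 * psi H + 4 * s)) = 43 * (9 * (4 * psi H) + 48 * s)" by simp
      moreover have "43 * (9 * (4 * psi H) + 48 * s) \<le> 43 * (9 * (7 * h\<^sup>2) + 48 * cpsi h)"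
        using 1 sh by (intro mult_le_mono2 add_mono)
      moreover have "43 * (9 * (7 * h\<^sup>2) + 48 * cpsi h) = 43 * (63 * h\<^sup>2 + 16 * (2 * h\<^sup>2 + 1))"
        unfolding ch [symmetric] by simp
      moreover have "12 * (19 * (7 * cpsi t)) = 532 * (8 * h\<^sup>2 + 1)" unfolding ctt [symmetric] by simp
      ultimately have "532 * (8 * h\<^sup>2 + 1) < 43 * (63 * h\<^sup>2 + 16 * (2 * h\<^sup>2 + 1))" by linarith
      then have "171 * h\<^sup>2 < 156" by simp
      moreover have "h\<^sup>2 > 0" using h t0 by simp
      ultimately show False by simp
    qed
    then obtain y c where y: "y \<in> carrier G" "ord y = t" "y \<otimes> u \<otimes> inv y = u [^] (c::nat)" "\<not> [c = 1] (mod q)"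
      using gen by blast
    have "u [^] c \<noteq> \<one>"
    proof
      assume "u [^] c = \<one>"
      then have "ord (y \<otimes> u \<otimes> inv y) = 1" using y(3) by simp
      then show False using ord_conj [OF y(1) u(1)] uq q3 by simp
    qed
    then have "\<not> 3 dvd c" using u(1) uq q3 by (simp add: pow_eq_id)
    then have "c mod 3 = 2" using y(4) q3 unfolding cong_def by presburger
    then have "u [^] c = u [^] (2::nat)" using pow_mod_ord [OF u(1), of c] uq q3 by simp
    then have "G \<cong> inv_sdp 3 t \<times>\<times> cyc 1"
      using dihedral_like_iso [OF u(1) uq y(1,2) _ nq ct et] y(3) q3 by simp
    then have "\<exists>k m. k \<ge> 1 \<and> gcd m 6 = 1 \<and> G \<cong> inv_sdp 3 (2 ^ k) \<times>\<times> cyc m"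
      using te \<open>e \<noteq> 0\<close> by (intro exI [of _ e] exI [of _ "1::nat"]) simp
    then show ?thesis by (intro bexI [of _ 5]) (simp_all add: in_class_def)
  next
    case False
    then have q5: "q = 5" using q35 by simp
    have d16: "d = 16" using d cpsi_small q5 by simp
    have m5: "399 * cpsi t < 43 * (5 * psi H + 16 * s)" using main' by (simp add: q5 d16)
    have pr: "r' = 2 \<or> r' = 3" if "prime r'" "r' dvd t" for r'
    proof -
      have "r' < 5" using pt [OF that] q5 by simp
      moreover have "r' \<noteq> 4" using that(1) by (auto simp: prime_nat_numeral_eq)
      ultimately show ?thesis using prime_ge_2_nat [OF that(1)] by linarith
    qed
    \<comment> \<open>A larger \<open>r\<close> gives \<open>7 * s \<le> cpsi t\<close>, and then
      \<open>7 * 399 = 2793\<close> would be below \<open>43 * 51 = 2193\<close>.\<close>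
    have "r = 2"
    proof (rule ccontr)
      assume "r \<noteq> 2"
      then have "7 * cpsi w \<le> cpsi t" unfolding r by (intro cpsi_mult_ge7 w0) (use r2 in simp)
      then have "7 * s \<le> cpsi t" using sw by simp
      then have "43 * (7 * (5 * psi H + 16 * s)) \<le> 43 * (35 * cpsi t + 16 * cpsi t)" using Hc by simp
      moreover have "7 * (399 * cpsi t) < 43 * (7 * (5 * psi H + 16 * s))" using m5 by simp
      ultimately have "7 * (399 * cpsi t) < 43 * (35 * cpsi t + 16 * cpsi t)" by linarith
      then show False by simp
    qed
    then have t2: "t = 2 * w" using r by simp
    \<comment> \<open>If 4 divides \<open>w\<close>, then \<open>43 * s \<le> 11 * cpsi t\<close>,
      and \<open>215 + 176 = 391\<close> does not reach 399. This is what keeps classes 6 and 7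
      finite in the 2-part.\<close>
    have n4: "\<not> 4 dvd w"
    proof
      assume "4 dvd w"
      then have "43 * cpsi w \<le> 11 * cpsi t" unfolding t2 using cpsi_double w0 by blast
      then have "43 * s \<le> 11 * cpsi t" using sw by simp
      then have "43 * (5 * psi H + 16 * s) \<le> 215 * cpsi t + 176 * cpsi t" using Hc by simp
      then show False using m5 by simp
    qed
    have c34: "3 * v\<^sup>2 \<le> 4 * cpsi v" if "v dvd t" "odd v" for v
    proof -
      have v0: "v > 0" using that(2) by (auto intro: gr0I)
      have "r' \<in> {3}" if r': "prime r'" "r' dvd v" for r'
      proof -
        have "r' dvd t" using r'(2) \<open>v dvd t\<close> by (rule dvd_trans)
        then have "r' = 2 \<or> r' = 3" using pr r'(1) by blast
        then show ?thesis using r'(2) \<open>odd v\<close> by auto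
      qed
      then show ?thesis using cpsi_ge_3 [OF v0] by blast
    qed
    have cycH: "cyclic_group H"
    proof (rule ccontr)
      assume ncy: "\<not> cyclic_group H"
      show False
      proof (cases "even w")
        \<comment> \<open>With \<open>t = 4 * v\<close>, everything is compared with
          \<open>cpsi v\<close>: \<open>3 * psi H\<close> is at most 32 and \<open>s\<close> at most
          3 times it, and \<open>43 * 304 = 13072\<close> falls short of
          \<open>3 * 399 * 11 = 13167\<close>.\<close>
        case True
        then obtain v where v: "w = 2 * v" by auto
        have "odd v" using n4 v by auto
        have v0: "v > 0" using w0 v by simp
        have tv: "t = 4 * v" using t2 v by simp
        have cw: "cpsi w = 3 * cpsi v"
          unfolding v using cpsi_mult [of 2 v] \<open>odd v\<close> v0 cpsi_small by (simp add: coprime_left_2_iff_odd)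
        have c4: "cpsi t = 11 * cpsi v"
          unfolding tv using cpsi_mult [of 4 v] coprime_2_power [OF \<open>odd v\<close>, of 2] v0 cpsi_small by simp
        have "psi H \<le> order H * (2 * v)"
          by (rule H.psi_le_order_mult) (use H.psi_noncyclic_le_half [OF ncy] oH tv in fastforce)
        then have "psi H \<le> 8 * v\<^sup>2" using oH tv by (simp add: power2_eq_square)
        moreover have "3 * v\<^sup>2 \<le> 4 * cpsi v" by (rule c34) (use tv \<open>odd v\<close> in auto)
        ultimately have "3 * psi H \<le> 32 * cpsi v" by linarith
        then have 1: "15 * psi H \<le> 160 * cpsi v" by simp
        have "48 * s \<le> 144 * cpsi v" using sw cw by simp
        then have "43 * (15 * psi H + 48 * s) \<le> 43 * (160 * cpsi v + 144 * cpsi v)"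
          using 1 by (intro mult_le_mono2 add_mono)
        moreover have "3 * (399 * cpsi t) < 43 * (15 * psi H + 48 * s)" using m5 by simp
        ultimately have "3 * (399 * cpsi t) < 43 * (160 * cpsi v + 144 * cpsi v)" by linarith
        then show False unfolding c4 by simp
      next
        \<comment> \<open>Here \<open>K\<close> has odd order and index 2, so
          \<open>psi_index_2_noncyclic\<close> applies; in units of \<open>cpsi w\<close>,
          \<open>43 * 229 = 9847\<close> is below \<open>9 * 399 * 3 = 10773\<close>.\<close>
        case od: False
        have c2: "cpsi t = 3 * cpsi w"
          unfolding t2 using cpsi_mult [of 2 w] od w0 cpsi_small by (simp add: coprime_left_2_iff_odd)
        have "3 * psi H \<le> 3 * s + 2 * w\<^sup>2"
          using psi_index_2_noncyclic [OF H.fin_group_axioms KH _ _ ncy] oH t2 w od by (simp add: s_def)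
        moreover have "3 * w\<^sup>2 \<le> 4 * cpsi w" by (rule c34) (use t2 od in auto)
        ultimately have "9 * psi H \<le> 17 * cpsi w" using sw by linarith
        then have 1: "45 * psi H \<le> 85 * cpsi w" by simp
        have "144 * s \<le> 144 * cpsi w" using sw by simp
        then have "43 * (45 * psi H + 144 * s) \<le> 43 * (85 * cpsi w + 144 * cpsi w)"
          by (intro mult_le_mono2 [of _ _ 43] add_mono [OF 1])
        moreover have "9 * (399 * cpsi t) < 43 * (45 * psi H + 144 * s)" using m5 by simp
        ultimately have "9 * (399 * cpsi t) < 43 * (85 * cpsi w + 144 * cpsi w)" by linarith
        then show False unfolding c2 using cpsi_pos [OF w0] by simp
      qed
    qed
    obtain y c c0 where y: "y \<in> carrier G" "ord y = t" "y \<otimes> u \<otimes> inv y = u [^] (c::nat)" "\<not> [c = 1] (mod q)"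
      and c0: "c0 \<in> carrier H" "y \<in> c0"
      using gen [OF cycH] by blast
    \<comment> \<open>\<open>K\<close> has index 2, so the square of the coset of \<open>y\<close>
      lies in \<open>K\<close>. The automorphism induced by \<open>y\<close> thus has order 2, and
      on a group of order 5 it is inversion.\<close>
    have y2u: "y [^] (2::nat) \<otimes> u = u \<otimes> y [^] (2::nat)"
    proof -
      have PG: "subgroup (generate G {u}) G" using u(1) by simp
      obtain g where g: "g \<in> carrier G" "c0 = generate G {u} #> g" using c0(1) by (auto simp: H_def carrier_FactGroup)
      have cy: "c0 = generate G {u} #> y" using repr_independence [OF _ g(1) PG] c0(2) g(2) by simp
      have "c0 [^]\<^bsub>H\<^esub> (2::nat) \<in> K" by (rule H.index_2_square [OF KH _ c0(1)]) (use oH t2 w in simp)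
      moreover have "c0 [^]\<^bsub>H\<^esub> (2::nat) = generate G {u} #> y [^] (2::nat)"
        unfolding cy H_def by (rule normal.FactGroup_pow [OF u(3) y(1)])
      ultimately show ?thesis using rcos_self [OF _ PG, of "y [^] (2::nat)"] y(1) by (auto simp: K_def)
    qed
    have "c mod 5 = 4"
    proof -
      have "u [^] (c ^ 2) = u [^] (1::nat)"
        using conj_iter [OF y(1) u(1) y(3), of 2] commute_iff_conj [of "y [^] (2::nat)" u] y2u y(1) u(1) by simp
      then have "int 5 dvd int (c ^ 2) - int 1" unfolding pow_eq_iff_nat [OF u(1)] uq q5 by simp
      then have "[c ^ 2 = 1] (mod 5)" by (metis cong_iff_dvd_diff cong_int_iff)
      then have "(c mod 5) ^ 2 mod 5 = 1" by (simp add: cong_def power_mod)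
      moreover have "c mod 5 \<noteq> 1" using y(4) q5 by (simp add: cong_def)
      moreover have "c mod 5 < 5" by simp
      then have "c mod 5 = 0 \<or> c mod 5 = 1 \<or> c mod 5 = 2 \<or> c mod 5 = 3 \<or> c mod 5 = 4" by linarith
      ultimately show ?thesis by auto
    qed
    then have cu: "y \<otimes> u \<otimes> inv y = u [^] (q - 1)" using pow_mod_ord [OF u(1), of c] uq q5 y(3) by simp
    have et: "even t" using t2 by simp
    obtain f m where f: "t = 3 ^ f * m" "\<not> 3 dvd m" "m > 0" "coprime (3 ^ f) m"
      using decompose_prime_power [OF prime_3 t0] by metis
    show ?thesis
    proof (cases "f = 0")
      case True
      have "w = 1 \<or> w = 2"
      proof -
        obtain j v where j: "w = 2 ^ j * v" "\<not> 2 dvd v" "v > 0"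
          using decompose_prime_power [OF two_is_prime_nat w0] by metis
        have "v = 1"
        proof (rule ccontr)
          assume "v \<noteq> 1"
          then obtain r' where r': "prime r'" "r' dvd v" using prime_factor_nat by blast
          then have "r' dvd t" using j(1) t2 by simp
          then have "r' = 2 \<or> r' = 3" using pr r'(1) by blast
          then show False using r'(2) j(2) f True \<open>r' dvd t\<close> by auto
        qed
        moreover have "j < 2"
        proof (rule ccontr)
          assume "\<not> j < 2"
          then have "(2::nat) ^ 2 dvd 2 ^ j" by (intro le_imp_power_dvd) simp
          then show False using n4 j(1) by simp
        qed
        ultimately show ?thesis using j(1) by (auto simp: less_2_cases_iff)
      qed
      moreover have iso: "G \<cong> inv_sdp 5 t \<times>\<times> cyc 1"
        using dihedral_like_iso [OF u(1) uq y(1,2) cu nq ct et] q5 by simp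
      have g1: "gcd (1::nat) 10 = 1" by simp
      ultimately show ?thesis
      proof (elim disjE)
        assume "w = 1"
        then have "\<exists>m. gcd m 10 = 1 \<and> G \<cong> inv_sdp 5 2 \<times>\<times> cyc m" using iso t2 g1 by (intro exI [of _ "1::nat"]) simp
        then show ?thesis by (intro bexI [of _ 6]) (simp_all add: in_class_def)
      next
        assume "w = 2"
        then have "\<exists>m. gcd m 10 = 1 \<and> G \<cong> inv_sdp 5 4 \<times>\<times> cyc m" using iso t2 g1 by (intro exI [of _ "1::nat"]) simp
        then show ?thesis by (intro bexI [of _ 7]) (simp_all add: in_class_def)
      qed
    next
      case f0: False
      \<comment> \<open>As \<open>m\<close> is even, \<open>z\<close> is a power of the square of
        \<open>y\<close> and commutes with \<open>u\<close>; it also commutes with \<open>y\<close>.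
        Its centralizer has order divisible by \<open>q\<close> and \<open>t\<close>, so
        \<open>z\<close> generates a central Sylow 3-subgroup, which splits off.\<close>
      have "even m" using et f(1) by simp
      then obtain m' where m': "m = 2 * m'" by auto
      define z where "z = y [^] m"
      have zc: "z \<in> carrier G" using y by (simp add: z_def)
      have oz: "ord z = 3 ^ f" unfolding z_def using ord_pow [OF y(1), of m] y(2) f(1,3) by simp
      have z2: "z = (y [^] (2::nat)) [^] m'" using y(1) by (simp add: z_def m' nat_pow_pow)
      have zu: "u \<otimes> z = z \<otimes> u"
        unfolding z2 using group_commutes_pow [OF y2u, of m'] y(1) u(1) by simp
      have zy: "y \<otimes> z = z \<otimes> y" unfolding z_def using nat_pow_comm [of y 1 m] y(1) by simp
      define C where "C = {g \<in> carrier G. g \<otimes> z = z \<otimes> g}"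
      have C: "subgroup C G" unfolding C_def by (rule centralizer_subgroup [OF zc])
      have "q dvd card C" using order_dvd_subgroup [OF C, of u] u(1) uq zu by (simp add: C_def)
      moreover have "t dvd card C" using order_dvd_subgroup [OF C, of y] y zy by (simp add: C_def)
      ultimately have "order G dvd card C" unfolding nq using ct by (intro divides_mult)
      moreover have "card C > 0" using subgroup.finite_imp_card_positive [OF C fin] .
      ultimately have "order G \<le> card C" by (intro dvd_imp_le)
      then have "C = carrier G"
        using card_seteq [OF fin subgroup.subset [OF C]] by (simp add: order_def)
      then have central: "g \<otimes> z = z \<otimes> g" if "g \<in> carrier G" for g using that unfolding C_def by blast
      have "order G = ord z * (5 * m)" unfolding nq q5 oz using f(1) by simp
      moreover have "coprime (ord z) (5 * m)"
      proof -
        have "coprime (3::nat) 5" using prime_imp_coprime [OF prime_3, of 5] by simp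
        then show ?thesis unfolding oz using f(4) by simp
      qed
      moreover have "odd (ord z)" unfolding oz by simp
      moreover have "ord z > 1" unfolding oz using f0 by (intro one_less_power) simp_all
      ultimately show ?thesis by (intro class_of_central_sylow [OF IH psi zc central, where t = "5 * m"])
    qed
  qed
qed

end

text \<open>Restricting the carrier to a subgroup keeps the type of the group, so the induction
  hypothesis covers the subgroups of \<open>G\<close>. Quotients enter only through the numerical
  bounds.\<close>

theorem in_class_exists:
  fixes G :: "('a, 'b) monoid_scheme"
  assumes "fin_group G" "19 * cpsi (order G) < 43 * psi G"
  shows "\<exists>i\<in>{1..7}. in_class i G"
  using assms
proof (induction "order G" arbitrary: G rule: less_induct)
  case less
  interpret fin_group G by (rule less.prems(1))
  note psi = less.prems(2)
  have IH: "\<exists>i\<in>{1..7}. in_class i (G\<lparr>carrier := K\<rparr>)"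
    if "subgroup K G" "card K < order G" "19 * cpsi (card K) < 43 * psi (G\<lparr>carrier := K\<rparr>)" for K
    using less.hyps [of "G\<lparr>carrier := K\<rparr>"] subgroup_fin_group [OF that(1)] that(2,3)
    by (simp add: order_subgroup)
  have two: ?case if "order G = 2 ^ k" for k
    using two_group_class [OF that psi] by (auto intro: bexI)
  show ?case
  proof (cases "order G = 1")
    case True
    then show ?thesis using two [of 0] by simp
  next
    case False
    then have "order G > 1" using order_pos by linarith
    then obtain p where p: "prime p" "p dvd order G" "\<And>r. prime r \<Longrightarrow> r dvd order G \<Longrightarrow> r \<le> p"
      using largest_prime_divisor by blast
    obtain a t where t: "order G = p ^ a * t" "\<not> p dvd t" "t > 0" "coprime (p ^ a) t"
      using decompose_prime_power [OF p(1) order_pos] by metis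
    have a0: "a > 0" using p(2) t by (intro gr0I) simp
    show ?thesis
    proof (cases "p = 2")
      case True
      have "t = 1"
      proof (rule ccontr)
        assume "t \<noteq> 1"
        then obtain r where r: "prime r" "r dvd t" using prime_factor_nat by blast
        then have "r \<le> 2" using p(3) [of r] t(1) True by simp
        then have "r = 2" using prime_ge_2_nat [OF r(1)] by linarith
        then show False using r t(2) True by simp
      qed
      then show ?thesis using two t(1) True by simp
    next
      case False
      then have p3: "p \<ge> 3" using prime_ge_2_nat [OF p(1)] by linarith
      obtain u where u: "u \<in> carrier G" "ord u = p ^ a" "generate G {u} \<lhd> G"
        using normal_cyclic_sylow [OF psi p(1) p3 p(2,3) t(1,2)] by blast
      show ?thesis
      proof (cases "\<forall>g\<in>carrier G. g \<otimes>\<^bsub>G\<^esub> u = u \<otimes>\<^bsub>G\<^esub> g")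
        case True
        show ?thesis
        proof (rule class_of_central_sylow [OF IH psi u(1), where t = t])
          show "g \<otimes>\<^bsub>G\<^esub> u = u \<otimes>\<^bsub>G\<^esub> g" if "g \<in> carrier G" for g using True that by blast
          show "odd (ord u)" using u(2) p(1) p3 prime_odd_nat [of p] by simp
          show "ord u > 1" unfolding u(2) using p3 a0 by (intro one_less_power) simp_all
          show "order G = ord u * t" "coprime (ord u) t" unfolding u(2) by (rule t)+
        qed
      next
        case False
        show ?thesis by (rule noncentral_sylow_class [OF IH psi p(1) p3 p(3) t(1,2) a0 u False])
      qed
    qed
  qed
qed

theorem theoremA:
  fixes G :: "('a, 'b) monoid_scheme"
  assumes "group G" and "finite (carrier G)"
    and "psi' G > 19 / 43"
  shows "M_group G \<and> (\<exists>!i. i \<in> {1..7} \<and> in_class i G)"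
proof -
  interpret fin_group G using assms by (simp add: fin_group_def fin_group_axioms_def)
  have c: "psi (cyc (order G)) = cpsi (order G)" by (rule psi_cyc) simp
  have "cpsi (order G) > 0" by (rule cpsi_pos) simp
  then have "19 * real (cpsi (order G)) < 43 * real (psi G)"
    using assms(3) unfolding psi'_def c by (simp add: field_simps)
  then have "19 * cpsi (order G) < 43 * psi G" by (metis of_nat_less_iff of_nat_mult of_nat_numeral)
  then obtain i where i: "i \<in> {1..7}" "in_class i G" using in_class_exists fin_group_axioms by blast
  have "M_group G" by (rule in_class_M_group [OF is_group i(2,1)])
  moreover have "\<exists>!i. i \<in> {1..7} \<and> in_class i G"
    using i in_class_unique [OF is_group] by blast
  ultimately show ?thesis ..
qed

end
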